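(* Let $\lambda\in P$, let $\Gamma_1=(\beta_1,\dots,\beta_r)$ be a $\lambda$-chain such that for some $t\ge0$, $q\ge1$ with $t+q\le r$, $(\beta_{t+1},\dots,\beta_{t+q})=(\alpha,s_\alpha(\beta),s_\alpha s_\beta(\alpha),\dots,s_\beta(\alpha),\beta)$ for some $\alpha,\beta\in\Delta$ with $\langle\alpha,\beta^\vee\rangle\le0$, $\alpha\ne-\beta$, and let $\Gamma_2=(\beta_1,\dots,\beta_t,\beta_{t+q},\dots,\beta_{t+1},\beta_{t+q+1},\dots,\beta_r)$. Fix $w\in W$. Then there exist subsets $\mathcal A_0(w,\Gamma_k)\subseteq\mathcal A(w,\Gamma_k)$ ($k=1,2$), a bijection $Y:\mathcal A_0(w,\Gamma_1)\to\mathcal A_0(w,\Gamma_2)$ and involutions $I_k$ of $\mathcal A_0^C(w,\Gamma_k):=\mathcal A(w,\Gamma_k)\setminus\mathcal A_0(w,\Gamma_k)$ such that: for all $A\in\mathcal A_0(w,\Gamma_1)$, $Y(A)^{(1)}=A^{(1)}$, $\mathrm{end}^{(2)}(Y(A))=\mathrm{end}^{(2)}(A)$, $Y(A)^{(3)}=A^{(3)}$, $\mathrm{down}(Y(A))=\mathrm{down}(A)$, $(-1)^{n(Y(A))}=(-1)^{n(A)}$, $\mathrm{wt}(Y(A))=\mathrm{wt}(A)$ and $\mathrm{height}(Y(A))=\mathrm{height}(A)$; and for $k=1,2$ and all $A\in\mathcal A_0^C(w,\Gamma_k)$, $I_k(A)^{(1)}=A^{(1)}$, $\mathrm{end}^{(2)}(I_k(A))=\mathrm{end}^{(2)}(A)$,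 $I_k(A)^{(3)}=A^{(3)}$, $\mathrm{down}(I_k(A))=\mathrm{down}(A)$, $(-1)^{n(I_k(A))}=-(-1)^{n(A)}$, $\mathrm{wt}(I_k(A))=\mathrm{wt}(A)$ and $\mathrm{height}(I_k(A))=\mathrm{height}(A)$.
   Context: Let $\mathfrak g$ be a complex simple Lie algebra or of type $A_1\times A_1$, with root system $\Delta$, positive roots $\Delta^+$, simple roots $\alpha_i$ ($i\in I$), coroots $\alpha^\vee$, weight lattice $P=\sum_i\mathbb Z\varpi_i$ ($\varpi_i$ fundamental weights), $\mathfrak h^*_{\mathbb R}=P\otimes\mathbb R$, Weyl group $W$ with length $\ell$, reflections $s_\alpha$, $\rho=\frac12\sum_{\alpha\in\Delta^+}\alpha$. For $\alpha\in\Delta$, $\mathrm{sgn}(\alpha)=\pm1$ according as $\alpha\in\pm\Delta^+$, $|\alpha|=\mathrm{sgn}(\alpha)\alpha$. $\mathrm{QBG}(W)$: vertices $W$, edge $x\xrightarrow{\gamma}xs_\gamma$ ($\gamma\in\Delta^+$) iff $\ell(xs_\gamma)=\ell(x)+1$ (Bruhat edge) or $\ell(xs_\gamma)=\ell(x)-2\langle\rho,\gamma^\vee\rangle+1$ (quantum edge). $H_{\alpha,k}=\{\nu:\langle\nu,\alpha^\vee\rangle=k\}$, $s_{\alpha,k}(\nu)=\nu-(\langle\nu,\alpha^\vee\rangle-k)\alpha$. Alcoves are connected components of the complement of all $H_{\alpha,k}$; $A\xrightarrow{\gamma}B$ means $A,B$ share a wall contained in some $H_{\gamma,k}$ with $\gamma$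 pointing from $A$ to $B$. $A_\circ=\{\nu:0<\langle\nu,\alpha^\vee\rangle<1\ \forall\alpha\in\Delta^+\}$, $A_\mu=A_\circ+\mu$. A $\lambda$-chain is a sequence of roots $(\beta_1,\dots,\beta_r)$ with alcoves $A_\circ=A_0\xrightarrow{-\beta_1}A_1\cdots\xrightarrow{-\beta_r}A_r=A_{-\lambda}$, consecutive ones adjacent; $l_k\in\mathbb Z$ is such that $H_{\beta_k,-l_k}$ contains the common wall of $A_{k-1},A_k$, and $\tilde l_k=\langle\lambda,\beta_k^\vee\rangle-l_k$. (For $\Gamma_2$, these integers are computed from $\Gamma_2$'s own alcove path.) $A=\{j_1<\dots<j_p\}$ is $w$-admissible if $w=w_0\xrightarrow{|\beta_{j_1}|}w_1\cdots\xrightarrow{|\beta_{j_p}|}w_p$ is a path in $\mathrm{QBG}(W)$; $\mathcal A(w,\Gamma)$ is the set of these. $\mathrm{end}(A)=w_p$; $\mathrm{wt}(A)=-w\,s_{\beta_{j_1},-l_{j_1}}\cdots s_{\beta_{j_p},-l_{j_p}}(-\lambda)$; $A^-=\{j_k: w_{k-1}\to w_k$ quantum$\}$; $\mathrm{down}(A)=\sum_{j\in A^-}|\beta_j|^\vee$; $\mathrm{height}(A)=\sum_{j\in A^-}\mathrm{sgn}(\beta_j)\tilde l_j$; $n(A)=\#\{j\in A:\beta_j\in-\Delta^+\}$. $A^{(1)}=A\cap\{1,\dots,t\}$, $A^{(2)}=A\cap\{t+1,\dots,t+q\}$, $A^{(3)}=A\cap\{t+q+1,\dots,r\}$; $\mathrm{end}^{(2)}(A)$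 is the vertex of the path of $A$ reached after the last step whose index lies in $A^{(1)}\cup A^{(2)}$. *)

theory Defs
  imports "HOL-Analysis.Analysis"
begin

text \<open>
  The Lie algebra enters only through its root system.  The real form of the dual of the Cartan
  subalgebra is a Euclidean space carrying a Weyl-invariant inner product (such as the one induced
  by the Killing form).  This inner product identifies the space with its dual, so that the coroot
  of \<open>\<alpha>\<close> becomes the vector \<open>2\<alpha> / (\<alpha>, \<alpha>)\<close>.
\<close>

section \<open>Root systems\<close>

definition coroot :: "'a::euclidean_space \<Rightarrow> 'a" where
  "coroot \<alpha> = (2 / (\<alpha> \<bullet> \<alpha>)) *\<^sub>R \<alpha>"

definition pairing :: "'a::euclidean_space \<Rightarrow> 'a \<Rightarrow> real" where
  "pairing \<nu> \<alpha> = \<nu> \<bullet> coroot \<alpha>"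

definition root_refl :: "'a::euclidean_space \<Rightarrow> 'a \<Rightarrow> 'a" where
  "root_refl \<alpha> \<nu> = \<nu> - pairing \<nu> \<alpha> *\<^sub>R \<alpha>"

text \<open>Reduced crystallographic root systems spanning the ambient space.\<close>

definition root_system :: "'a::euclidean_space set \<Rightarrow> bool" where
  "root_system \<Delta> \<longleftrightarrow>
     finite \<Delta> \<and> 0 \<notin> \<Delta> \<and> span \<Delta> = UNIV \<and>
     (\<forall>\<alpha>\<in>\<Delta>. \<forall>c::real. c *\<^sub>R \<alpha> \<in> \<Delta> \<longleftrightarrow> c = 1 \<or> c = -1) \<and>
     (\<forall>\<alpha>\<in>\<Delta>. \<forall>\<beta>\<in>\<Delta>. root_refl \<alpha> \<beta> \<in> \<Delta>) \<and>
     (\<forall>\<alpha>\<in>\<Delta>. \<forall>\<beta>\<in>\<Delta>. pairing \<beta> \<alpha> \<in> \<int>)"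

text \<open>The irreducible root systems are exactly those of the complex simple Lie algebras.\<close>

definition irreducible_roots :: "'a::euclidean_space set \<Rightarrow> bool" where
  "irreducible_roots \<Delta> \<longleftrightarrow>
     \<Delta> \<noteq> {} \<and>
     \<not> (\<exists>\<Delta>' \<Delta>''. \<Delta> = \<Delta>' \<union> \<Delta>'' \<and> \<Delta>' \<noteq> {} \<and> \<Delta>'' \<noteq> {} \<and>
          (\<forall>\<alpha>\<in>\<Delta>'. \<forall>\<beta>\<in>\<Delta>''. \<alpha> \<bullet> \<beta> = 0))"

definition type_A1_A1 :: "'a::euclidean_space set \<Rightarrow> bool" where
  "type_A1_A1 \<Delta> \<longleftrightarrow>
     (\<exists>\<alpha> \<beta>. \<alpha> \<noteq> 0 \<and> \<beta> \<noteq> 0 \<and> \<alpha> \<bullet> \<beta> = 0 \<and> \<Delta> = {\<alpha>, -\<alpha>, \<beta>, -\<beta>})"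

definition simple_system :: "'a::euclidean_space set \<Rightarrow> 'a set \<Rightarrow> bool" where
  "simple_system \<Delta> S \<longleftrightarrow>
     S \<subseteq> \<Delta> \<and> independent S \<and>
     (\<forall>\<alpha>\<in>\<Delta>. \<exists>c::'a \<Rightarrow> nat. \<alpha> = (\<Sum>\<beta>\<in>S. real (c \<beta>) *\<^sub>R \<beta>) \<or> \<alpha> = - (\<Sum>\<beta>\<in>S. real (c \<beta>) *\<^sub>R \<beta>))"

definition pos_roots :: "'a::euclidean_space set \<Rightarrow> 'a set \<Rightarrow> 'a set" where
  "pos_roots \<Delta> S = {\<alpha>\<in>\<Delta>. \<exists>c::'a \<Rightarrow> nat. \<alpha> = (\<Sum>\<beta>\<in>S. real (c \<beta>) *\<^sub>R \<beta>)}"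

definition root_sgn :: "'a::euclidean_space set \<Rightarrow> 'a set \<Rightarrow> 'a \<Rightarrow> real" where
  "root_sgn \<Delta> S \<alpha> = (if \<alpha> \<in> pos_roots \<Delta> S then 1 else -1)"

definition root_abs :: "'a::euclidean_space set \<Rightarrow> 'a set \<Rightarrow> 'a \<Rightarrow> 'a" where
  "root_abs \<Delta> S \<alpha> = root_sgn \<Delta> S \<alpha> *\<^sub>R \<alpha>"

definition weyl_vector :: "'a::euclidean_space set \<Rightarrow> 'a set \<Rightarrow> 'a" where
  "weyl_vector \<Delta> S = (1/2) *\<^sub>R (\<Sum>\<alpha>\<in>pos_roots \<Delta> S. \<alpha>)"

definition fund_weight :: "'a::euclidean_space set \<Rightarrow> 'a \<Rightarrow> 'a" where
  "fund_weight S \<alpha> = (THE \<nu>. \<forall>\<beta>\<in>S. pairing \<nu> \<beta> = (if \<beta> = \<alpha> then 1 else 0))"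

definition weight_lattice :: "'a::euclidean_space set \<Rightarrow> 'a set" where
  "weight_lattice S = {\<Sum>\<alpha>\<in>S. of_int (c \<alpha>) *\<^sub>R fund_weight S \<alpha> | c :: 'a \<Rightarrow> int. True}"

section \<open>The Weyl group and the quantum Bruhat graph\<close>

text \<open>Weyl group elements are represented by their action on the ambient space.\<close>

inductive_set weyl_group :: "'a::euclidean_space set \<Rightarrow> ('a \<Rightarrow> 'a) set" for \<Delta> where
  weyl_id: "id \<in> weyl_group \<Delta>"
| weyl_step: "w \<in> weyl_group \<Delta> \<Longrightarrow> \<alpha> \<in> \<Delta> \<Longrightarrow> w \<circ> root_refl \<alpha> \<in> weyl_group \<Delta>"

definition weyl_length :: "'a::euclidean_space set \<Rightarrow> ('a \<Rightarrow> 'a) \<Rightarrow> nat" where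
  "weyl_length S w =
     (LEAST n. \<exists>as. length as = n \<and> set as \<subseteq> S \<and> w = foldr (\<circ>) (map root_refl as) id)"

definition bruhat_edge ::
  "'a::euclidean_space set \<Rightarrow> 'a set \<Rightarrow> ('a \<Rightarrow> 'a) \<Rightarrow> 'a \<Rightarrow> ('a \<Rightarrow> 'a) \<Rightarrow> bool" where
  "bruhat_edge \<Delta> S x \<gamma> y \<longleftrightarrow>
     x \<in> weyl_group \<Delta> \<and> \<gamma> \<in> pos_roots \<Delta> S \<and> y = x \<circ> root_refl \<gamma> \<and>
     weyl_length S y = weyl_length S x + 1"

definition quantum_edge ::
  "'a::euclidean_space set \<Rightarrow> 'a set \<Rightarrow> ('a \<Rightarrow> 'a) \<Rightarrow> 'a \<Rightarrow> ('a \<Rightarrow> 'a) \<Rightarrow> bool" where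
  "quantum_edge \<Delta> S x \<gamma> y \<longleftrightarrow>
     x \<in> weyl_group \<Delta> \<and> \<gamma> \<in> pos_roots \<Delta> S \<and> y = x \<circ> root_refl \<gamma> \<and>
     real (weyl_length S y) = real (weyl_length S x) - 2 * pairing (weyl_vector \<Delta> S) \<gamma> + 1"

definition qbg_edge ::
  "'a::euclidean_space set \<Rightarrow> 'a set \<Rightarrow> ('a \<Rightarrow> 'a) \<Rightarrow> 'a \<Rightarrow> ('a \<Rightarrow> 'a) \<Rightarrow> bool" where
  "qbg_edge \<Delta> S x \<gamma> y \<longleftrightarrow> bruhat_edge \<Delta> S x \<gamma> y \<or> quantum_edge \<Delta> S x \<gamma> y"

section \<open>Alcoves and \<open>\<lambda>\<close>-chains\<close>

definition affine_hyp :: "'a::euclidean_space \<Rightarrow> int \<Rightarrow> 'a set" where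
  "affine_hyp \<alpha> k = {\<nu>. pairing \<nu> \<alpha> = of_int k}"

definition affine_refl :: "'a::euclidean_space \<Rightarrow> int \<Rightarrow> 'a \<Rightarrow> 'a" where
  "affine_refl \<alpha> k \<nu> = \<nu> - (pairing \<nu> \<alpha> - of_int k) *\<^sub>R \<alpha>"

definition alcoves :: "'a::euclidean_space set \<Rightarrow> 'a set set" where
  "alcoves \<Delta> = components (UNIV - (\<Union>\<alpha>\<in>\<Delta>. \<Union>k. affine_hyp \<alpha> k))"

definition common_wall :: "'a::euclidean_space set \<Rightarrow> 'a set \<Rightarrow> 'a set \<Rightarrow> bool" where
  "common_wall A B F \<longleftrightarrow> F facet_of closure A \<and> F facet_of closure B"

definition alcove_step :: "'a::euclidean_space set \<Rightarrow> 'a \<Rightarrow> 'a set \<Rightarrow> 'a set \<Rightarrow> bool" where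
  "alcove_step \<Delta> \<gamma> A B \<longleftrightarrow>
     A \<in> alcoves \<Delta> \<and> B \<in> alcoves \<Delta> \<and> \<gamma> \<in> \<Delta> \<and>
     (\<exists>F k. common_wall A B F \<and> F \<subseteq> affine_hyp \<gamma> k \<and>
        (\<forall>\<nu>\<in>A. pairing \<nu> \<gamma> < of_int k) \<and> (\<forall>\<nu>\<in>B. of_int k < pairing \<nu> \<gamma>))"

definition fund_alcove :: "'a::euclidean_space set \<Rightarrow> 'a set \<Rightarrow> 'a set" where
  "fund_alcove \<Delta> S = {\<nu>. \<forall>\<alpha>\<in>pos_roots \<Delta> S. 0 < pairing \<nu> \<alpha> \<and> pairing \<nu> \<alpha> < 1}"

definition shifted_alcove :: "'a::euclidean_space set \<Rightarrow> 'a set \<Rightarrow> 'a \<Rightarrow> 'a set" where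
  "shifted_alcove \<Delta> S \<mu> = (\<lambda>\<nu>. \<nu> + \<mu>) ` fund_alcove \<Delta> S"

text \<open>
  Chains are lists and positions are counted from 0: the root written \<open>\<beta>\<^sub>k\<close> in 1-based notation
  is \<open>\<Gamma> ! (k - 1)\<close>.  The list of alcoves is one longer than the list of roots.
\<close>

definition alcove_path ::
  "'a::euclidean_space set \<Rightarrow> 'a set \<Rightarrow> 'a list \<Rightarrow> 'a set list \<Rightarrow> bool" where
  "alcove_path \<Delta> S \<Gamma> As \<longleftrightarrow>
     length As = Suc (length \<Gamma>) \<and> As ! 0 = fund_alcove \<Delta> S \<and>
     (\<forall>j<length \<Gamma>. alcove_step \<Delta> (- (\<Gamma> ! j)) (As ! j) (As ! Suc j))"

definition lambda_chain :: "'a::euclidean_space set \<Rightarrow> 'a set \<Rightarrow> 'a \<Rightarrow> 'a list \<Rightarrow> bool" where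
  "lambda_chain \<Delta> S lam \<Gamma> \<longleftrightarrow>
     (\<exists>As. alcove_path \<Delta> S \<Gamma> As \<and> As ! length \<Gamma> = shifted_alcove \<Delta> S (- lam))"

text \<open>
  The alcove path is determined by the chain: an alcove has at most one wall with a given outward
  normal direction, and only one other alcove shares that wall.
\<close>

definition path_of :: "'a::euclidean_space set \<Rightarrow> 'a set \<Rightarrow> 'a list \<Rightarrow> 'a set list" where
  "path_of \<Delta> S \<Gamma> = (THE As. alcove_path \<Delta> S \<Gamma> As)"

definition chain_l :: "'a::euclidean_space set \<Rightarrow> 'a set \<Rightarrow> 'a list \<Rightarrow> nat \<Rightarrow> int" where
  "chain_l \<Delta> S \<Gamma> j =
     (THE l. \<exists>F. common_wall (path_of \<Delta> S \<Gamma> ! j) (path_of \<Delta> S \<Gamma> ! Suc j) F \<and>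
                 F \<subseteq> affine_hyp (\<Gamma> ! j) (- l))"

definition chain_l_tilde ::
  "'a::euclidean_space set \<Rightarrow> 'a set \<Rightarrow> 'a \<Rightarrow> 'a list \<Rightarrow> nat \<Rightarrow> real" where
  "chain_l_tilde \<Delta> S lam \<Gamma> j = pairing lam (\<Gamma> ! j) - of_int (chain_l \<Delta> S \<Gamma> j)"

text \<open>
  \<open>alternating \<alpha> \<beta>\<close> enumerates \<open>\<alpha>\<close>, \<open>s\<^sub>\<alpha> \<beta>\<close>, \<open>s\<^sub>\<alpha> s\<^sub>\<beta> \<alpha>\<close>, \<open>s\<^sub>\<alpha> s\<^sub>\<beta> s\<^sub>\<alpha> \<beta>\<close>, and so on.  This sequence is
  periodic; the string \<open>(\<alpha>, s\<^sub>\<alpha> \<beta>, \<dots>, s\<^sub>\<beta> \<alpha>, \<beta>)\<close> is cut off at the first occurrence of \<open>\<beta>\<close>.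
\<close>

fun alternating :: "'a::euclidean_space \<Rightarrow> 'a \<Rightarrow> nat \<Rightarrow> 'a" where
  "alternating \<alpha> \<beta> 0 = \<alpha>"
| "alternating \<alpha> \<beta> (Suc i) = root_refl \<alpha> (alternating \<beta> \<alpha> i)"

definition rank2_string :: "'a::euclidean_space \<Rightarrow> 'a \<Rightarrow> 'a list" where
  "rank2_string \<alpha> \<beta> = map (alternating \<alpha> \<beta>) [0..<Suc (LEAST i. alternating \<alpha> \<beta> i = \<beta>)]"

section \<open>Admissible subsets and their statistics\<close>

text \<open>
  \<open>walk \<Delta> S w \<Gamma> A m\<close> is the vertex reached from \<open>w\<close> after the steps whose position is in \<open>A\<close> and
  smaller than \<open>m\<close>, taken in increasing order.  The step at position \<open>j \<in> A\<close> thus goes from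
  \<open>walk \<Delta> S w \<Gamma> A j\<close> to \<open>walk \<Delta> S w \<Gamma> A (Suc j)\<close>.
\<close>

definition walk ::
  "'a::euclidean_space set \<Rightarrow> 'a set \<Rightarrow> ('a \<Rightarrow> 'a) \<Rightarrow> 'a list \<Rightarrow> nat set \<Rightarrow> nat \<Rightarrow> ('a \<Rightarrow> 'a)" where
  "walk \<Delta> S w \<Gamma> A m =
     fold (\<lambda>j x. x \<circ> root_refl (root_abs \<Delta> S (\<Gamma> ! j))) (sorted_list_of_set (A \<inter> {..<m})) w"

definition admissible ::
  "'a::euclidean_space set \<Rightarrow> 'a set \<Rightarrow> ('a \<Rightarrow> 'a) \<Rightarrow> 'a list \<Rightarrow> nat set set" where
  "admissible \<Delta> S w \<Gamma> =
     {A. A \<subseteq> {..<length \<Gamma>} \<and>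
         (\<forall>j\<in>A. qbg_edge \<Delta> S (walk \<Delta> S w \<Gamma> A j) (root_abs \<Delta> S (\<Gamma> ! j))
                           (walk \<Delta> S w \<Gamma> A (Suc j)))}"

definition adm_wt ::
  "'a::euclidean_space set \<Rightarrow> 'a set \<Rightarrow> 'a \<Rightarrow> ('a \<Rightarrow> 'a) \<Rightarrow> 'a list \<Rightarrow> nat set \<Rightarrow> 'a" where
  "adm_wt \<Delta> S lam w \<Gamma> A =
     - w (foldr (\<lambda>j. affine_refl (\<Gamma> ! j) (- chain_l \<Delta> S \<Gamma> j)) (sorted_list_of_set A) (- lam))"

definition quantum_steps ::
  "'a::euclidean_space set \<Rightarrow> 'a set \<Rightarrow> ('a \<Rightarrow> 'a) \<Rightarrow> 'a list \<Rightarrow> nat set \<Rightarrow> nat set" where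
  "quantum_steps \<Delta> S w \<Gamma> A =
     {j\<in>A. quantum_edge \<Delta> S (walk \<Delta> S w \<Gamma> A j) (root_abs \<Delta> S (\<Gamma> ! j))
                              (walk \<Delta> S w \<Gamma> A (Suc j))}"

definition adm_down ::
  "'a::euclidean_space set \<Rightarrow> 'a set \<Rightarrow> ('a \<Rightarrow> 'a) \<Rightarrow> 'a list \<Rightarrow> nat set \<Rightarrow> 'a" where
  "adm_down \<Delta> S w \<Gamma> A = (\<Sum>j\<in>quantum_steps \<Delta> S w \<Gamma> A. coroot (root_abs \<Delta> S (\<Gamma> ! j)))"

definition adm_height ::
  "'a::euclidean_space set \<Rightarrow> 'a set \<Rightarrow> 'a \<Rightarrow> ('a \<Rightarrow> 'a) \<Rightarrow> 'a list \<Rightarrow> nat set \<Rightarrow> real" where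
  "adm_height \<Delta> S lam w \<Gamma> A =
     (\<Sum>j\<in>quantum_steps \<Delta> S w \<Gamma> A. root_sgn \<Delta> S (\<Gamma> ! j) * chain_l_tilde \<Delta> S lam \<Gamma> j)"

definition neg_count :: "'a::euclidean_space set \<Rightarrow> 'a set \<Rightarrow> 'a list \<Rightarrow> nat set \<Rightarrow> nat" where
  "neg_count \<Delta> S \<Gamma> A = card {j\<in>A. \<Gamma> ! j \<in> uminus ` pos_roots \<Delta> S}"

end

theory Submission
  imports Defs
begin

text \<open>
  All hyperplanes crossed by the string pass through one point \<open>c\<close>.  Hence the weight depends only
  on \<open>A\<^sup>(\<^sup>1\<^sup>)\<close>, \<open>end\<^sup>(\<^sup>2\<^sup>)(A)\<close> and \<open>A\<^sup>(\<^sup>3\<^sup>)\<close>, and the string contributes to the height the pairing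
  of \<open>\<lambda> + c\<close> with its part of \<open>down(A)\<close>.  It therefore suffices that for given \<open>A\<^sup>(\<^sup>1\<^sup>)\<close>,
  \<open>end\<^sup>(\<^sup>2\<^sup>)(A)\<close>, \<open>A\<^sup>(\<^sup>3\<^sup>)\<close> and \<open>down(A)\<close> the admissible subsets counted with the sign
  \<open>(-1)\<^sup>n\<close> are equally many for both chains: then opposite signs are cancelled by involutions and
  what is left is matched by a bijection.

  This equality of signed counts says that the operators \<open>1 + Q\<^sub>\<gamma>\<close> satisfy the Yang-Baxter equation,
  where \<open>Q\<^sub>\<gamma>\<close> moves along the edges of the quantum Bruhat graph labelled \<open>\<gamma>\<close> and \<open>Q\<close> changes sign
  with \<open>\<gamma>\<close>.  Following Brenti, Fomin and Postnikov, \<open>Q\<^sub>\<gamma>\<close> is deformed: from \<open>x\<close> one moves to \<open>x s\<^sub>\<gamma>\<close> with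
  coefficient \<open>\<kappa> / (1 - E(\<gamma>))\<close> if \<open>x \<gamma>\<close> is positive and \<open>\<kappa> E(\<gamma>) / (1 - E(\<gamma>))\<close> otherwise, where
  \<open>E(\<gamma>) = exp \<langle>\<mu> - 2T\<rho>, \<gamma>\<^sup>\<or>\<rangle>\<close> and \<open>\<kappa> = exp T\<close>.  Up to right multiplication by the reflections, these
  operators are standard generators of a dihedral Hecke algebra plus scalars, so that the equation
  becomes a finite computation in that algebra.  After conjugation with \<open>exp (- T \<ell>(x))\<close> the limit
  \<open>T \<rightarrow> \<infinity>\<close> keeps exactly the Bruhat and quantum edges, because \<open>\<ell>(x) - \<ell>(x s\<^sub>\<gamma>) \<le> 2\<langle>\<rho>, \<gamma>\<^sup>\<or>\<rangle> - 1\<close> for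
  positive \<open>\<gamma>\<close>.  The different values of \<open>down\<close> are separated by varying \<open>\<mu>\<close>.
\<close>

section \<open>Reflections\<close>

text \<open>Whether an edge of the quantum Bruhat graph exists depends on lengths in all of
  \<open>W\<close>, so the operators \<open>1 + Q\<close> of a string cannot be read off from the
  dihedral group generated by its reflections. The coefficients of the deformation depend on x only
  through the signs of \<open>x \<gamma>\<close>, hence only on the position of x in its coset of
  that dihedral group. This is what makes the equation an identity of rank two. The exponents T and
  -2T\<rho> are chosen for the limit: after conjugation the exponent of a coefficient is T times 1 +
  \<ell>(x) - \<ell>(x s) or T times the same number minus twice the pairing of \<rho> and \<gamma>,
  and these vanish precisely on Bruhat and on quantum edges. The scalars \<kappa> E / (1 - E) obey
  an addition law because E is multiplicative in the coroot, and the inversion of E under \<gamma>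
  to -\<gamma> produces the sign of negative roots. Only numbers of subsets are compared, so neither
  the bijection nor the involutions are explicit.\<close>

lemma pairing_eq: "pairing \<nu> \<alpha> = 2 * (\<nu> \<bullet> \<alpha>) / (\<alpha> \<bullet> \<alpha>)"
  by (simp add: pairing_def coroot_def)

lemma pairing_add_left: "pairing (x + y) \<alpha> = pairing x \<alpha> + pairing y \<alpha>"
  and pairing_diff_left: "pairing (x - y) \<alpha> = pairing x \<alpha> - pairing y \<alpha>"
  and pairing_scaleR_left: "pairing (c *\<^sub>R x) \<alpha> = c * pairing x \<alpha>"
  by (simp_all add: pairing_def inner_left_distrib inner_diff_left)

lemma coroot_uminus: "coroot (- \<alpha>) = - coroot \<alpha>"
  by (simp add: coroot_def)

lemma pairing_uminus_right: "pairing x (- \<alpha>) = - pairing x \<alpha>"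
  by (simp add: pairing_def coroot_uminus)

lemma pairing_self: "\<alpha> \<noteq> 0 \<Longrightarrow> pairing \<alpha> \<alpha> = 2"
  by (simp add: pairing_eq)

lemma root_refl_uminus: "root_refl (- \<alpha>) = root_refl \<alpha>"
  by (simp add: root_refl_def pairing_uminus_right fun_eq_iff)

lemma linear_root_refl: "linear (root_refl \<alpha>)"
  by (rule linearI)
    (simp_all add: root_refl_def pairing_add_left pairing_scaleR_left algebra_simps)

text \<open>For \<alpha> = 0, division by zero makes \<open>coroot 0 = 0\<close>, so
  \<open>root_refl 0\<close> is the identity and both sides are 0.\<close>

lemma root_refl_self: "root_refl \<alpha> \<alpha> = - \<alpha>"
  by (cases "\<alpha> = 0") (simp_all add: root_refl_def pairing_self scaleR_2)

lemma root_refl_neg_arg: "root_refl \<alpha> (- x) = - root_refl \<alpha> x"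
  by (simp add: linear_neg linear_root_refl)

lemma pairing_root_refl_same: "pairing (root_refl \<alpha> x) \<alpha> = - pairing x \<alpha>"
  by (cases "\<alpha> = 0")
    (simp_all add: root_refl_def pairing_diff_left pairing_scaleR_left pairing_self
      pairing_eq[of _ 0])

lemma root_refl_involution [simp]: "root_refl \<alpha> (root_refl \<alpha> x) = x"
proof -
  have "root_refl \<alpha> (root_refl \<alpha> x) = root_refl \<alpha> x + pairing x \<alpha> *\<^sub>R \<alpha>"
    by (subst (1) root_refl_def) (simp add: pairing_root_refl_same)
  then show ?thesis by (simp add: root_refl_def)
qed

lemma root_refl_comp_self [simp]: "root_refl \<alpha> \<circ> root_refl \<alpha> = id"
  by (simp add: fun_eq_iff)

lemma orthogonal_root_refl: "orthogonal_transformation (root_refl \<alpha>)"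
proof (cases "\<alpha> = 0")
  case True
  then have "root_refl \<alpha> = id" by (simp add: fun_eq_iff root_refl_def)
  then show ?thesis using orthogonal_transformation_id by (metis id_apply eq_id_iff)
next
  case False
  then have "\<alpha> \<bullet> \<alpha> \<noteq> 0" by simp
  then have "root_refl \<alpha> x \<bullet> root_refl \<alpha> y = x \<bullet> y" for x y
    by (simp add: root_refl_def pairing_eq inner_diff_left inner_diff_right inner_commute)
  then show ?thesis by (simp add: orthogonal_transformation_def linear_root_refl)
qed

lemma orthogonal_coroot:
  assumes "orthogonal_transformation w" shows "coroot (w \<alpha>) = w (coroot \<alpha>)"
  using assms by (simp add: coroot_def orthogonal_transformation_def linear_scale)

lemma orthogonal_pairing:
  assumes "orthogonal_transformation w" shows "pairing (w x) (w \<alpha>) = pairing x \<alpha>"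
  using assms by (simp add: pairing_eq orthogonal_transformation_def)

lemma orthogonal_root_refl_conj:
  assumes "orthogonal_transformation w" shows "root_refl (w \<alpha>) (w x) = w (root_refl \<alpha> x)"
proof -
  have "linear w" using assms by (simp add: orthogonal_transformation_def)
  then show ?thesis
    by (simp add: root_refl_def orthogonal_pairing[OF assms] linear_diff linear_scale)
qed

lemma orthogonal_root_refl_conj_comp:
  "orthogonal_transformation w \<Longrightarrow> root_refl (w \<alpha>) \<circ> w = w \<circ> root_refl \<alpha>"
  by (simp add: fun_eq_iff orthogonal_root_refl_conj)

lemma root_refl_root_refl:
  "root_refl (root_refl \<alpha> \<gamma>) = root_refl \<alpha> \<circ> root_refl \<gamma> \<circ> root_refl \<alpha>"
proof -
  have "root_refl (root_refl \<alpha> \<gamma>) x = root_refl \<alpha> (root_refl \<gamma> (root_refl \<alpha> x))" for x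
    using orthogonal_root_refl_conj[OF orthogonal_root_refl, of \<alpha> \<gamma> "root_refl \<alpha> x"] by simp
  then show ?thesis by (simp add: fun_eq_iff)
qed

section \<open>Positive roots and the length function\<close>

text \<open>The products of simple reflections over which \<open>weyl_length\<close>
  minimises.\<close>

definition simple_word :: "'a::euclidean_space list \<Rightarrow> 'a \<Rightarrow> 'a" where
  "simple_word as = foldr (\<circ>) (map root_refl as) id"

lemma simple_word_Nil [simp]: "simple_word [] = id"
  and simple_word_Cons [simp]: "simple_word (a # as) = root_refl a \<circ> simple_word as"
  by (simp_all add: simple_word_def)

lemma simple_word_append [simp]: "simple_word (as @ bs) = simple_word as \<circ> simple_word bs"
  by (induction as) (simp_all add: comp_assoc)

lemma orthogonal_simple_word: "orthogonal_transformation (simple_word as)"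
proof (induction as)
  case Nil
  show ?case by (simp add: id_def)
next
  case (Cons a as)
  show ?case
    unfolding simple_word_Cons
    by (rule orthogonal_transformation_compose[OF orthogonal_root_refl Cons.IH])
qed

locale based_root_system =
  fixes \<Delta> S :: "'a::euclidean_space set"
  assumes root_system: "root_system \<Delta>" and simple_system: "simple_system \<Delta> S"
begin

abbreviation "Pos \<equiv> pos_roots \<Delta> S"
abbreviation "W \<equiv> weyl_group \<Delta>"

lemma finite_roots: "finite \<Delta>"
  and zero_not_root: "0 \<notin> \<Delta>"
  and root_refl_root: "\<alpha> \<in> \<Delta> \<Longrightarrow> \<gamma> \<in> \<Delta> \<Longrightarrow> root_refl \<alpha> \<gamma> \<in> \<Delta>"
  and pairing_Ints: "\<alpha> \<in> \<Delta> \<Longrightarrow> \<gamma> \<in> \<Delta> \<Longrightarrow> pairing \<gamma> \<alpha> \<in> \<int>"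
  and scaleR_root_iff: "\<alpha> \<in> \<Delta> \<Longrightarrow> c *\<^sub>R \<alpha> \<in> \<Delta> \<longleftrightarrow> c = 1 \<or> c = -1"
  using root_system unfolding root_system_def by auto

lemma uminus_root: "\<alpha> \<in> \<Delta> \<Longrightarrow> - \<alpha> \<in> \<Delta>"
  using scaleR_root_iff[of \<alpha> "-1"] by simp

lemma uminus_root_iff: "- \<alpha> \<in> \<Delta> \<longleftrightarrow> \<alpha> \<in> \<Delta>"
  using uminus_root[of \<alpha>] uminus_root[of "- \<alpha>"] by auto

lemma S_subset: "S \<subseteq> \<Delta>" and independent_S: "independent S"
  using simple_system unfolding simple_system_def by auto

lemma finite_S: "finite S"
  using S_subset finite_roots finite_subset by blast

lemma root_in_span: assumes "\<alpha> \<in> \<Delta>" shows "\<alpha> \<in> span S"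
proof -
  obtain c :: "'a \<Rightarrow> nat" where
    "\<alpha> = (\<Sum>\<beta>\<in>S. real (c \<beta>) *\<^sub>R \<beta>) \<or> \<alpha> = - (\<Sum>\<beta>\<in>S. real (c \<beta>) *\<^sub>R \<beta>)"
    using simple_system assms unfolding simple_system_def by blast
  moreover have "(\<Sum>\<beta>\<in>S. real (c \<beta>) *\<^sub>R \<beta>) \<in> span S"
    by (intro span_sum span_scale span_base)
  ultimately show ?thesis using span_neg by blast
qed

lemma span_S: "span S = UNIV"
proof -
  have "span \<Delta> \<subseteq> span S" using root_in_span span_minimal[OF _ subspace_span] by blast
  then show ?thesis using root_system unfolding root_system_def by auto
qed

section \<open>Coordinates in the simple roots and positivity\<close>

definition coord :: "'a \<Rightarrow> 'a \<Rightarrow> real" where "coord v b = representation S v b"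

lemma coord_add: "coord (x + y) b = coord x b + coord y b"
  and coord_diff: "coord (x - y) b = coord x b - coord y b"
  and coord_uminus: "coord (- x) b = - coord x b"
  and coord_scaleR: "coord (c *\<^sub>R x) b = c * coord x b"
  using independent_S span_S
  by (simp_all add: coord_def representation_add representation_diff representation_neg
      representation_scale)

lemma coord_simple: "b \<in> S \<Longrightarrow> coord b b' = (if b = b' then 1 else 0)"
  using independent_S by (simp add: coord_def representation_basis)

lemma coord_expand: "(\<Sum>b\<in>S. coord v b *\<^sub>R b) = v"
  using sum_representation_eq[OF independent_S _ finite_S order_refl] span_S
  by (simp add: coord_def)

lemma coord_sum: "coord (\<Sum>b\<in>S. f b *\<^sub>R b) b' = (if b' \<in> S then f b' else 0)"
proof -
  have lin: "coord (\<Sum>b\<in>B. f b *\<^sub>R b) b' = (\<Sum>b\<in>B. f b * coord b b')" if "finite B" for B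
    using that
  proof induction
    case empty
    then show ?case using coord_scaleR[of 0 0] by simp
  qed (simp add: coord_add coord_scaleR)
  have "coord (\<Sum>b\<in>S. f b *\<^sub>R b) b' = (\<Sum>b\<in>S. if b = b' then f b else 0)"
    unfolding lin[OF finite_S] by (rule sum.cong) (simp_all add: coord_simple)
  then show ?thesis by (simp add: finite_S)
qed

lemma pos_root_coord_nat:
  assumes "\<gamma> \<in> Pos" obtains c :: "'a \<Rightarrow> nat" where "\<And>b. b \<in> S \<Longrightarrow> coord \<gamma> b = real (c b)"
proof -
  obtain c :: "'a \<Rightarrow> nat" where "\<gamma> = (\<Sum>\<beta>\<in>S. real (c \<beta>) *\<^sub>R \<beta>)"
    using assms unfolding pos_roots_def by blast
  then show thesis using that coord_sum by simp
qed

lemma pos_root_root: "\<gamma> \<in> Pos \<Longrightarrow> \<gamma> \<in> \<Delta>"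
  by (simp add: pos_roots_def)

lemma finite_Pos: "finite Pos"
  using finite_roots by (simp add: pos_roots_def)

lemma root_pos_or_neg: "\<gamma> \<in> \<Delta> \<Longrightarrow> \<gamma> \<in> Pos \<or> - \<gamma> \<in> Pos"
  using simple_system unfolding simple_system_def pos_roots_def
  by (smt (verit, best) mem_Collect_eq minus_minus uminus_root)

lemma pos_root_coord_ge: "\<gamma> \<in> Pos \<Longrightarrow> b \<in> S \<Longrightarrow> coord \<gamma> b \<ge> 0"
  by (metis of_nat_0_le_iff pos_root_coord_nat)

lemma pos_root_not_neg: assumes "\<gamma> \<in> Pos" shows "- \<gamma> \<notin> Pos"
proof
  assume "- \<gamma> \<in> Pos"
  then have "coord \<gamma> b = 0" if "b \<in> S" for b
    using pos_root_coord_ge[OF assms that] pos_root_coord_ge[OF \<open>- \<gamma> \<in> Pos\<close> that]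
    by (simp add: coord_uminus)
  then have "\<gamma> = 0" using coord_expand[of \<gamma>] by simp
  then show False using assms zero_not_root pos_root_root by blast
qed

lemma neg_root_iff: "\<gamma> \<in> \<Delta> \<Longrightarrow> - \<gamma> \<in> Pos \<longleftrightarrow> \<gamma> \<notin> Pos"
  using root_pos_or_neg pos_root_not_neg by blast

text \<open>All simple coordinates of a root have the same sign, so one positive coordinate
  decides.\<close>

lemma pos_root_coord_pos:
  assumes "\<gamma> \<in> \<Delta>" "b \<in> S" "coord \<gamma> b > 0" shows "\<gamma> \<in> Pos"
proof (rule ccontr)
  assume "\<gamma> \<notin> Pos"
  then have "- \<gamma> \<in> Pos" using assms neg_root_iff by blast
  then show False using pos_root_coord_ge[of "- \<gamma>" b] assms by (simp add: coord_uminus)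
qed

lemma pos_rootI_coord:
  assumes "\<gamma> \<in> \<Delta>" "\<And>b. b \<in> S \<Longrightarrow> coord \<gamma> b \<ge> 0" shows "\<gamma> \<in> Pos"
proof (rule ccontr)
  assume "\<gamma> \<notin> Pos"
  then have "\<not> coord \<gamma> b > 0" if "b \<in> S" for b using that assms pos_root_coord_pos by blast
  then have "coord \<gamma> b = 0" if "b \<in> S" for b using that assms(2) by fastforce
  then have "\<gamma> = 0" using coord_expand[of \<gamma>] by simp
  then show False using assms zero_not_root by blast
qed

text \<open>This convexity drives both the comparison of lengths and the sign patterns along a
  string.\<close>

lemma pos_root_comb:
  assumes "\<gamma> \<in> \<Delta>" "\<gamma> = a *\<^sub>R x + b *\<^sub>R y" "a \<ge> 0" "b \<ge> 0" "x \<in> Pos" "y \<in> Pos"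
  shows "\<gamma> \<in> Pos"
  using assms by (intro pos_rootI_coord) (auto simp: coord_add coord_scaleR pos_root_coord_ge)

lemma pos_root_refl_nonpos:
  assumes "\<gamma> \<in> Pos" "\<delta> \<in> Pos" "pairing \<delta> \<gamma> \<le> 0" shows "root_refl \<gamma> \<delta> \<in> Pos"
proof (rule pos_root_comb[of _ 1 \<delta> "- pairing \<delta> \<gamma>" \<gamma>])
  show "root_refl \<gamma> \<delta> \<in> \<Delta>" using assms pos_root_root root_refl_root by blast
qed (use assms in \<open>simp_all add: root_refl_def\<close>)

lemma simple_pos: assumes "b \<in> S" shows "b \<in> Pos"
  using assms S_subset by (intro pos_rootI_coord) (auto simp: coord_simple)

text \<open>Since \<gamma> is not a multiple of \<alpha>, it has a positive coordinate at another
  simple root, and \<open>root_refl \<alpha>\<close> changes only the coordinate at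
  \<alpha>.\<close>

lemma simple_refl_pos:
  assumes "\<alpha> \<in> S" "\<gamma> \<in> Pos" "\<gamma> \<noteq> \<alpha>" shows "root_refl \<alpha> \<gamma> \<in> Pos"
proof -
  have "\<exists>b\<in>S. b \<noteq> \<alpha> \<and> coord \<gamma> b \<noteq> 0"
  proof (rule ccontr)
    assume "\<not> ?thesis"
    then have "(\<Sum>b\<in>S. coord \<gamma> b *\<^sub>R b) = (\<Sum>b\<in>S. if b = \<alpha> then coord \<gamma> \<alpha> *\<^sub>R \<alpha> else 0)"
      by (intro sum.cong) auto
    then have \<gamma>: "\<gamma> = coord \<gamma> \<alpha> *\<^sub>R \<alpha>"
      using assms finite_S by (simp add: coord_expand)
    have "coord \<gamma> \<alpha> *\<^sub>R \<alpha> \<in> \<Delta>" using pos_root_root[OF assms(2)] \<gamma> by metis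
    then have "coord \<gamma> \<alpha> = 1 \<or> coord \<gamma> \<alpha> = -1"
      using scaleR_root_iff[of \<alpha>] assms S_subset by blast
    then show False
      using pos_root_coord_ge[OF assms(2,1)] \<gamma> assms(3) by auto
  qed
  then obtain b where b: "b \<in> S" "b \<noteq> \<alpha>" "coord \<gamma> b \<noteq> 0" by blast
  then have "coord \<gamma> b > 0" using pos_root_coord_ge[OF assms(2) b(1)] by simp
  moreover have "coord (root_refl \<alpha> \<gamma>) b = coord \<gamma> b"
    using b assms by (simp add: root_refl_def coord_diff coord_scaleR coord_simple)
  ultimately show ?thesis
    using b root_refl_root[of \<alpha> \<gamma>] assms S_subset pos_root_root
    by (intro pos_root_coord_pos[of _ b]) auto
qed

section \<open>The Weyl group as words in simple reflections\<close>

lemma weyl_orthogonal: "w \<in> W \<Longrightarrow> orthogonal_transformation w"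
proof (induction rule: weyl_group.induct)
  case weyl_id
  show ?case by (simp add: id_def)
qed (rule orthogonal_transformation_compose[OF _ orthogonal_root_refl])

lemma weyl_linear: "w \<in> W \<Longrightarrow> linear w"
  using weyl_orthogonal orthogonal_transformation_def by blast

lemma weyl_uminus: "w \<in> W \<Longrightarrow> w (- x) = - w x"
  using weyl_linear linear_neg by blast

lemma weyl_root: "w \<in> W \<Longrightarrow> \<gamma> \<in> \<Delta> \<Longrightarrow> w \<gamma> \<in> \<Delta>"
  by (induction arbitrary: \<gamma> rule: weyl_group.induct) (simp_all add: root_refl_root)

lemma weyl_inj: "w \<in> W \<Longrightarrow> inj w"
  using weyl_orthogonal orthogonal_transformation_inj by blast

lemma weyl_refl: "w \<in> W \<Longrightarrow> \<gamma> \<in> \<Delta> \<Longrightarrow> w \<circ> root_refl \<gamma> \<in> W"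
  by (rule weyl_group.weyl_step)

text \<open>Induction on the height, the sum of the coordinates. A positive root \<gamma> that is
  not simple pairs positively with some simple \<alpha>; then
  \<open>root_refl \<alpha> \<gamma>\<close> is positive of smaller height, and conjugation by
  \<open>root_refl \<alpha>\<close> leads back to \<gamma>.\<close>

lemma root_refl_simple_word:
  assumes "\<gamma> \<in> Pos" shows "\<exists>as. set as \<subseteq> S \<and> root_refl \<gamma> = simple_word as"
  using assms
proof (induction "nat \<lfloor>\<Sum>b\<in>S. coord \<gamma> b\<rfloor>" arbitrary: \<gamma> rule: less_induct)
  case less
  show ?case
  proof (cases "\<gamma> \<in> S")
    case True
    then have "set [\<gamma>] \<subseteq> S \<and> root_refl \<gamma> = simple_word [\<gamma>]" by simp
    then show ?thesis by blast
  next
    case False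
    have "\<gamma> \<noteq> 0" using less.prems pos_root_root zero_not_root by blast
    \<comment> \<open>Expanding the positive number \<open>\<gamma> \<bullet> \<gamma>\<close> in
      the simple roots yields a positive summand; as coordinates are nonnegative, \<gamma> pairs
      positively with that simple root.\<close>
    then have "0 < \<gamma> \<bullet> (\<Sum>b\<in>S. coord \<gamma> b *\<^sub>R b)" by (simp add: coord_expand)
    also have "\<dots> = (\<Sum>b\<in>S. coord \<gamma> b * (\<gamma> \<bullet> b))" by (simp add: inner_sum_right)
    finally obtain \<alpha> where \<alpha>: "\<alpha> \<in> S" "coord \<gamma> \<alpha> * (\<gamma> \<bullet> \<alpha>) > 0"
      using sum_nonpos[of S "\<lambda>b. coord \<gamma> b * (\<gamma> \<bullet> b)"] by fastforce
    have \<alpha>0: "\<alpha> \<bullet> \<alpha> > 0" "\<alpha> \<in> \<Delta>" using \<alpha> S_subset zero_not_root by auto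
    have "\<gamma> \<bullet> \<alpha> > 0"
      using \<alpha> pos_root_coord_ge[OF less.prems \<alpha>(1)] by (auto simp: zero_less_mult_iff)
    then have "pairing \<gamma> \<alpha> > 0" using \<alpha>0 by (simp add: pairing_eq)
    moreover have "pairing \<gamma> \<alpha> \<in> \<int>" using \<alpha>0 less.prems pairing_Ints pos_root_root by blast
    ultimately have p1: "pairing \<gamma> \<alpha> \<ge> 1" by (auto elim!: Ints_cases)
    define \<delta> where "\<delta> = root_refl \<alpha> \<gamma>"
    have \<delta>: "\<delta> \<in> Pos" unfolding \<delta>_def using less.prems \<alpha> False by (intro simple_refl_pos) auto
    have "(\<Sum>b\<in>S. coord \<delta> b) = (\<Sum>b\<in>S. coord \<gamma> b) - pairing \<gamma> \<alpha> * (\<Sum>b\<in>S. coord \<alpha> b)"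
      by (simp add: \<delta>_def root_refl_def coord_diff coord_scaleR sum_subtractf sum_distrib_left)
    also have "(\<Sum>b\<in>S. coord \<alpha> b) = 1" using \<alpha> finite_S by (simp add: coord_simple)
    finally have le: "(\<Sum>b\<in>S. coord \<delta> b) \<le> (\<Sum>b\<in>S. coord \<gamma> b) - 1" using p1 by simp
    have "(\<Sum>b\<in>S. coord \<delta> b) \<ge> 0" by (intro sum_nonneg pos_root_coord_ge \<delta>)
    then have "nat \<lfloor>\<Sum>b\<in>S. coord \<delta> b\<rfloor> < nat \<lfloor>\<Sum>b\<in>S. coord \<gamma> b\<rfloor>" using le by linarith
    then obtain as where as: "set as \<subseteq> S" "root_refl \<delta> = simple_word as"
      using less.hyps \<delta> by blast
    have "root_refl \<gamma> = root_refl (root_refl \<alpha> \<delta>)" by (simp add: \<delta>_def)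
    also have "\<dots> = simple_word (\<alpha> # as @ [\<alpha>])"
      by (simp add: root_refl_root_refl as comp_assoc)
    finally show ?thesis using as \<alpha>
      by (intro exI[of _ "\<alpha> # as @ [\<alpha>]"]) auto
  qed
qed

lemma weyl_simple_word: "w \<in> W \<Longrightarrow> \<exists>as. set as \<subseteq> S \<and> w = simple_word as"
proof (induction rule: weyl_group.induct)
  case weyl_id
  show ?case by (intro exI[of _ "[]"]) simp
next
  case (weyl_step w \<alpha>)
  obtain bs where "set bs \<subseteq> S" "root_refl \<alpha> = simple_word bs"
    using root_refl_simple_word root_pos_or_neg[OF \<open>\<alpha> \<in> \<Delta>\<close>] root_refl_uminus by metis
  moreover obtain as where "set as \<subseteq> S" "w = simple_word as" using weyl_step by blast
  ultimately show ?case by (intro exI[of _ "as @ bs"]) auto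
qed

lemma simple_word_weyl: "set as \<subseteq> S \<Longrightarrow> simple_word as \<in> W"
proof (induction as rule: rev_induct)
  case Nil
  show ?case unfolding simple_word_Nil by (rule weyl_group.weyl_id)
next
  case (snoc x xs)
  have "simple_word (xs @ [x]) = simple_word xs \<circ> root_refl x" by simp
  moreover have "simple_word xs \<circ> root_refl x \<in> W"
    using snoc S_subset by (intro weyl_refl) auto
  ultimately show ?case by metis
qed

section \<open>Inversions and length\<close>

definition inversions :: "('a \<Rightarrow> 'a) \<Rightarrow> 'a set" where
  "inversions w = {\<gamma>\<in>Pos. w \<gamma> \<notin> Pos}"

lemma finite_inversions: "finite (inversions w)"
  using finite_Pos by (simp add: inversions_def)

text \<open>A simple reflection permutes the positive roots other than its own, so it carries the
  inversions of w to inversions of the product, and \<alpha> is the only new one.\<close>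

lemma card_inversions_simple:
  assumes "w \<in> W" "\<alpha> \<in> S" "w \<alpha> \<in> Pos"
  shows "card (inversions (w \<circ> root_refl \<alpha>)) = Suc (card (inversions w))"
proof -
  have \<alpha>: "\<alpha> \<in> Pos" "\<alpha> \<in> \<Delta>" using assms simple_pos S_subset by auto
  have neg: "w (- \<alpha>) \<notin> Pos" using weyl_uminus assms pos_root_not_neg by metis
  have "inversions (w \<circ> root_refl \<alpha>) = insert \<alpha> (root_refl \<alpha> ` inversions w)" (is "?L = ?R")
  proof
    show "?L \<subseteq> ?R"
    proof
      fix \<gamma> assume \<gamma>: "\<gamma> \<in> ?L"
      show "\<gamma> \<in> ?R"
      proof (cases "\<gamma> = \<alpha>")
        case False
        then have "root_refl \<alpha> \<gamma> \<in> inversions w"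
          using \<gamma> assms by (auto simp: inversions_def intro: simple_refl_pos)
        then show ?thesis by (metis image_eqI insertCI root_refl_involution)
      qed simp
    qed
    show "?R \<subseteq> ?L"
      using assms \<alpha> neg by (auto simp: inversions_def root_refl_self intro!: simple_refl_pos)
  qed
  moreover have "\<alpha> \<notin> root_refl \<alpha> ` inversions w"
  proof
    assume "\<alpha> \<in> root_refl \<alpha> ` inversions w"
    then have "root_refl \<alpha> \<alpha> \<in> inversions w"
      by (metis image_iff root_refl_involution)
    then show False using pos_root_not_neg \<alpha> by (simp add: root_refl_self inversions_def)
  qed
  moreover have "inj_on (root_refl \<alpha>) (inversions w)"
    by (metis inj_on_def root_refl_involution)
  ultimately show ?thesis by (simp add: finite_inversions card_image)
qed

text \<open>Let the word act on \<alpha>, starting with its last letter. At the letter b where the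
  root turns negative it equals b itself, since \<open>root_refl b\<close> makes no other positive
  root negative; there the product with \<open>root_refl \<alpha>\<close> cancels the
  letter.\<close>

lemma simple_word_deletion:
  assumes "set as \<subseteq> S" "\<alpha> \<in> S" "simple_word as \<alpha> \<notin> Pos"
  shows "\<exists>bs. set bs \<subseteq> S \<and> length bs < length as \<and> simple_word bs = simple_word as \<circ> root_refl \<alpha>"
  using assms
proof (induction as)
  case Nil
  then show ?case using simple_pos by simp
next
  case (Cons b as)
  show ?case
  proof (cases "simple_word as \<alpha> \<in> Pos")
    case True
    then have "simple_word as \<alpha> = b" using Cons simple_refl_pos[of b] by auto
    then have "root_refl b \<circ> simple_word as = simple_word as \<circ> root_refl \<alpha>"
      using orthogonal_root_refl_conj_comp[OF orthogonal_simple_word, of as \<alpha>] by metis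
    then have "simple_word as = simple_word (b # as) \<circ> root_refl \<alpha>"
      unfolding simple_word_Cons by (metis comp_assoc comp_id root_refl_comp_self)
    then show ?thesis
      using Cons.prems by (metis length_Cons lessI set_subset_Cons subset_trans)
  next
    case False
    then obtain bs where "set bs \<subseteq> S" "length bs < length as"
      "simple_word bs = simple_word as \<circ> root_refl \<alpha>"
      using Cons.IH Cons.prems by (metis set_subset_Cons subset_trans)
    then have "simple_word (b # bs) = simple_word (b # as) \<circ> root_refl \<alpha>"
      by (simp add: comp_assoc)
    moreover have "set (b # bs) \<subseteq> S" "length (b # bs) < length (b # as)"
      using \<open>set bs \<subseteq> S\<close> \<open>length bs < length as\<close> Cons.prems by auto
    ultimately show ?thesis by blast
  qed
qed

text \<open>The last letter of a shortest word creates an inversion, since otherwise the deletion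
  property would give a shorter word.\<close>

lemma card_inversions_minimal_word:
  assumes "set as \<subseteq> S"
    "\<And>bs. set bs \<subseteq> S \<Longrightarrow> simple_word bs = simple_word as \<Longrightarrow> length as \<le> length bs"
  shows "card (inversions (simple_word as)) = length as"
  using assms
proof (induction as rule: rev_induct)
  case Nil
  then show ?case by (simp add: inversions_def)
next
  case (snoc a as)
  have min: "length as \<le> length bs" if "set bs \<subseteq> S" "simple_word bs = simple_word as" for bs
    using snoc.prems(2)[of "bs @ [a]"] that snoc.prems(1) by simp
  have "simple_word as a \<in> Pos"
  proof (rule ccontr)
    assume "simple_word as a \<notin> Pos"
    then obtain bs where "set bs \<subseteq> S" "length bs < length as"
      "simple_word bs = simple_word as \<circ> root_refl a"
      using simple_word_deletion[of as a] snoc.prems by auto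
    then show False using snoc.prems(2)[of bs] by simp
  qed
  moreover have "simple_word (as @ [a]) = simple_word as \<circ> root_refl a" by simp
  moreover have "card (inversions (simple_word as)) = length as"
    using snoc min by simp
  ultimately show ?case
    using card_inversions_simple[of "simple_word as" a] snoc.prems simple_word_weyl
    by (metis Un_subset_iff insert_subset length_append_singleton list.simps(15) set_append)
qed

lemma weyl_length_eq:
  assumes "w \<in> W" shows "weyl_length S w = card (inversions w)"
proof -
  let ?P = "\<lambda>n. \<exists>as. length as = n \<and> set as \<subseteq> S \<and> w = simple_word as"
  have len: "weyl_length S w = (LEAST n. ?P n)"
    by (simp add: weyl_length_def simple_word_def)
  have "?P (LEAST n. ?P n)"
    by (rule LeastI_ex) (use weyl_simple_word[OF assms] in blast)
  then obtain as where as: "length as = weyl_length S w" "set as \<subseteq> S" "w = simple_word as"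
    unfolding len by blast
  have "card (inversions (simple_word as)) = length as"
  proof (rule card_inversions_minimal_word[OF as(2)])
    fix bs assume "set bs \<subseteq> S" "simple_word bs = simple_word as"
    then have "?P (length bs)" using as by metis
    then show "length as \<le> length bs" unfolding as(1) len by (rule Least_le)
  qed
  then show ?thesis using as by simp
qed

section \<open>Change of length under a reflection\<close>

text \<open>The map \<open>?f\<close> injects the inversions of x into those of
  \<open>x \<circ> root_refl \<gamma>\<close> other than \<gamma>, which is an additional one: it
  reflects a root whenever the result stays positive. If it does not, \<delta> pairs nonnegatively
  with \<gamma>, so \<open>x \<delta>\<close> is \<open>x (root_refl \<gamma> \<delta>)\<close> plus
  a nonnegative multiple of the positive root \<open>x \<gamma>\<close>; hence
  \<open>x (root_refl \<gamma> \<delta>)\<close> is not positive either.\<close>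

lemma weyl_length_refl_pos:
  assumes "x \<in> W" "\<gamma> \<in> Pos" "x \<gamma> \<in> Pos"
  shows "weyl_length S x < weyl_length S (x \<circ> root_refl \<gamma>)"
proof -
  have \<gamma>: "\<gamma> \<in> \<Delta>" "\<gamma> \<noteq> 0" using assms pos_root_root zero_not_root by blast+
  let ?y = "x \<circ> root_refl \<gamma>"
  let ?f = "\<lambda>\<delta>. if root_refl \<gamma> \<delta> \<in> Pos then root_refl \<gamma> \<delta> else \<delta>"
  have "?f ` inversions x \<subseteq> inversions ?y - {\<gamma>}"
  proof
    fix \<epsilon> assume "\<epsilon> \<in> ?f ` inversions x"
    then obtain \<delta> where \<delta>: "\<delta> \<in> Pos" "x \<delta> \<notin> Pos" "\<epsilon> = ?f \<delta>" by (auto simp: inversions_def)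
    show "\<epsilon> \<in> inversions ?y - {\<gamma>}"
    proof (cases "root_refl \<gamma> \<delta> \<in> Pos")
      case True
      have "root_refl \<gamma> \<delta> \<noteq> \<gamma>"
      proof
        assume "root_refl \<gamma> \<delta> = \<gamma>"
        then have "\<delta> = - \<gamma>" by (metis root_refl_involution root_refl_self)
        then show False using \<delta> assms pos_root_not_neg by blast
      qed
      then show ?thesis using True \<delta> by (simp add: inversions_def)
    next
      case False
      have "pairing \<delta> \<gamma> \<ge> 0"
      proof (rule ccontr)
        assume "\<not> ?thesis"
        then have "root_refl \<gamma> \<delta> \<in> Pos"
          using \<delta> assms by (intro pos_root_refl_nonpos) auto
        then show False using False by simp
      qed
      have "x (root_refl \<gamma> \<delta>) \<notin> Pos"
      proof
        assume p: "x (root_refl \<gamma> \<delta>) \<in> Pos"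
        have x\<delta>: "x \<delta> = 1 *\<^sub>R x (root_refl \<gamma> \<delta>) + pairing \<delta> \<gamma> *\<^sub>R x \<gamma>"
          using weyl_linear[OF assms(1)]
          by (simp add: root_refl_def linear_diff linear_scale)
        moreover have "x \<delta> \<in> \<Delta>" using assms \<delta> weyl_root pos_root_root by blast
        ultimately have "x \<delta> \<in> Pos"
          using p assms \<open>pairing \<delta> \<gamma> \<ge> 0\<close> pos_root_comb[OF _ x\<delta>] by simp
        then show False using \<delta> by simp
      qed
      then show ?thesis using False \<delta> assms by (auto simp: inversions_def)
    qed
  qed
  \<comment> \<open>The two branches cannot collide: if
    \<open>root_refl \<gamma> \<delta> = \<epsilon>\<close>, then
    \<open>root_refl \<gamma> \<epsilon> = \<delta>\<close> is positive, so \<epsilon> is reflected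
    too.\<close>
  moreover have "inj_on ?f (inversions x)"
  proof (rule inj_onI)
    fix \<delta> \<epsilon> assume "\<delta> \<in> inversions x" "\<epsilon> \<in> inversions x" "?f \<delta> = ?f \<epsilon>"
    moreover from this have "\<delta> \<in> Pos" "\<epsilon> \<in> Pos" by (simp_all add: inversions_def)
    ultimately show "\<delta> = \<epsilon>"
      by (auto split: if_splits) (metis root_refl_involution)
  qed
  ultimately have "card (inversions x) \<le> card (inversions ?y - {\<gamma>})"
    using card_inj_on_le finite_inversions by blast
  moreover have "\<gamma> \<in> inversions ?y"
    using assms pos_root_not_neg weyl_uminus[OF assms(1)]
    by (simp add: inversions_def root_refl_self)
  ultimately have "card (inversions x) < card (inversions ?y)"
    by (metis card_Diff1_less finite_inversions order_le_less_trans)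
  then show ?thesis using assms \<gamma> by (simp add: weyl_length_eq weyl_refl)
qed

lemma weyl_length_refl_neg:
  assumes "x \<in> W" "\<gamma> \<in> Pos" "x \<gamma> \<notin> Pos"
  shows "weyl_length S (x \<circ> root_refl \<gamma>) < weyl_length S x"
proof -
  have "\<gamma> \<in> \<Delta>" using assms pos_root_root by blast
  moreover have "(x \<circ> root_refl \<gamma>) \<gamma> \<in> Pos"
    using assms calculation weyl_root neg_root_iff by (simp add: root_refl_self weyl_uminus)
  ultimately show ?thesis
    using weyl_length_refl_pos[of "x \<circ> root_refl \<gamma>" \<gamma>] assms weyl_refl by (simp add: comp_assoc)
qed

text \<open>Twice \<rho> is the sum of the positive roots. Those that
  \<open>root_refl \<gamma>\<close> keeps positive cancel, as the reflection permutes them and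
  negates the pairing; each remaining one contributes at least 1, and \<gamma> contributes
  2.\<close>

lemma card_inversions_refl_le:
  assumes "\<gamma> \<in> Pos"
  shows "real (card (inversions (root_refl \<gamma>))) + 1 \<le> 2 * pairing (weyl_vector \<Delta> S) \<gamma>"
proof -
  have \<gamma>: "\<gamma> \<in> \<Delta>" "\<gamma> \<noteq> 0" using assms pos_root_root zero_not_root by blast+
  let ?I = "inversions (root_refl \<gamma>)" and ?J = "{\<delta>\<in>Pos. root_refl \<gamma> \<delta> \<in> Pos}"
  have "2 * pairing (weyl_vector \<Delta> S) \<gamma> = (\<Sum>\<delta>\<in>Pos. pairing \<delta> \<gamma>)"
    by (simp add: weyl_vector_def pairing_def inner_sum_left)
  also have "\<dots> = (\<Sum>\<delta>\<in>?I. pairing \<delta> \<gamma>) + (\<Sum>\<delta>\<in>?J. pairing \<delta> \<gamma>)"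
    using finite_Pos by (subst sum.union_disjoint[symmetric])
      (auto simp: inversions_def intro!: sum.cong)
  also have "(\<Sum>\<delta>\<in>?J. pairing \<delta> \<gamma>) = 0"
  proof -
    have "(\<Sum>\<delta>\<in>?J. pairing \<delta> \<gamma>) = (\<Sum>\<delta>\<in>?J. pairing (root_refl \<gamma> \<delta>) \<gamma>)"
      by (rule sum.reindex_bij_witness[of _ "root_refl \<gamma>" "root_refl \<gamma>"]) auto
    then show ?thesis by (simp add: pairing_root_refl_same sum_negf)
  qed
  finally have eq: "2 * pairing (weyl_vector \<Delta> S) \<gamma> = (\<Sum>\<delta>\<in>?I. pairing \<delta> \<gamma>)" by simp
  have ge: "pairing \<delta> \<gamma> \<ge> 1" if "\<delta> \<in> ?I" for \<delta>
  proof (rule ccontr)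
    assume "\<not> ?thesis"
    moreover have \<delta>: "\<delta> \<in> Pos" "\<delta> \<in> \<Delta>" "root_refl \<gamma> \<delta> \<notin> Pos"
      using that pos_root_root by (auto simp: inversions_def)
    moreover have "pairing \<delta> \<gamma> \<in> \<int>" using \<delta> \<gamma> pairing_Ints by blast
    ultimately have "pairing \<delta> \<gamma> \<le> 0" by (auto elim!: Ints_cases)
    then have "root_refl \<gamma> \<delta> \<in> Pos"
      using \<delta> assms by (intro pos_root_refl_nonpos) auto
    then show False using \<delta> by simp
  qed
  have mem: "\<gamma> \<in> ?I" using assms pos_root_not_neg by (simp add: inversions_def root_refl_self)
  have "real (card ?I) + 1 = (\<Sum>\<delta>\<in>?I. 1 + (if \<delta> = \<gamma> then 1 else 0))"
    using mem by (simp add: sum.distrib finite_inversions)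
  also have "\<dots> \<le> (\<Sum>\<delta>\<in>?I. pairing \<delta> \<gamma>)"
    using ge \<gamma> by (intro sum_mono) (auto simp: pairing_self)
  finally show ?thesis using eq by simp
qed

text \<open>Subadditivity of inversion counts, combined with the bound on the inversions of
  \<open>root_refl \<gamma>\<close>. Equality holds exactly for quantum edges.\<close>

lemma weyl_length_refl_diff:
  assumes "x \<in> W" "\<gamma> \<in> Pos"
  shows "real (weyl_length S x) \<le>
    real (weyl_length S (x \<circ> root_refl \<gamma>)) + 2 * pairing (weyl_vector \<Delta> S) \<gamma> - 1"
proof -
  let ?y = "x \<circ> root_refl \<gamma>"
  have "inversions x \<subseteq> inversions (root_refl \<gamma>) \<union> root_refl \<gamma> ` inversions ?y"
  proof
    fix \<delta> assume "\<delta> \<in> inversions x"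
    then show "\<delta> \<in> inversions (root_refl \<gamma>) \<union> root_refl \<gamma> ` inversions ?y"
      by (cases "root_refl \<gamma> \<delta> \<in> Pos")
        (auto simp: inversions_def intro!: image_eqI[of _ _ "root_refl \<gamma> \<delta>"])
  qed
  then have "card (inversions x) \<le> card (inversions (root_refl \<gamma>) \<union> root_refl \<gamma> ` inversions ?y)"
    by (intro card_mono) (auto simp: finite_inversions)
  also have "\<dots> \<le> card (inversions (root_refl \<gamma>)) + card (inversions ?y)"
    by (meson card_Un_le card_image_le finite_inversions add_left_mono order_trans)
  finally have "card (inversions x) \<le> card (inversions (root_refl \<gamma>)) + card (inversions ?y)" .
  moreover have "\<gamma> \<in> \<Delta>" using assms pos_root_root by blast
  ultimately show ?thesis
    using card_inversions_refl_le[OF assms(2)] weyl_length_eq assms weyl_refl by simp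
qed

end

section \<open>Strings of rank two\<close>

definition comb :: "'a::real_vector \<Rightarrow> 'a \<Rightarrow> real \<Rightarrow> real \<Rightarrow> 'a" where
  "comb \<alpha> \<beta> x y = x *\<^sub>R \<alpha> + y *\<^sub>R \<beta>"

lemma comb_swap: "comb \<beta> \<alpha> x y = comb \<alpha> \<beta> y x"
  by (simp add: comb_def)

lemma comb_unit: "comb \<alpha> \<beta> 1 0 = \<alpha>" "comb \<alpha> \<beta> 0 1 = \<beta>"
  by (simp_all add: comb_def)

lemma root_refl_comb:
  assumes "\<alpha> \<noteq> 0"
  shows "root_refl \<alpha> (comb \<alpha> \<beta> x y) = comb \<alpha> \<beta> (- x - y * pairing \<beta> \<alpha>) y"
proof -
  have "root_refl \<alpha> (comb \<alpha> \<beta> x y) = comb \<alpha> \<beta> x y - (2 * x + y * pairing \<beta> \<alpha>) *\<^sub>R \<alpha>"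
    using assms by (simp add: root_refl_def comb_def pairing_add_left pairing_scaleR_left pairing_self)
  also have "\<dots> = comb \<alpha> \<beta> (x - (2 * x + y * pairing \<beta> \<alpha>)) y"
    unfolding comb_def scaleR_diff_left by (simp only: diff_add_eq)
  also have "x - (2 * x + y * pairing \<beta> \<alpha>) = - x - y * pairing \<beta> \<alpha>" by simp
  finally show ?thesis .
qed

lemma root_refl_comb_right:
  assumes "\<beta> \<noteq> 0"
  shows "root_refl \<beta> (comb \<alpha> \<beta> x y) = comb \<alpha> \<beta> x (- y - x * pairing \<alpha> \<beta>)"
  using root_refl_comb[OF assms, of \<alpha> y x] by (simp add: comb_swap[of \<beta> \<alpha>])

lemma alternating_0_comb:
  "alternating \<alpha> \<beta> 0 = comb \<alpha> \<beta> 1 0" "alternating \<beta> \<alpha> 0 = comb \<alpha> \<beta> 0 1"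
  by (simp_all add: comb_unit)

lemma coroot_nonzero: "\<alpha> \<noteq> 0 \<Longrightarrow> coroot \<alpha> \<noteq> 0"
  by (simp add: coroot_def)

lemma coroot_coroot: "coroot (coroot \<alpha>) = \<alpha>"
  by (cases "\<alpha> = 0") (simp_all add: coroot_def)

text \<open>Passing to coroots transposes the Cartan integers, so the coroots of a string form a
  string of the dual type.\<close>

lemma pairing_coroot: "pairing (coroot \<alpha>) (coroot \<beta>) = pairing \<beta> \<alpha>"
  unfolding pairing_def coroot_coroot by (simp add: inner_commute)

lemma root_refl_coroot: "root_refl (coroot \<alpha>) = root_refl \<alpha>"
proof
  fix x
  have "pairing x (coroot \<alpha>) *\<^sub>R coroot \<alpha> = pairing x \<alpha> *\<^sub>R \<alpha>"
    unfolding pairing_def coroot_coroot by (simp add: coroot_def)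
  then show "root_refl (coroot \<alpha>) x = root_refl \<alpha> x" by (simp add: root_refl_def)
qed

lemma coroot_alternating: "coroot (alternating \<alpha> \<beta> i) = alternating (coroot \<alpha>) (coroot \<beta>) i"
  by (induction i arbitrary: \<alpha> \<beta>)
    (simp_all add: orthogonal_coroot[OF orthogonal_root_refl] root_refl_coroot)

text \<open>Strict Cauchy-Schwarz bounds the product of the two integers by 3; both are nonpositive
  and they vanish together.\<close>

lemma rank2_pairing_cases:
  assumes "root_system \<Delta>" "\<alpha> \<in> \<Delta>" "\<beta> \<in> \<Delta>" "pairing \<alpha> \<beta> \<le> 0" "\<alpha> \<noteq> - \<beta>"
  shows "(pairing \<alpha> \<beta>, pairing \<beta> \<alpha>) \<in> {(0,0), (-1,-1), (-1,-2), (-2,-1), (-1,-3), (-3,-1)}"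
    and "\<And>x y. comb \<alpha> \<beta> x y = 0 \<Longrightarrow> x = 0 \<and> y = 0"
proof -
  have ne: "\<alpha> \<noteq> 0" "\<beta> \<noteq> 0" using assms unfolding root_system_def by auto
  have "2 * (\<alpha> \<bullet> \<beta>) = pairing \<alpha> \<beta> * (\<beta> \<bullet> \<beta>)" using ne by (simp add: pairing_eq)
  also have "\<dots> \<le> 0" using assms(4) by (intro mult_nonpos_nonneg) auto
  finally have le: "\<alpha> \<bullet> \<beta> \<le> 0" by simp
  \<comment> \<open>The only multiples of \<alpha> among the roots are \<alpha> and -\<alpha>; the
    first pairs positively with \<alpha>, the second is excluded by hypothesis.\<close>
  have scal: "c *\<^sub>R \<alpha> \<in> \<Delta> \<longleftrightarrow> c = 1 \<or> c = -1" for c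
    using assms(1,2) unfolding root_system_def by blast
  have ncol: "\<beta> \<noteq> c *\<^sub>R \<alpha>" for c
  proof
    assume c: "\<beta> = c *\<^sub>R \<alpha>"
    then have "c = 1 \<or> c = -1" using scal assms(3) by metis
    then have "\<beta> = \<alpha>" using c assms(5) by auto
    then show False using le ne by (auto dest: antisym[OF _ inner_ge_zero])
  qed
  show "x = 0 \<and> y = 0" if "comb \<alpha> \<beta> x y = 0" for x y
  proof -
    have "y = 0"
    proof (rule ccontr)
      assume "y \<noteq> 0"
      then have "\<beta> = (1 / y) *\<^sub>R (y *\<^sub>R \<beta>)" by simp
      also have "y *\<^sub>R \<beta> = (- x) *\<^sub>R \<alpha>" using that by (simp add: comb_def add_eq_0_iff)
      finally have "\<beta> = (- x / y) *\<^sub>R \<alpha>" by simp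
      then show False using ncol by blast
    qed
    then show ?thesis using that ne by (simp add: comb_def)
  qed
  have "(\<alpha> \<bullet> \<beta>)\<^sup>2 \<noteq> (\<alpha> \<bullet> \<alpha>) * (\<beta> \<bullet> \<beta>)"
  proof
    assume "(\<alpha> \<bullet> \<beta>)\<^sup>2 = (\<alpha> \<bullet> \<alpha>) * (\<beta> \<bullet> \<beta>)"
    then have "(\<beta> - ((\<alpha> \<bullet> \<beta>) / (\<alpha> \<bullet> \<alpha>)) *\<^sub>R \<alpha>) \<bullet> (\<beta> - ((\<alpha> \<bullet> \<beta>) / (\<alpha> \<bullet> \<alpha>)) *\<^sub>R \<alpha>) = 0"
      using ne by (simp add: inner_diff_left inner_diff_right inner_commute field_simps power2_eq_square)
    then show False using ncol by (simp)
  qed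
  then have "(\<alpha> \<bullet> \<beta>)\<^sup>2 < (\<alpha> \<bullet> \<alpha>) * (\<beta> \<bullet> \<beta>)"
    using Cauchy_Schwarz_ineq[of \<alpha> \<beta>] by simp
  then have lt4: "pairing \<alpha> \<beta> * pairing \<beta> \<alpha> < 4"
    using ne by (simp add: pairing_eq field_simps power2_eq_square inner_commute)
  have le': "pairing \<beta> \<alpha> \<le> 0" using le by (simp add: pairing_eq inner_commute divide_le_0_iff)
  have zero: "pairing \<alpha> \<beta> = 0 \<longleftrightarrow> pairing \<beta> \<alpha> = 0" using ne by (simp add: pairing_eq inner_commute)
  have "pairing \<alpha> \<beta> \<in> \<int>" "pairing \<beta> \<alpha> \<in> \<int>"
    using assms unfolding root_system_def by auto
  then obtain i j :: int where ij: "pairing \<alpha> \<beta> = of_int i" "pairing \<beta> \<alpha> = of_int j"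
    by (auto elim!: Ints_cases)
  have "real_of_int (i * j) < 4" using lt4 ij by simp
  then have ij4: "i * j < 4" by linarith
  have i0: "i \<le> 0" "j \<le> 0" "i = 0 \<longleftrightarrow> j = 0" using ij le' assms(4) zero by auto
  have "(i, j) \<in> {(0,0), (-1,-1), (-1,-2), (-2,-1), (-1,-3), (-3,-1)}"
  proof (cases "i = 0")
    case False
    then have *: "i \<le> -1" "j \<le> -1" using i0 by auto
    \<comment> \<open>For i, j \<le> -1 these products bound -i and -j by \<open>i * j\<close>,
      which is at most 3.\<close>
    have "0 \<le> i * (j + 1)" "0 \<le> (i + 1) * j" using * by (simp_all add: mult_nonpos_nonpos)
    then have "- i \<le> i * j" "- j \<le> i * j" by (simp_all add: algebra_simps)
    then have "i \<in> {-3,-2,-1}" "j \<in> {-3,-2,-1}" using * ij4 by auto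
    then show ?thesis using ij4 by auto
  qed (use i0 in auto)
  then show "(pairing \<alpha> \<beta>, pairing \<beta> \<alpha>) \<in> {(0,0), (-1,-1), (-1,-2), (-2,-1), (-1,-3), (-3,-1)}"
    unfolding ij by auto
qed

text \<open>These tables run through both strings, from \<alpha> and from \<beta>, in coordinates. A
  type with two root lengths is tabulated for one order of \<alpha> and \<beta>; the other order
  follows by exchanging them.\<close>

lemma alternating_A1A1:
  assumes "\<alpha> \<noteq> 0" "\<beta> \<noteq> 0" "pairing \<alpha> \<beta> = 0" "pairing \<beta> \<alpha> = 0"
  shows "alternating \<alpha> \<beta> 0 = comb \<alpha> \<beta> 1 0" "alternating \<beta> \<alpha> 0 = comb \<alpha> \<beta> 0 1"
    "alternating \<alpha> \<beta> (Suc 0) = comb \<alpha> \<beta> 0 1" "alternating \<beta> \<alpha> (Suc 0) = comb \<alpha> \<beta> 1 0"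
  by (simp_all add: assms alternating_0_comb[where \<alpha> = \<alpha> and \<beta> = \<beta>] root_refl_comb root_refl_comb_right
      eval_nat_numeral del: alternating.simps(1))

lemma alternating_A2:
  assumes "\<alpha> \<noteq> 0" "\<beta> \<noteq> 0" "pairing \<alpha> \<beta> = -1" "pairing \<beta> \<alpha> = -1"
  shows "alternating \<alpha> \<beta> 0 = comb \<alpha> \<beta> 1 0" "alternating \<beta> \<alpha> 0 = comb \<alpha> \<beta> 0 1"
    "alternating \<alpha> \<beta> (Suc 0) = comb \<alpha> \<beta> 1 1" "alternating \<beta> \<alpha> (Suc 0) = comb \<alpha> \<beta> 1 1"
    "alternating \<alpha> \<beta> 2 = comb \<alpha> \<beta> 0 1" "alternating \<beta> \<alpha> 2 = comb \<alpha> \<beta> 1 0"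
  by (simp_all add: assms alternating_0_comb[where \<alpha> = \<alpha> and \<beta> = \<beta>] root_refl_comb root_refl_comb_right
      eval_nat_numeral del: alternating.simps(1))

lemma alternating_B2:
  assumes "\<alpha> \<noteq> 0" "\<beta> \<noteq> 0" "pairing \<alpha> \<beta> = -1" "pairing \<beta> \<alpha> = -2"
  shows "alternating \<alpha> \<beta> 0 = comb \<alpha> \<beta> 1 0" "alternating \<beta> \<alpha> 0 = comb \<alpha> \<beta> 0 1"
    "alternating \<alpha> \<beta> (Suc 0) = comb \<alpha> \<beta> 2 1" "alternating \<beta> \<alpha> (Suc 0) = comb \<alpha> \<beta> 1 1"
    "alternating \<alpha> \<beta> 2 = comb \<alpha> \<beta> 1 1" "alternating \<beta> \<alpha> 2 = comb \<alpha> \<beta> 2 1"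
    "alternating \<alpha> \<beta> 3 = comb \<alpha> \<beta> 0 1" "alternating \<beta> \<alpha> 3 = comb \<alpha> \<beta> 1 0"
  by (simp_all add: assms alternating_0_comb[where \<alpha> = \<alpha> and \<beta> = \<beta>] root_refl_comb root_refl_comb_right
      eval_nat_numeral del: alternating.simps(1))

lemma alternating_G2:
  assumes "\<alpha> \<noteq> 0" "\<beta> \<noteq> 0" "pairing \<alpha> \<beta> = -1" "pairing \<beta> \<alpha> = -3"
  shows "alternating \<alpha> \<beta> 0 = comb \<alpha> \<beta> 1 0" "alternating \<beta> \<alpha> 0 = comb \<alpha> \<beta> 0 1"
    "alternating \<alpha> \<beta> (Suc 0) = comb \<alpha> \<beta> 3 1" "alternating \<beta> \<alpha> (Suc 0) = comb \<alpha> \<beta> 1 1"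
    "alternating \<alpha> \<beta> 2 = comb \<alpha> \<beta> 2 1" "alternating \<beta> \<alpha> 2 = comb \<alpha> \<beta> 3 2"
    "alternating \<alpha> \<beta> 3 = comb \<alpha> \<beta> 3 2" "alternating \<beta> \<alpha> 3 = comb \<alpha> \<beta> 2 1"
    "alternating \<alpha> \<beta> 4 = comb \<alpha> \<beta> 1 1" "alternating \<beta> \<alpha> 4 = comb \<alpha> \<beta> 3 1"
    "alternating \<alpha> \<beta> 5 = comb \<alpha> \<beta> 0 1" "alternating \<beta> \<alpha> 5 = comb \<alpha> \<beta> 1 0"
  by (simp_all add: assms alternating_0_comb[where \<alpha> = \<alpha> and \<beta> = \<beta>] root_refl_comb root_refl_comb_right
      eval_nat_numeral del: alternating.simps(1))


lemma rank2_string_eq: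
  assumes "alternating \<alpha> \<beta> k = \<beta>" "\<And>i. i < k \<Longrightarrow> alternating \<alpha> \<beta> i \<noteq> \<beta>"
  shows "rank2_string \<alpha> \<beta> = map (alternating \<alpha> \<beta>) [0..<Suc k]"
proof -
  have "(LEAST i. alternating \<alpha> \<beta> i = \<beta>) = k"
    by (rule Least_equality) (use assms not_le in blast)+
  then show ?thesis by (simp add: rank2_string_def)
qed

text \<open>Only the Cartan integers and independence are kept from the root system. Both survive
  exchanging \<alpha> and \<beta> and passing to coroots, so the tables serve for all of these
  pairs.\<close>

locale rank2 =
  fixes \<alpha> \<beta> :: "'a::euclidean_space"
  assumes pairings:
      "(pairing \<alpha> \<beta>, pairing \<beta> \<alpha>) \<in> {(0,0), (-1,-1), (-1,-2), (-2,-1), (-1,-3), (-3,-1)}"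
    and indep: "\<And>x y. comb \<alpha> \<beta> x y = 0 \<Longrightarrow> x = 0 \<and> y = 0"
begin

lemma nonzero: "\<alpha> \<noteq> 0" "\<beta> \<noteq> 0"
  using indep[of 1 0] indep[of 0 1] by (auto simp: comb_unit)

lemma comb_eq_iff: "comb \<alpha> \<beta> x y = comb \<alpha> \<beta> x' y' \<longleftrightarrow> x = x' \<and> y = y'"
proof
  assume "comb \<alpha> \<beta> x y = comb \<alpha> \<beta> x' y'"
  then have "comb \<alpha> \<beta> (x - x') (y - y') = 0"
    by (simp add: comb_def scaleR_diff_left algebra_simps)
  then show "x = x' \<and> y = y'" using indep by fastforce
qed simp

lemma comb_eq_right: "comb \<alpha> \<beta> x y = \<beta> \<longleftrightarrow> x = 0 \<and> y = 1"
  using comb_eq_iff[of x y 0 1] by (simp add: comb_unit)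

lemma swap: "rank2 \<beta> \<alpha>"
proof
  show "(pairing \<beta> \<alpha>, pairing \<alpha> \<beta>) \<in> {(0,0), (-1,-1), (-1,-2), (-2,-1), (-1,-3), (-3,-1)}"
    using pairings by auto
  show "x = 0 \<and> y = 0" if "comb \<beta> \<alpha> x y = 0" for x y
    using that indep comb_swap by metis
qed

lemma coroots: "rank2 (coroot \<alpha>) (coroot \<beta>)"
proof
  show "(pairing (coroot \<alpha>) (coroot \<beta>), pairing (coroot \<beta>) (coroot \<alpha>))
      \<in> {(0,0), (-1,-1), (-1,-2), (-2,-1), (-1,-3), (-3,-1)}"
    using pairings by (auto simp: pairing_coroot)
  show "x = 0 \<and> y = 0" if "comb (coroot \<alpha>) (coroot \<beta>) x y = 0" for x y
    using that indep[of "x * (2 / (\<alpha> \<bullet> \<alpha>))" "y * (2 / (\<beta> \<bullet> \<beta>))"] nonzero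
    by (simp add: comb_def coroot_def)
qed

end

text \<open>Tables of natural numbers, so that the combinatorics of a string is settled by
  evaluating lists. The second conjunct contains the reversal of the string.\<close>

definition rank2_data ::
  "'a::euclidean_space \<Rightarrow> 'a \<Rightarrow> nat \<Rightarrow> nat list \<Rightarrow> nat list \<Rightarrow> bool" where
  "rank2_data \<alpha> \<beta> k xs ys \<longleftrightarrow>
     (\<forall>i\<le>k. alternating \<alpha> \<beta> i = comb \<alpha> \<beta> (xs ! i) (ys ! i) \<and>
            alternating \<beta> \<alpha> i = comb \<alpha> \<beta> (xs ! (k - i)) (ys ! (k - i)))"

lemma rank2_data_swap:
  assumes "rank2_data \<beta> \<alpha> k xs ys" "length xs = Suc k" "length ys = Suc k"
  shows "rank2_data \<alpha> \<beta> k (rev ys) (rev xs)"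
  using assms by (auto simp: rank2_data_def comb_swap[of \<beta> \<alpha>] rev_nth Suc_diff_le)

context rank2
begin

lemma rank2_data_A1A1:
  assumes "pairing \<alpha> \<beta> = 0" "pairing \<beta> \<alpha> = 0"
  shows "rank2_data \<alpha> \<beta> 1 [1, 0] [0, 1]"
  unfolding rank2_data_def
proof (intro allI impI)
  fix i :: nat assume "i \<le> 1"
  then consider "i = 0" | "i = Suc 0" by linarith
  then show "alternating \<alpha> \<beta> i = comb \<alpha> \<beta> (real ([1, 0] ! i)) (real ([0, 1] ! i)) \<and>
    alternating \<beta> \<alpha> i = comb \<alpha> \<beta> (real ([1, 0] ! (1 - i))) (real ([0, 1] ! (1 - i)))"
    by cases (simp_all add: alternating_A1A1[OF nonzero assms] del: alternating.simps)
qed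

lemma rank2_data_A2:
  assumes "pairing \<alpha> \<beta> = -1" "pairing \<beta> \<alpha> = -1"
  shows "rank2_data \<alpha> \<beta> 2 [1, 1, 0] [0, 1, 1]"
  unfolding rank2_data_def
proof (intro allI impI)
  fix i :: nat assume "i \<le> 2"
  then consider "i = 0" | "i = Suc 0" | "i = 2" by linarith
  then show "alternating \<alpha> \<beta> i = comb \<alpha> \<beta> (real ([1, 1, 0] ! i)) (real ([0, 1, 1] ! i)) \<and>
    alternating \<beta> \<alpha> i = comb \<alpha> \<beta> (real ([1, 1, 0] ! (2 - i))) (real ([0, 1, 1] ! (2 - i)))"
    by cases (simp_all add: alternating_A2[OF nonzero assms] del: alternating.simps)
qed

lemma rank2_data_B2:
  assumes "pairing \<alpha> \<beta> = -1" "pairing \<beta> \<alpha> = -2"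
  shows "rank2_data \<alpha> \<beta> 3 [1, 2, 1, 0] [0, 1, 1, 1]"
  unfolding rank2_data_def
proof (intro allI impI)
  fix i :: nat assume "i \<le> 3"
  then consider "i = 0" | "i = Suc 0" | "i = 2" | "i = 3" by linarith
  then show "alternating \<alpha> \<beta> i = comb \<alpha> \<beta> (real ([1, 2, 1, 0] ! i)) (real ([0, 1, 1, 1] ! i)) \<and>
    alternating \<beta> \<alpha> i = comb \<alpha> \<beta> (real ([1, 2, 1, 0] ! (3 - i))) (real ([0, 1, 1, 1] ! (3 - i)))"
    by cases (simp_all add: alternating_B2[OF nonzero assms] del: alternating.simps)
qed

lemma rank2_data_G2:
  assumes "pairing \<alpha> \<beta> = -1" "pairing \<beta> \<alpha> = -3"
  shows "rank2_data \<alpha> \<beta> 5 [1, 3, 2, 3, 1, 0] [0, 1, 1, 2, 1, 1]"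
  unfolding rank2_data_def
proof (intro allI impI)
  fix i :: nat assume "i \<le> 5"
  then consider "i = 0" | "i = Suc 0" | "i = 2" | "i = 3" | "i = 4" | "i = 5" by linarith
  then show "alternating \<alpha> \<beta> i = comb \<alpha> \<beta> (real ([1, 3, 2, 3, 1, 0] ! i)) (real ([0, 1, 1, 2, 1, 1] ! i)) \<and>
    alternating \<beta> \<alpha> i = comb \<alpha> \<beta> (real ([1, 3, 2, 3, 1, 0] ! (5 - i))) (real ([0, 1, 1, 2, 1, 1] !
        (5 - i)))"
    by cases (simp_all add: alternating_G2[OF nonzero assms] del: alternating.simps)
qed

lemma rank2_data_cases:
  obtains (A1A1) "rank2_data \<alpha> \<beta> 1 [1, 0] [0, 1]"
  | (A2) "rank2_data \<alpha> \<beta> 2 [1, 1, 0] [0, 1, 1]"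
  | (B2) "rank2_data \<alpha> \<beta> 3 [1, 2, 1, 0] [0, 1, 1, 1]"
  | (C2) "rank2_data \<alpha> \<beta> 3 [1, 1, 1, 0] [0, 1, 2, 1]"
  | (G2) "rank2_data \<alpha> \<beta> 5 [1, 3, 2, 3, 1, 0] [0, 1, 1, 2, 1, 1]"
  | (G2') "rank2_data \<alpha> \<beta> 5 [1, 1, 2, 1, 1, 0] [0, 1, 3, 2, 3, 1]"
proof -
  interpret sw: rank2 \<beta> \<alpha> by (rule swap)
  show thesis
    using pairings that rank2_data_A1A1 rank2_data_A2 rank2_data_B2 rank2_data_G2
      rank2_data_swap[OF sw.rank2_data_B2] rank2_data_swap[OF sw.rank2_data_G2]
    by auto
qed

end

section \<open>The Yang-Baxter equation in dihedral Hecke algebras\<close>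

text \<open>With \<open>\<kappa> = v - 1/v\<close> the quadratic relation reads (H - v)(H + 1/v) =
  0. The braid relation has a different length in each type and is therefore a premise of the lemmas
  below.\<close>

locale hecke_pair =
  fixes \<kappa> :: real and H\<^sub>1 H\<^sub>2 :: "('s \<Rightarrow> real) \<Rightarrow> 's \<Rightarrow> real"
  assumes add\<^sub>1: "H\<^sub>1 (\<lambda>x. f x + g x) = (\<lambda>x. H\<^sub>1 f x + H\<^sub>1 g x)"
    and add\<^sub>2: "H\<^sub>2 (\<lambda>x. f x + g x) = (\<lambda>x. H\<^sub>2 f x + H\<^sub>2 g x)"
    and scale\<^sub>1: "H\<^sub>1 (\<lambda>x. c * f x) = (\<lambda>x. c * H\<^sub>1 f x)"
    and scale\<^sub>2: "H\<^sub>2 (\<lambda>x. c * f x) = (\<lambda>x. c * H\<^sub>2 f x)"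
    and quadratic\<^sub>1: "H\<^sub>1 (H\<^sub>1 f) = (\<lambda>x. f x + \<kappa> * H\<^sub>1 f x)"
    and quadratic\<^sub>2: "H\<^sub>2 (H\<^sub>2 f) = (\<lambda>x. f x + \<kappa> * H\<^sub>2 f x)"
begin

definition R\<^sub>1 :: "real \<Rightarrow> ('s \<Rightarrow> real) \<Rightarrow> 's \<Rightarrow> real" where "R\<^sub>1 c f = (\<lambda>x. H\<^sub>1 f x + c * f x)"
definition R\<^sub>2 :: "real \<Rightarrow> ('s \<Rightarrow> real) \<Rightarrow> 's \<Rightarrow> real" where "R\<^sub>2 c f = (\<lambda>x. H\<^sub>2 f x + c * f x)"

lemmas expand = R\<^sub>1_def R\<^sub>2_def add\<^sub>1 add\<^sub>2 scale\<^sub>1 scale\<^sub>2 quadratic\<^sub>1 quadratic\<^sub>2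

lemma yang_baxter_2:
  assumes "H\<^sub>1 (H\<^sub>2 f) = H\<^sub>2 (H\<^sub>1 f)"
  shows "R\<^sub>1 c1 (R\<^sub>2 c2 f) = R\<^sub>2 c2 (R\<^sub>1 c1 f)"
  using assms by (auto simp: expand fun_eq_iff algebra_simps)

text \<open>After the squares are reduced, the difference of the two sides is a combination of
  differences of two alternating words of equal length. The longest one vanishes by the braid
  relation; the shorter ones that remain have coefficients that vanish by the relations between the
  scalars.\<close>

lemma yang_baxter_3:
  assumes "H\<^sub>1 (H\<^sub>2 (H\<^sub>1 f)) = H\<^sub>2 (H\<^sub>1 (H\<^sub>2 f))"
    and r1: "c1 * c3 = c2 * (\<kappa> + c1 + c3)"
  shows "R\<^sub>1 c1 (R\<^sub>2 c2 (R\<^sub>1 c3 f)) = R\<^sub>2 c3 (R\<^sub>1 c2 (R\<^sub>2 c1 f))"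
proof
  fix x
  have e1: "c1*c2 - 1*c1*c3 + c2*c3 + \<kappa>*c2 = 0"
    using r1 by algebra
  have "R\<^sub>1 c1 (R\<^sub>2 c2 (R\<^sub>1 c3 f)) x - R\<^sub>2 c3 (R\<^sub>1 c2 (R\<^sub>2 c1 f)) x =
    (c1*c2 - 1*c1*c3 + c2*c3 + \<kappa>*c2) * (H\<^sub>1 f x - H\<^sub>2 f x) +
    (H\<^sub>1 (H\<^sub>2 (H\<^sub>1 f)) x - H\<^sub>2 (H\<^sub>1 (H\<^sub>2 f)) x)"
    by (simp add: expand algebra_simps power2_eq_square)
  then show "R\<^sub>1 c1 (R\<^sub>2 c2 (R\<^sub>1 c3 f)) x = R\<^sub>2 c3 (R\<^sub>1 c2 (R\<^sub>2 c1 f)) x"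
    using assms(1) by (simp only: e1)
qed

lemma yang_baxter_4:
  assumes "H\<^sub>1 (H\<^sub>2 (H\<^sub>1 (H\<^sub>2 f))) = H\<^sub>2 (H\<^sub>1 (H\<^sub>2 (H\<^sub>1 f)))"
    and r1: "c1 * c4 = c2 * (\<kappa> + c1 + c4)"
    and r2: "c2 * c4 = c3 * (\<kappa> + c2 + c4)"
  shows "R\<^sub>1 c1 (R\<^sub>2 c2 (R\<^sub>1 c3 (R\<^sub>2 c4 f))) = R\<^sub>2 c4 (R\<^sub>1 c3 (R\<^sub>2 c2 (R\<^sub>1 c1 f)))"
proof
  fix x
  have e2: "c1*c2 - 1*c1*c4 + c2*c3 + c3*c4 + \<kappa>*c2 + \<kappa>*c3 = 0"
    using r1 r2 by algebra
  have "R\<^sub>1 c1 (R\<^sub>2 c2 (R\<^sub>1 c3 (R\<^sub>2 c4 f))) x - R\<^sub>2 c4 (R\<^sub>1 c3 (R\<^sub>2 c2 (R\<^sub>1 c1 f))) x =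
    (c1*c2 - 1*c1*c4 + c2*c3 + c3*c4 + \<kappa>*c2 + \<kappa>*c3) * (H\<^sub>1 (H\<^sub>2 f) x - H\<^sub>2 (H\<^sub>1 f) x) +
    (H\<^sub>1 (H\<^sub>2 (H\<^sub>1 (H\<^sub>2 f))) x - H\<^sub>2 (H\<^sub>1 (H\<^sub>2 (H\<^sub>1 f))) x)"
    by (simp add: expand algebra_simps power2_eq_square)
  then show "R\<^sub>1 c1 (R\<^sub>2 c2 (R\<^sub>1 c3 (R\<^sub>2 c4 f))) x = R\<^sub>2 c4 (R\<^sub>1 c3 (R\<^sub>2 c2 (R\<^sub>1 c1 f))) x"
    using assms(1) by (simp only: e2)
qed

text \<open>There is one premise for each of the five ways to write a coroot of a string of type G2
  as a sum of two others.\<close>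

lemma yang_baxter_6:
  assumes "H\<^sub>1 (H\<^sub>2 (H\<^sub>1 (H\<^sub>2 (H\<^sub>1 (H\<^sub>2 f))))) = H\<^sub>2 (H\<^sub>1 (H\<^sub>2 (H\<^sub>1 (H\<^sub>2 (H\<^sub>1 f)))))"
    and r1: "c1 * c6 = c2 * (\<kappa> + c1 + c6)"
    and r2: "c1 * c5 = c3 * (\<kappa> + c1 + c5)"
    and r3: "c2 * c4 = c3 * (\<kappa> + c2 + c4)"
    and r4: "c2 * c6 = c4 * (\<kappa> + c2 + c6)"
    and r5: "c4 * c6 = c5 * (\<kappa> + c4 + c6)"
  shows "R\<^sub>1 c1 (R\<^sub>2 c2 (R\<^sub>1 c3 (R\<^sub>2 c4 (R\<^sub>1 c5 (R\<^sub>2 c6 f))))) = R\<^sub>2 c6 (R\<^sub>1 c5 (R\<^sub>2 c4 (R\<^sub>1 c3 (R\<^sub>2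
      c2 (R\<^sub>1 c1 f)))))"
proof
  fix x
  have e2: "c1*c2*c3*c4 - 1*c1*c2*c3*c6 + c1*c2*c4*c5 + c1*c2*c5*c6 + c1*c3 - 1*c1*c3*c4*c6 -
      1*c1*c4*c5*c6 - 1*c1*c5 + c2*c3*c4*c5 + c2*c3*c5*c6 + c2*c4 - 1*c2*c6 + c3*c4*c5*c6 + c3*c5 +
      c4*c6 + \<kappa>*c1*c2*c4 + \<kappa>*c1*c2*c5 - 1*\<kappa>*c1*c3*c6 - 1*\<kappa>*c1*c4*c6 + \<kappa>*c2*c3*c4 + \<kappa>*c2*c3*c5 +
      \<kappa>*c2*c4*c5 + \<kappa>*c2*c5*c6 + \<kappa>*c3 + \<kappa>*c3*c4*c5 + \<kappa>*c3*c5*c6 + \<kappa>*c4 + \<kappa>^2*c2*c4 + \<kappa>^2*c2*c5 +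
      \<kappa>^2*c3*c5 = 0"
    using r1 r2 r3 r4 r5 by algebra
  have e4: "c1*c2 - 1*c1*c6 + c2*c3 + c3*c4 + c4*c5 + c5*c6 + \<kappa>*c2 + \<kappa>*c3 + \<kappa>*c4 + \<kappa>*c5 = 0"
    using r1 r2 r3 r4 r5 by algebra
  have "R\<^sub>1 c1 (R\<^sub>2 c2 (R\<^sub>1 c3 (R\<^sub>2 c4 (R\<^sub>1 c5 (R\<^sub>2 c6 f))))) x - R\<^sub>2 c6 (R\<^sub>1 c5 (R\<^sub>2 c4 (R\<^sub>1 c3
      (R\<^sub>2 c2 (R\<^sub>1 c1 f))))) x =
    (c1*c2*c3*c4 - 1*c1*c2*c3*c6 + c1*c2*c4*c5 + c1*c2*c5*c6 + c1*c3 - 1*c1*c3*c4*c6 - 1*c1*c4*c5*c6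
        - 1*c1*c5 + c2*c3*c4*c5 + c2*c3*c5*c6 + c2*c4 - 1*c2*c6 + c3*c4*c5*c6 + c3*c5 + c4*c6 +
        \<kappa>*c1*c2*c4 + \<kappa>*c1*c2*c5 - 1*\<kappa>*c1*c3*c6 - 1*\<kappa>*c1*c4*c6 + \<kappa>*c2*c3*c4 + \<kappa>*c2*c3*c5 + \<kappa>*c2*c4*c5
        + \<kappa>*c2*c5*c6 + \<kappa>*c3 + \<kappa>*c3*c4*c5 + \<kappa>*c3*c5*c6 + \<kappa>*c4 + \<kappa>^2*c2*c4 + \<kappa>^2*c2*c5 + \<kappa>^2*c3*c5) *
        (H\<^sub>1 (H\<^sub>2 f) x - H\<^sub>2 (H\<^sub>1 f) x) + (c1*c2 - 1*c1*c6 + c2*c3 + c3*c4 + c4*c5 + c5*c6 + \<kappa>*c2 +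
        \<kappa>*c3 + \<kappa>*c4 + \<kappa>*c5) * (H\<^sub>1 (H\<^sub>2 (H\<^sub>1 (H\<^sub>2 f))) x - H\<^sub>2 (H\<^sub>1 (H\<^sub>2 (H\<^sub>1 f))) x) +
    (H\<^sub>1 (H\<^sub>2 (H\<^sub>1 (H\<^sub>2 (H\<^sub>1 (H\<^sub>2 f))))) x - H\<^sub>2 (H\<^sub>1 (H\<^sub>2 (H\<^sub>1 (H\<^sub>2 (H\<^sub>1 f))))) x)"
    by (simp add: expand algebra_simps power2_eq_square)
  then show "R\<^sub>1 c1 (R\<^sub>2 c2 (R\<^sub>1 c3 (R\<^sub>2 c4 (R\<^sub>1 c5 (R\<^sub>2 c6 f))))) x = R\<^sub>2 c6 (R\<^sub>1 c5 (R\<^sub>2 c4 (R\<^sub>1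
      c3 (R\<^sub>2 c2 (R\<^sub>1 c1 f))))) x"
    using assms(1) by (simp only: e2 e4)
qed

end

text \<open>
  Outside the set \<open>X\<close> of states the operator \<open>hop\<close> is multiplication by a root of \<open>r\<^sup>2 = 1 + \<kappa> r\<close>.
  The quadratic and braid relations then hold for all functions, not only on \<open>X\<close>.
\<close>

definition hop_root :: "real \<Rightarrow> real" where
  "hop_root \<kappa> = (\<kappa> + sqrt (\<kappa>\<^sup>2 + 4)) / 2"

definition hop ::
  "'s set \<Rightarrow> real \<Rightarrow> ('s \<Rightarrow> 's) \<Rightarrow> ('s \<Rightarrow> bool) \<Rightarrow> ('s \<Rightarrow> real) \<Rightarrow> 's \<Rightarrow> real" where
  "hop X \<kappa> a A f = (\<lambda>x. if x \<in> X then f (a x) + (if A x then \<kappa> else 0) * f x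
     else hop_root \<kappa> * f x)"

lemma hop_root_square: "hop_root \<kappa> * hop_root \<kappa> = 1 + \<kappa> * hop_root \<kappa>"
proof -
  have "2 * hop_root \<kappa> - \<kappa> = sqrt (\<kappa>\<^sup>2 + 4)" by (simp add: hop_root_def field_simps)
  then have "(2 * hop_root \<kappa> - \<kappa>)\<^sup>2 = \<kappa>\<^sup>2 + 4" by simp
  then show ?thesis by (simp add: power2_eq_square algebra_simps)
qed

text \<open>Exactly one of x and \<open>a x\<close> satisfies \<open>A\<close>, so exactly one of
  the two diagonal terms \<kappa> occurs; off X the relation is the equation of
  \<open>hop_root\<close>.\<close>

lemma hop_quadratic:
  assumes "\<And>x. x \<in> X \<Longrightarrow> a x \<in> X" "\<And>x. x \<in> X \<Longrightarrow> a (a x) = x"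
    "\<And>x. x \<in> X \<Longrightarrow> A (a x) \<longleftrightarrow> \<not> A x"
  shows "hop X \<kappa> a A (hop X \<kappa> a A f) = (\<lambda>x. f x + \<kappa> * hop X \<kappa> a A f x)"
proof
  fix x
  have "hop_root \<kappa> * (hop_root \<kappa> * f x) = f x + \<kappa> * (hop_root \<kappa> * f x)"
    using arg_cong[OF hop_root_square[of \<kappa>], of "\<lambda>r. r * f x"] by (simp add: algebra_simps)
  then show "hop X \<kappa> a A (hop X \<kappa> a A f) x = f x + \<kappa> * hop X \<kappa> a A f x"
    by (cases "x \<in> X") (simp_all add: hop_def assms algebra_simps)
qed

text \<open>
  Position \<open>k\<close> of a rank two string with positions \<open>0, \<dots>, n\<close>: \<open>P k x\<close> says that \<open>x\<close> maps this root
  to a positive one, and \<open>a\<close>, \<open>b\<close> multiply by the reflections in the first and last root.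
\<close>

locale dihedral_states =
  fixes X :: "'s set" and n :: nat and a b :: "'s \<Rightarrow> 's" and P :: "nat \<Rightarrow> 's \<Rightarrow> bool" and \<kappa> :: real
  assumes a_in: "x \<in> X \<Longrightarrow> a x \<in> X" and b_in: "x \<in> X \<Longrightarrow> b x \<in> X"
    and a_inv: "x \<in> X \<Longrightarrow> a (a x) = x" and b_inv: "x \<in> X \<Longrightarrow> b (b x) = x"
    and P_a_0: "x \<in> X \<Longrightarrow> P 0 (a x) \<longleftrightarrow> \<not> P 0 x"
    and P_a: "x \<in> X \<Longrightarrow> 0 < k \<Longrightarrow> k \<le> n \<Longrightarrow> P k (a x) \<longleftrightarrow> P (Suc n - k) x"
    and P_b_n: "x \<in> X \<Longrightarrow> P n (b x) \<longleftrightarrow> \<not> P n x"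
    and P_b: "x \<in> X \<Longrightarrow> k < n \<Longrightarrow> P k (b x) \<longleftrightarrow> P (n - 1 - k) x"
    and P_convex: "x \<in> X \<Longrightarrow> P 0 x = P n x \<Longrightarrow> k \<le> n \<Longrightarrow> P k x = P 0 x"
begin

abbreviation "H\<^sub>1 \<equiv> hop X \<kappa> a (P 0)"
abbreviation "H\<^sub>2 \<equiv> hop X \<kappa> b (P n)"

sublocale hecke_pair \<kappa> H\<^sub>1 H\<^sub>2
proof
  show "H\<^sub>1 (H\<^sub>1 f) = (\<lambda>x. f x + \<kappa> * H\<^sub>1 f x)" "H\<^sub>2 (H\<^sub>2 f) = (\<lambda>x. f x + \<kappa> * H\<^sub>2 f x)" for f
    by (simp_all add: hop_quadratic a_in b_in a_inv b_inv P_a_0 P_b_n)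
qed (auto simp: hop_def fun_eq_iff algebra_simps)

lemma braid_2:
  assumes "n = 1" and br: "\<And>x. x \<in> X \<Longrightarrow> a (b x) = b (a x)"
  shows "H\<^sub>1 (H\<^sub>2 f) = H\<^sub>2 (H\<^sub>1 f)"
proof
  fix x
  show "H\<^sub>1 (H\<^sub>2 f) x = H\<^sub>2 (H\<^sub>1 f) x"
  proof (cases "x \<in> X")
    case False
    then show ?thesis by (simp add: hop_def)
  next
    case True
    note [simp] = True a_in b_in a_inv b_inv br
    have Pa: "P 0 (a y) \<longleftrightarrow> \<not> P 0 y" "P (Suc 0) (a y) \<longleftrightarrow> P (Suc 0) y" if "y \<in> X" for y
      using P_a_0[OF that] P_a[OF that] \<open>n = 1\<close> by simp_all
    have Pb: "P (Suc 0) (b y) \<longleftrightarrow> \<not> P (Suc 0) y" "P 0 (b y) \<longleftrightarrow> P 0 y" if "y \<in> X" for y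
      using P_b_n[OF that] P_b[OF that] \<open>n = 1\<close> by simp_all
    have conv: "P (Suc 0) y = P 0 y" if "y \<in> X" "P 0 y = P (Suc 0) y" for y
      by (intro conjI P_convex[unfolded \<open>n = 1\<close> One_nat_def, OF that]) simp_all
    have "\<not> P 0 x \<and> \<not> P (Suc 0) x \<or>
      P 0 x \<and> \<not> P (Suc 0) x \<or>
      P 0 x \<and> P (Suc 0) x \<or>
      \<not> P 0 x \<and> P (Suc 0) x"
      using conv[OF True]
      by blast
    then show ?thesis
      using \<open>n = 1\<close> by (elim disjE conjE) (simp_all add: hop_def Pa Pb algebra_simps)
  qed
qed

text \<open>The signs \<open>P k x\<close> change at most once along the string, so only 2(n + 1)
  patterns occur, as many as the dihedral group has elements. For each pattern both sides are
  evaluated.\<close>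

lemma braid_3:
  assumes "n = 2" and br: "\<And>x. x \<in> X \<Longrightarrow> a (b (a x)) = b (a (b x))"
  shows "H\<^sub>1 (H\<^sub>2 (H\<^sub>1 f)) = H\<^sub>2 (H\<^sub>1 (H\<^sub>2 f))"
proof
  fix x
  show "H\<^sub>1 (H\<^sub>2 (H\<^sub>1 f)) x = H\<^sub>2 (H\<^sub>1 (H\<^sub>2 f)) x"
  proof (cases "x \<in> X")
    case False
    then show ?thesis by (simp add: hop_def)
  next
    case True
    note [simp] = True a_in b_in a_inv b_inv br
    have Pa: "P 0 (a y) \<longleftrightarrow> \<not> P 0 y" "P (Suc 0) (a y) \<longleftrightarrow> P 2 y" "P 2 (a y) \<longleftrightarrow> P (Suc 0) y" if "y \<in> X" for y
      using P_a_0[OF that] P_a[OF that] \<open>n = 2\<close> by simp_all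
    have Pb: "P 2 (b y) \<longleftrightarrow> \<not> P 2 y" "P 0 (b y) \<longleftrightarrow> P (Suc 0) y" "P (Suc 0) (b y) \<longleftrightarrow> P 0 y" if "y \<in> X" for y
      using P_b_n[OF that] P_b[OF that] \<open>n = 2\<close> by simp_all
    have conv: "P (Suc 0) y = P 0 y \<and> P 2 y = P 0 y" if "y \<in> X" "P 0 y = P 2 y" for y
      by (intro conjI P_convex[unfolded \<open>n = 2\<close> One_nat_def, OF that]) simp_all
    have "\<not> P 0 x \<and> \<not> P (Suc 0) x \<and> \<not> P 2 x \<or>
      P 0 x \<and> \<not> P (Suc 0) x \<and> \<not> P 2 x \<or>
      P 0 x \<and> P (Suc 0) x \<and> \<not> P 2 x \<or>
      P 0 x \<and> P (Suc 0) x \<and> P 2 x \<or>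
      \<not> P 0 x \<and> P (Suc 0) x \<and> P 2 x \<or>
      \<not> P 0 x \<and> \<not> P (Suc 0) x \<and> P 2 x"
      \<comment> \<open>For a translate of x, \<open>conv\<close> concerns two neighbouring roots of
        the string: if the sign changes between them, it changes nowhere else. The translates run
        through all neighbouring pairs.\<close>
      using conv[OF True] conv[OF a_in[OF True]] conv[OF b_in[OF True]]
      by (simp (no_asm_use) add: Pa Pb) argo
    then show ?thesis
      using \<open>n = 2\<close> by (elim disjE conjE) (simp_all add: hop_def Pa Pb algebra_simps)
  qed
qed

lemma braid_4:
  assumes "n = 3" and br: "\<And>x. x \<in> X \<Longrightarrow> a (b (a (b x))) = b (a (b (a x)))"
  shows "H\<^sub>1 (H\<^sub>2 (H\<^sub>1 (H\<^sub>2 f))) = H\<^sub>2 (H\<^sub>1 (H\<^sub>2 (H\<^sub>1 f)))"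
proof
  fix x
  show "H\<^sub>1 (H\<^sub>2 (H\<^sub>1 (H\<^sub>2 f))) x = H\<^sub>2 (H\<^sub>1 (H\<^sub>2 (H\<^sub>1 f))) x"
  proof (cases "x \<in> X")
    case False
    then show ?thesis by (simp add: hop_def)
  next
    case True
    note [simp] = True a_in b_in a_inv b_inv br
    have Pa: "P 0 (a y) \<longleftrightarrow> \<not> P 0 y" "P (Suc 0) (a y) \<longleftrightarrow> P 3 y" "P 2 (a y) \<longleftrightarrow> P 2 y" "P 3 (a y) \<longleftrightarrow> P (Suc
        0) y" if "y \<in> X" for y
      using P_a_0[OF that] P_a[OF that] \<open>n = 3\<close> by simp_all
    have Pb: "P 3 (b y) \<longleftrightarrow> \<not> P 3 y" "P 0 (b y) \<longleftrightarrow> P 2 y" "P (Suc 0) (b y) \<longleftrightarrow> P (Suc 0) y" "P 2 (b y) \<longleftrightarrow>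
        P 0 y" if "y \<in> X" for y
      using P_b_n[OF that] P_b[OF that] \<open>n = 3\<close> by simp_all
    have conv: "P (Suc 0) y = P 0 y \<and> P 2 y = P 0 y \<and> P 3 y = P 0 y" if "y \<in> X" "P 0 y = P 3 y" for y
      by (intro conjI P_convex[unfolded \<open>n = 3\<close> One_nat_def, OF that]) simp_all
    have "\<not> P 0 x \<and> \<not> P (Suc 0) x \<and> \<not> P 2 x \<and> \<not> P 3 x \<or>
      P 0 x \<and> \<not> P (Suc 0) x \<and> \<not> P 2 x \<and> \<not> P 3 x \<or>
      P 0 x \<and> P (Suc 0) x \<and> \<not> P 2 x \<and> \<not> P 3 x \<or>
      P 0 x \<and> P (Suc 0) x \<and> P 2 x \<and> \<not> P 3 x \<or>
      P 0 x \<and> P (Suc 0) x \<and> P 2 x \<and> P 3 x \<or>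
      \<not> P 0 x \<and> P (Suc 0) x \<and> P 2 x \<and> P 3 x \<or>
      \<not> P 0 x \<and> \<not> P (Suc 0) x \<and> P 2 x \<and> P 3 x \<or>
      \<not> P 0 x \<and> \<not> P (Suc 0) x \<and> \<not> P 2 x \<and> P 3 x"
      using conv[OF True] conv[OF a_in[OF True]] conv[OF b_in[OF a_in[OF True]]] conv[OF b_in[OF
          True]] conv[OF a_in[OF b_in[OF True]]]
      by (simp (no_asm_use) add: Pa Pb) argo
    then show ?thesis
      using \<open>n = 3\<close> by (elim disjE conjE) (simp_all add: hop_def Pa Pb algebra_simps)
  qed
qed

lemma braid_6:
  assumes "n = 5" and br: "\<And>x. x \<in> X \<Longrightarrow> a (b (a (b (a (b x))))) = b (a (b (a (b (a x)))))"
  shows "H\<^sub>1 (H\<^sub>2 (H\<^sub>1 (H\<^sub>2 (H\<^sub>1 (H\<^sub>2 f))))) = H\<^sub>2 (H\<^sub>1 (H\<^sub>2 (H\<^sub>1 (H\<^sub>2 (H\<^sub>1 f)))))"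
proof
  fix x
  show "H\<^sub>1 (H\<^sub>2 (H\<^sub>1 (H\<^sub>2 (H\<^sub>1 (H\<^sub>2 f))))) x = H\<^sub>2 (H\<^sub>1 (H\<^sub>2 (H\<^sub>1 (H\<^sub>2 (H\<^sub>1 f))))) x"
  proof (cases "x \<in> X")
    case False
    then show ?thesis by (simp add: hop_def)
  next
    case True
    note [simp] = True a_in b_in a_inv b_inv br
    have Pa: "P 0 (a y) \<longleftrightarrow> \<not> P 0 y" "P (Suc 0) (a y) \<longleftrightarrow> P 5 y" "P 2 (a y) \<longleftrightarrow> P 4 y" "P 3 (a y) \<longleftrightarrow> P 3 y"
        "P 4 (a y) \<longleftrightarrow> P 2 y" "P 5 (a y) \<longleftrightarrow> P (Suc 0) y" if "y \<in> X" for y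
      using P_a_0[OF that] P_a[OF that] \<open>n = 5\<close> by simp_all
    have Pb: "P 5 (b y) \<longleftrightarrow> \<not> P 5 y" "P 0 (b y) \<longleftrightarrow> P 4 y" "P (Suc 0) (b y) \<longleftrightarrow> P 3 y" "P 2 (b y) \<longleftrightarrow> P 2 y"
        "P 3 (b y) \<longleftrightarrow> P (Suc 0) y" "P 4 (b y) \<longleftrightarrow> P 0 y" if "y \<in> X" for y
      using P_b_n[OF that] P_b[OF that] \<open>n = 5\<close> by simp_all
    have conv: "P (Suc 0) y = P 0 y \<and> P 2 y = P 0 y \<and> P 3 y = P 0 y \<and> P 4 y = P 0 y \<and> P 5 y = P 0 y"
        if "y \<in> X" "P 0 y = P 5 y" for y
      by (intro conjI P_convex[unfolded \<open>n = 5\<close> One_nat_def, OF that]) simp_all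
    have "\<not> P 0 x \<and> \<not> P (Suc 0) x \<and> \<not> P 2 x \<and> \<not> P 3 x \<and> \<not> P 4 x \<and> \<not> P 5 x \<or>
      P 0 x \<and> \<not> P (Suc 0) x \<and> \<not> P 2 x \<and> \<not> P 3 x \<and> \<not> P 4 x \<and> \<not> P 5 x \<or>
      P 0 x \<and> P (Suc 0) x \<and> \<not> P 2 x \<and> \<not> P 3 x \<and> \<not> P 4 x \<and> \<not> P 5 x \<or>
      P 0 x \<and> P (Suc 0) x \<and> P 2 x \<and> \<not> P 3 x \<and> \<not> P 4 x \<and> \<not> P 5 x \<or>
      P 0 x \<and> P (Suc 0) x \<and> P 2 x \<and> P 3 x \<and> \<not> P 4 x \<and> \<not> P 5 x \<or>
      P 0 x \<and> P (Suc 0) x \<and> P 2 x \<and> P 3 x \<and> P 4 x \<and> \<not> P 5 x \<or>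
      P 0 x \<and> P (Suc 0) x \<and> P 2 x \<and> P 3 x \<and> P 4 x \<and> P 5 x \<or>
      \<not> P 0 x \<and> P (Suc 0) x \<and> P 2 x \<and> P 3 x \<and> P 4 x \<and> P 5 x \<or>
      \<not> P 0 x \<and> \<not> P (Suc 0) x \<and> P 2 x \<and> P 3 x \<and> P 4 x \<and> P 5 x \<or>
      \<not> P 0 x \<and> \<not> P (Suc 0) x \<and> \<not> P 2 x \<and> P 3 x \<and> P 4 x \<and> P 5 x \<or>
      \<not> P 0 x \<and> \<not> P (Suc 0) x \<and> \<not> P 2 x \<and> \<not> P 3 x \<and> P 4 x \<and> P 5 x \<or>
      \<not> P 0 x \<and> \<not> P (Suc 0) x \<and> \<not> P 2 x \<and> \<not> P 3 x \<and> \<not> P 4 x \<and> P 5 x"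
      using conv[OF True] conv[OF a_in[OF True]] conv[OF b_in[OF a_in[OF True]]] conv[OF a_in[OF
          b_in[OF a_in[OF True]]]] conv[OF b_in[OF a_in[OF b_in[OF a_in[OF True]]]]] conv[OF b_in[OF
          True]] conv[OF a_in[OF b_in[OF True]]] conv[OF b_in[OF a_in[OF b_in[OF True]]]] conv[OF
          a_in[OF b_in[OF a_in[OF b_in[OF True]]]]]
      by (simp (no_asm_use) add: Pa Pb) argo
    then show ?thesis
      using \<open>n = 5\<close> by (elim disjE conjE) (simp_all add: hop_def Pa Pb algebra_simps)
  qed
qed

end

section \<open>Path sums along rank two strings\<close>

context rank2
begin

lemma rank2_data_exists:
  "\<exists>n xs ys. n \<in> {1, 2, 3, 5} \<and> rank2_data \<alpha> \<beta> n xs ys \<and> length xs = Suc n \<and> length ys = Suc n \<and>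
     distinct (zip xs ys) \<and> (0, 0) \<notin> set (zip xs ys) \<and> xs ! n = 0 \<and> ys ! n = 1"
proof (cases rule: rank2_data_cases)
  case A1A1
  then show ?thesis by (intro exI[of _ 1] exI[of _ "[1, 0]"] exI[of _ "[0, 1]"]) simp
next
  case A2
  then show ?thesis by (intro exI[of _ 2] exI[of _ "[1, 1, 0]"] exI[of _ "[0, 1, 1]"]) simp
next
  case B2
  then show ?thesis by (intro exI[of _ 3] exI[of _ "[1, 2, 1, 0]"] exI[of _ "[0, 1, 1, 1]"]) simp
next
  case C2
  then show ?thesis by (intro exI[of _ 3] exI[of _ "[1, 1, 1, 0]"] exI[of _ "[0, 1, 2, 1]"]) simp
next
  case G2
  then show ?thesis
    by (intro exI[of _ 5] exI[of _ "[1, 3, 2, 3, 1, 0]"] exI[of _ "[0, 1, 1, 2, 1, 1]"]) simp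
next
  case G2'
  then show ?thesis
    by (intro exI[of _ 5] exI[of _ "[1, 1, 2, 1, 1, 0]"] exI[of _ "[0, 1, 3, 2, 3, 1]"]) simp
qed

text \<open>What the geometry of alcoves uses of the tables, independently of the type.\<close>

lemma rank2_structure:
  obtains n where "n \<in> {1, 2, 3, 5}"
    "rank2_string \<alpha> \<beta> = map (alternating \<alpha> \<beta>) [0..<Suc n]"
    "\<And>i. i \<le> n \<Longrightarrow> alternating \<beta> \<alpha> i = alternating \<alpha> \<beta> (n - i)"
    "alternating \<alpha> \<beta> n = \<beta>"
    "\<And>i. i \<le> n \<Longrightarrow> \<exists>x y :: nat. alternating \<alpha> \<beta> i = comb \<alpha> \<beta> (real x) (real y) \<and> (x \<noteq> 0 \<or> y \<noteq> 0)"
    "\<And>i j. i \<le> n \<Longrightarrow> j \<le> n \<Longrightarrow> i \<noteq> j \<Longrightarrow>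
      alternating \<alpha> \<beta> i \<noteq> alternating \<alpha> \<beta> j \<and> alternating \<alpha> \<beta> i \<noteq> - alternating \<alpha> \<beta> j"
proof -
  obtain n xs ys where n: "n \<in> {1, 2, 3, 5}" and d: "rank2_data \<alpha> \<beta> n xs ys"
    and len: "length xs = Suc n" "length ys = Suc n"
    and dist: "distinct (zip xs ys)" "(0, 0) \<notin> set (zip xs ys)" "xs ! n = 0" "ys ! n = 1"
    using rank2_data_exists by blast
  have alt: "alternating \<alpha> \<beta> i = comb \<alpha> \<beta> (xs ! i) (ys ! i)"
    "alternating \<beta> \<alpha> i = comb \<alpha> \<beta> (xs ! (n - i)) (ys ! (n - i))" if "i \<le> n" for i
    using d that unfolding rank2_data_def by blast+
  have nz: "xs ! i \<noteq> 0 \<or> ys ! i \<noteq> 0" if "i \<le> n" for i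
  proof -
    have "zip xs ys ! i \<in> set (zip xs ys)" using that len by (intro nth_mem) simp
    moreover have "zip xs ys ! i = (xs ! i, ys ! i)" using that len by simp
    ultimately show ?thesis using dist(2) by metis
  qed
  have ne: "\<not> (xs ! i = xs ! j \<and> ys ! i = ys ! j)" if "i \<le> n" "j \<le> n" "i \<noteq> j" for i j
    using dist(1) that len nth_eq_iff_index_eq[OF dist(1), of i j] by simp
  have last: "alternating \<alpha> \<beta> n = \<beta>" using alt(1)[of n] dist by (simp add: comb_unit)
  show thesis
  proof (rule that[OF n])
    show "rank2_string \<alpha> \<beta> = map (alternating \<alpha> \<beta>) [0..<Suc n]"
    proof (rule rank2_string_eq[OF last])
      show "alternating \<alpha> \<beta> i \<noteq> \<beta>" if "i < n" for i
        using ne[of i n] alt(1)[of i] that dist by (auto simp: comb_eq_right)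
    qed
    show "alternating \<beta> \<alpha> i = alternating \<alpha> \<beta> (n - i)" if "i \<le> n" for i
      using alt that by simp
    show "\<exists>x y :: nat. alternating \<alpha> \<beta> i = comb \<alpha> \<beta> (real x) (real y) \<and> (x \<noteq> 0 \<or> y \<noteq> 0)"
      if "i \<le> n" for i using alt(1) nz that by blast
    show "alternating \<alpha> \<beta> i \<noteq> alternating \<alpha> \<beta> j \<and> alternating \<alpha> \<beta> i \<noteq> - alternating \<alpha> \<beta> j"
      if "i \<le> n" "j \<le> n" "i \<noteq> j" for i j
    proof -
      have "comb \<alpha> \<beta> (xs ! i) (ys ! i) \<noteq> comb \<alpha> \<beta> (- real (xs ! j)) (- real (ys ! j))"
        unfolding comb_eq_iff using nz[OF that(1)] by auto
      moreover have "- comb \<alpha> \<beta> (xs ! j) (ys ! j) = comb \<alpha> \<beta> (- real (xs ! j)) (- real (ys ! j))"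
        by (simp add: comb_def)
      ultimately show ?thesis using alt(1) that ne[OF that] by (simp add: comb_eq_iff)
    qed
  qed (fact last)
qed

lemma rank2_string_swap: "rank2_string \<beta> \<alpha> = rev (rank2_string \<alpha> \<beta>)"
proof -
  interpret sw: rank2 \<beta> \<alpha> by (rule swap)
  obtain n where n: "rank2_string \<alpha> \<beta> = map (alternating \<alpha> \<beta>) [0..<Suc n]"
    "\<And>i. i \<le> n \<Longrightarrow> alternating \<beta> \<alpha> i = alternating \<alpha> \<beta> (n - i)"
    and ne: "\<And>i j. i \<le> n \<Longrightarrow> j \<le> n \<Longrightarrow> i \<noteq> j \<Longrightarrow>
      alternating \<alpha> \<beta> i \<noteq> alternating \<alpha> \<beta> j \<and> alternating \<alpha> \<beta> i \<noteq> - alternating \<alpha> \<beta> j"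
    using rank2_structure by metis
  have "rank2_string \<beta> \<alpha> = map (alternating \<beta> \<alpha>) [0..<Suc n]"
  proof (rule rank2_string_eq)
    show "alternating \<beta> \<alpha> n = \<alpha>" using n(2)[of n] by simp
    show "alternating \<beta> \<alpha> i \<noteq> \<alpha>" if "i < n" for i
      using n(2)[of i] ne[of "n - i" 0] that by simp
  qed
  also have "\<dots> = rev (map (alternating \<alpha> \<beta>) [0..<Suc n])"
    by (rule nth_equalityI) (auto simp: n(2) rev_nth simp del: upt_Suc)
  finally show ?thesis using n(1) by simp
qed

end

section \<open>Path sums, their deformation, and Hecke operators\<close>

text \<open>The product of the operators \<open>1 + Q\<close> along the list, applied to f: each
  root is skipped or used, and f is evaluated at the end of the path.\<close>

fun psum ::
  "(('a::euclidean_space \<Rightarrow> 'a) \<Rightarrow> 'a \<Rightarrow> real) \<Rightarrow> 'a list \<Rightarrow> (('a \<Rightarrow> 'a) \<Rightarrow> real) \<Rightarrow> ('a \<Rightarrow> 'a) \<Rightarrow> real"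
  where
  "psum c [] f x = f x"
| "psum c (\<gamma> # L) f x = psum c L f x + c x \<gamma> * psum c L f (x \<circ> root_refl \<gamma>)"

context based_root_system
begin

text \<open>The coefficient is \<kappa> / (1 - e) or \<kappa> e / (1 - e) according to the sign of
  \<open>x \<gamma>\<close>. The weight e is stored with its root because it must stay unchanged
  when the root is reflected, as in \<open>msum_refl\<close>.\<close>

fun msum :: "real \<Rightarrow> ('a \<times> real) list \<Rightarrow> (('a \<Rightarrow> 'a) \<Rightarrow> real) \<Rightarrow> ('a \<Rightarrow> 'a) \<Rightarrow> real" where
  "msum \<kappa> [] f x = f x"
| "msum \<kappa> ((\<gamma>, e) # L) f x = msum \<kappa> L f x +
     (\<kappa> * e / (1 - e) + (if x \<gamma> \<in> Pos then \<kappa> else 0)) * msum \<kappa> L f (x \<circ> root_refl \<gamma>)"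

lemma msum_refl:
  "msum \<kappa> (map (\<lambda>(\<gamma>, e). (root_refl \<alpha> \<gamma>, e)) L) f x =
   msum \<kappa> L (\<lambda>z. f (z \<circ> root_refl \<alpha>)) (x \<circ> root_refl \<alpha>)"
proof (induction L arbitrary: x)
  case Nil
  then show ?case by (simp add: comp_assoc)
next
  case (Cons p L)
  obtain \<gamma> e where p: "p = (\<gamma>, e)" by (cases p)
  have "x \<circ> root_refl (root_refl \<alpha> \<gamma>) \<circ> root_refl \<alpha> = x \<circ> root_refl \<alpha> \<circ> root_refl \<gamma>"
    by (simp add: root_refl_root_refl fun_eq_iff)
  then show ?case using Cons.IH by (simp add: p o_def)
qed

abbreviation "chop \<kappa> \<alpha> \<equiv> hop W \<kappa> (\<lambda>x. x \<circ> root_refl \<alpha>) (\<lambda>x. x \<alpha> \<in> Pos)"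

text \<open>The factors \<open>chop + c\<close> alternate between \<alpha> and \<beta>; the
  reflections split off from the path are collected in the argument of f.\<close>

fun tower :: "real \<Rightarrow> 'a \<Rightarrow> 'a \<Rightarrow> real list \<Rightarrow> (('a \<Rightarrow> 'a) \<Rightarrow> real) \<Rightarrow> ('a \<Rightarrow> 'a) \<Rightarrow> real" where
  "tower \<kappa> \<alpha> \<beta> [] f = f"
| "tower \<kappa> \<alpha> \<beta> (c # cs) f =
     (\<lambda>x. chop \<kappa> \<alpha> (tower \<kappa> \<beta> \<alpha> cs (\<lambda>z. f (z \<circ> root_refl \<alpha>))) x +
          c * tower \<kappa> \<beta> \<alpha> cs (\<lambda>z. f (z \<circ> root_refl \<alpha>)) x)"

text \<open>
  Conjugating the later roots back by the reflections already used turns every factor of the path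
  sum into a Hecke generator plus a scalar.
\<close>

lemma msum_eq_tower:
  assumes "\<alpha> \<in> \<Delta>" "\<beta> \<in> \<Delta>" "x \<in> W"
  shows "msum \<kappa> (zip (map (alternating \<alpha> \<beta>) [0..<length es]) es) f x =
    tower \<kappa> \<alpha> \<beta> (map (\<lambda>e. \<kappa> * e / (1 - e)) es) f x"
  using assms
proof (induction es arbitrary: \<alpha> \<beta> f x)
  case Nil
  then show ?case by simp
next
  case (Cons e es)
  let ?L = "zip (map (alternating \<beta> \<alpha>) [0..<length es]) es"
  let ?g = "\<lambda>z. f (z \<circ> root_refl \<alpha>)"
  have "map (alternating \<alpha> \<beta>) [0..<length (e # es)] =
    \<alpha> # map (root_refl \<alpha>) (map (alternating \<beta> \<alpha>) [0..<length es])"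
    by (simp add: upt_conv_Cons map_Suc_upt[symmetric] del: upt_Suc)
  then have "zip (map (alternating \<alpha> \<beta>) [0..<length (e # es)]) (e # es) =
    (\<alpha>, e) # map (\<lambda>(\<gamma>, e). (root_refl \<alpha> \<gamma>, e)) ?L"
    by (simp only: zip_Cons_Cons zip_map1)
  moreover have "x \<circ> root_refl \<alpha> \<in> W" using Cons weyl_refl by blast
  moreover have "x \<circ> root_refl \<alpha> \<circ> root_refl \<alpha> = x" by (simp add: fun_eq_iff)
  moreover have "msum \<kappa> ?L ?g y = tower \<kappa> \<beta> \<alpha> (map (\<lambda>e. \<kappa> * e / (1 - e)) es) ?g y" if "y \<in> W" for y
    using Cons that by blast
  ultimately show ?case
    using Cons.prems(3)
    by (simp only: msum.simps msum_refl tower.simps list.map hop_def)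
      (simp only: if_True distrib_right mult.commute add.assoc add.commute add.left_commute)
qed

text \<open>In terms of c + \<kappa>/2 = (\<kappa>/2)(1 + e)/(1 - e) this is the addition theorem of
  the hyperbolic cotangent.\<close>

lemma coefficient_relation:
  fixes e1 e2 e3 \<kappa> :: real
  assumes "e2 = e1 * e3" "e1 \<noteq> 1" "e2 \<noteq> 1" "e3 \<noteq> 1"
  shows "(\<kappa> * e1 / (1 - e1)) * (\<kappa> * e3 / (1 - e3)) =
    (\<kappa> * e2 / (1 - e2)) * (\<kappa> + \<kappa> * e1 / (1 - e1) + \<kappa> * e3 / (1 - e3))"
proof -
  have "1 - e1 \<noteq> 0" "1 - e1 * e3 \<noteq> 0" "1 - e3 \<noteq> 0" using assms by auto
  then show ?thesis unfolding assms(1) by (simp add: divide_simps) algebra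
qed

lemma alternating_root:
  "\<alpha> \<in> \<Delta> \<Longrightarrow> \<beta> \<in> \<Delta> \<Longrightarrow> alternating \<alpha> \<beta> i \<in> \<Delta>"
  by (induction i arbitrary: \<alpha> \<beta>) (simp_all add: root_refl_root)

text \<open>Reflecting in \<alpha> turns the tail of the string into the string that starts with
  \<beta>, which is the reversed one; hence the index shift in \<open>P_a\<close>, and likewise for
  \<beta>. Convexity holds because every root of the string is a nonnegative combination of \<alpha>
  and \<beta>.\<close>

lemma dihedral_states_string:
  assumes "\<alpha> \<in> \<Delta>" "\<beta> \<in> \<Delta>" "alternating \<alpha> \<beta> n = \<beta>"
    and rev: "\<And>i. i \<le> n \<Longrightarrow> alternating \<beta> \<alpha> i = alternating \<alpha> \<beta> (n - i)"
    and cone: "\<And>i. i \<le> n \<Longrightarrow> \<exists>x y :: nat. alternating \<alpha> \<beta> i = comb \<alpha> \<beta> (real x) (real y)"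
  shows "dihedral_states W n (\<lambda>x. x \<circ> root_refl \<alpha>) (\<lambda>x. x \<circ> root_refl \<beta>)
    (\<lambda>k x. x (alternating \<alpha> \<beta> k) \<in> Pos)"
proof
  fix x assume x: "x \<in> W"
  show "x \<circ> root_refl \<alpha> \<in> W" "x \<circ> root_refl \<beta> \<in> W"
    using x assms weyl_refl by blast+
  show "x \<circ> root_refl \<alpha> \<circ> root_refl \<alpha> = x" "x \<circ> root_refl \<beta> \<circ> root_refl \<beta> = x"
    by (simp_all add: fun_eq_iff)
  have neg: "x (- \<gamma>) \<in> Pos \<longleftrightarrow> x \<gamma> \<notin> Pos" if "\<gamma> \<in> \<Delta>" for \<gamma>
    using that x weyl_root neg_root_iff weyl_uminus[OF x] by simp
  show "(x \<circ> root_refl \<alpha>) (alternating \<alpha> \<beta> 0) \<in> Pos \<longleftrightarrow> \<not> x (alternating \<alpha> \<beta> 0) \<in> Pos"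
    using neg assms by (simp add: root_refl_self)
  show "(x \<circ> root_refl \<beta>) (alternating \<alpha> \<beta> n) \<in> Pos \<longleftrightarrow> \<not> x (alternating \<alpha> \<beta> n) \<in> Pos"
    using neg assms by (simp add: root_refl_self)
  fix k
  show "(x \<circ> root_refl \<alpha>) (alternating \<alpha> \<beta> k) \<in> Pos \<longleftrightarrow> x (alternating \<alpha> \<beta> (Suc n - k)) \<in> Pos"
    if "0 < k" "k \<le> n"
  proof -
    obtain i where i: "k = Suc i" using \<open>0 < k\<close> gr0_conv_Suc by blast
    then show ?thesis using rev[of i] that by simp
  qed
  show "(x \<circ> root_refl \<beta>) (alternating \<alpha> \<beta> k) \<in> Pos \<longleftrightarrow> x (alternating \<alpha> \<beta> (n - 1 - k)) \<in> Pos"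
    if "k < n"
  proof -
    have "alternating \<alpha> \<beta> k = alternating \<beta> \<alpha> (Suc (n - 1 - k))"
      using rev[of "n - k"] that by (simp add: Suc_diff_Suc del: alternating.simps)
    then show ?thesis by simp
  qed
  assume eq: "(x (alternating \<alpha> \<beta> 0) \<in> Pos) = (x (alternating \<alpha> \<beta> n) \<in> Pos)" and k: "k \<le> n"
  obtain u v :: nat where "alternating \<alpha> \<beta> k = comb \<alpha> \<beta> (real u) (real v)" using cone k by blast
  then have lin: "x (alternating \<alpha> \<beta> k) = real u *\<^sub>R x \<alpha> + real v *\<^sub>R x \<beta>"
    using weyl_linear[OF x] by (simp add: comb_def linear_add linear_scale)
  have r: "x (alternating \<alpha> \<beta> k) \<in> \<Delta>" "x \<alpha> \<in> \<Delta>" "x \<beta> \<in> \<Delta>"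
    using weyl_root[OF x] alternating_root assms by auto
  show "(x (alternating \<alpha> \<beta> k) \<in> Pos) = (x (alternating \<alpha> \<beta> 0) \<in> Pos)"
  proof (cases "x \<alpha> \<in> Pos")
    case True
    then show ?thesis
      using eq assms pos_root_comb[OF r(1) lin] by simp
  next
    case False
    then have "- x \<alpha> \<in> Pos" "- x \<beta> \<in> Pos" using eq assms r neg_root_iff by auto
    moreover have "- x (alternating \<alpha> \<beta> k) = real u *\<^sub>R (- x \<alpha>) + real v *\<^sub>R (- x \<beta>)"
      unfolding lin by simp
    ultimately have "- x (alternating \<alpha> \<beta> k) \<in> Pos"
      using pos_root_comb[of "- x (alternating \<alpha> \<beta> k)" "real u" "- x \<alpha>" "real v" "- x \<beta>"]
        uminus_root[OF r(1)] by simp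
    then show ?thesis using False r neg_root_iff by simp
  qed
qed

section \<open>The Yang-Baxter equation for each type of string\<close>

lemma msum_string_2:
  assumes ab: "\<alpha> \<in> \<Delta>" "\<beta> \<in> \<Delta>" and x: "x \<in> W"
    and last: "alternating \<alpha> \<beta> 1 = \<beta>"
    and rev: "\<And>i. i \<le> 1 \<Longrightarrow> alternating \<beta> \<alpha> i = alternating \<alpha> \<beta> (1 - i)"
    and cone: "\<And>i. i \<le> 1 \<Longrightarrow> \<exists>x y :: nat. alternating \<alpha> \<beta> i = comb \<alpha> \<beta> (real x) (real y)"
    and e: "\<And>i. i \<le> 1 \<Longrightarrow> e i = exp (real ([1, 0] ! i) * u + real ([0, 1] ! i) * v)"
    and ne: "\<And>i. i \<le> 1 \<Longrightarrow> e i \<noteq> 1"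
  shows "msum \<kappa> (zip (map (alternating \<alpha> \<beta>) [0..<Suc 1]) (map e [0..<Suc 1])) f x =
    msum \<kappa> (zip (map (alternating \<beta> \<alpha>) [0..<Suc 1]) (map (\<lambda>i. e (1 - i)) [0..<Suc 1])) f x"
proof -
  let ?c = "\<lambda>e. \<kappa> * e / (1 - e)"
  have nes: "e 0 \<noteq> 1" "e (Suc 0) \<noteq> 1"
    using ne by simp_all
  interpret ds: dihedral_states W 1 "\<lambda>x. x \<circ> root_refl \<alpha>" "\<lambda>x. x \<circ> root_refl \<beta>"
    "\<lambda>k x. x (alternating \<alpha> \<beta> k) \<in> Pos" \<kappa>
    by (rule dihedral_states_string[OF ab last rev cone])
  \<comment> \<open>The braid relation comes from the last root: its reflection is
    \<open>root_refl \<beta>\<close>, and as a conjugate it is an alternating word of length 2n + 1,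
    here 3.\<close>
  have "root_refl (alternating \<alpha> \<beta> 1) v =
      root_refl \<alpha> (root_refl \<beta> (root_refl \<alpha> v))" for v
    by (simp add: root_refl_root_refl eval_nat_numeral)
  then have refl: "root_refl \<beta> v =
      root_refl \<alpha> (root_refl \<beta> (root_refl \<alpha> v))" for v unfolding last .
  have word: "root_refl \<beta> (root_refl \<alpha> v) =
      root_refl \<alpha> (root_refl \<beta> v)" for v
    by (subst refl[of "root_refl \<alpha> v"]) simp
  have br: "z \<circ> root_refl \<beta> \<circ> root_refl \<alpha> =
      z \<circ> root_refl \<alpha> \<circ> root_refl \<beta>" for z :: "'a \<Rightarrow> 'a"
    using word by (simp add: fun_eq_iff)
  note yb = ds.yang_baxter_2[OF ds.braid_2[OF HOL.refl br],
      unfolded ds.R\<^sub>1_def ds.R\<^sub>2_def, unfolded alternating.simps(1) last]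
  \<comment> \<open>Both towers end in f composed with an alternating word; \<open>br\<close>
    identifies the two words.\<close>
  have "tower \<kappa> \<alpha> \<beta> [?c (e 0), ?c (e (Suc 0))] f x =
      tower \<kappa> \<beta> \<alpha> [?c (e (Suc 0)), ?c (e 0)] f x"
    by (simp only: tower.simps br) (rule fun_cong[OF yb])
  moreover have "map e [0..<Suc 1] = [e 0, e (Suc 0)]" "map (\<lambda>i. e (1 - i)) [0..<Suc 1] = [e (Suc 0), e 0]"
    by (simp_all add: eval_nat_numeral)
  ultimately show ?thesis
    using msum_eq_tower[OF ab x, of \<kappa> "[e 0, e (Suc 0)]" f]
      msum_eq_tower[OF ab(2,1) x, of \<kappa> "[e (Suc 0), e 0]" f]
    by (simp add: eval_nat_numeral del: upt_Suc)
qed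

lemma msum_string_3:
  assumes ab: "\<alpha> \<in> \<Delta>" "\<beta> \<in> \<Delta>" and x: "x \<in> W"
    and last: "alternating \<alpha> \<beta> 2 = \<beta>"
    and rev: "\<And>i. i \<le> 2 \<Longrightarrow> alternating \<beta> \<alpha> i = alternating \<alpha> \<beta> (2 - i)"
    and cone: "\<And>i. i \<le> 2 \<Longrightarrow> \<exists>x y :: nat. alternating \<alpha> \<beta> i = comb \<alpha> \<beta> (real x) (real y)"
    and e: "\<And>i. i \<le> 2 \<Longrightarrow> e i = exp (real ([1, 1, 0] ! i) * u + real ([0, 1, 1] ! i) * v)"
    and ne: "\<And>i. i \<le> 2 \<Longrightarrow> e i \<noteq> 1"
  shows "msum \<kappa> (zip (map (alternating \<alpha> \<beta>) [0..<Suc 2]) (map e [0..<Suc 2])) f x =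
    msum \<kappa> (zip (map (alternating \<beta> \<alpha>) [0..<Suc 2]) (map (\<lambda>i. e (2 - i)) [0..<Suc 2])) f x"
proof -
  let ?c = "\<lambda>e. \<kappa> * e / (1 - e)"
  have nes: "e 0 \<noteq> 1" "e (Suc 0) \<noteq> 1" "e 2 \<noteq> 1"
    using ne by simp_all
  have rel: "e (Suc 0) = e 0 * e 2"
    by (simp_all add: e exp_add[symmetric] algebra_simps)
  interpret ds: dihedral_states W 2 "\<lambda>x. x \<circ> root_refl \<alpha>" "\<lambda>x. x \<circ> root_refl \<beta>"
    "\<lambda>k x. x (alternating \<alpha> \<beta> k) \<in> Pos" \<kappa>
    by (rule dihedral_states_string[OF ab last rev cone])
  have "root_refl (alternating \<alpha> \<beta> 2) v =
      root_refl \<alpha> (root_refl \<beta> (root_refl \<alpha> (root_refl \<beta> (root_refl \<alpha> v))))" for v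
    by (simp add: root_refl_root_refl eval_nat_numeral)
  then have refl: "root_refl \<beta> v =
      root_refl \<alpha> (root_refl \<beta> (root_refl \<alpha> (root_refl \<beta> (root_refl \<alpha> v))))" for v unfolding last .
  have word: "root_refl \<beta> (root_refl \<alpha> (root_refl \<beta> v)) =
      root_refl \<alpha> (root_refl \<beta> (root_refl \<alpha> v))" for v
    by (subst refl[of "root_refl \<alpha> (root_refl \<beta> v)"]) simp
  have br: "z \<circ> root_refl \<alpha> \<circ> root_refl \<beta> \<circ> root_refl \<alpha> =
      z \<circ> root_refl \<beta> \<circ> root_refl \<alpha> \<circ> root_refl \<beta>" for z :: "'a \<Rightarrow> 'a"
    using word by (simp add: fun_eq_iff)
  note yb = ds.yang_baxter_3[OF ds.braid_3[OF HOL.refl br]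
      coefficient_relation[OF rel(1) nes(1) nes(2) nes(3)],
      unfolded ds.R\<^sub>1_def ds.R\<^sub>2_def, unfolded alternating.simps(1) last]
  have "tower \<kappa> \<alpha> \<beta> [?c (e 0), ?c (e (Suc 0)), ?c (e 2)] f x =
      tower \<kappa> \<beta> \<alpha> [?c (e 2), ?c (e (Suc 0)), ?c (e 0)] f x"
    by (simp only: tower.simps br) (rule fun_cong[OF yb])
  moreover have "map e [0..<Suc 2] = [e 0, e (Suc 0), e 2]" "map (\<lambda>i. e (2 - i)) [0..<Suc 2] = [e 2,
      e (Suc 0), e 0]"
    by (simp_all add: eval_nat_numeral)
  ultimately show ?thesis
    using msum_eq_tower[OF ab x, of \<kappa> "[e 0, e (Suc 0), e 2]" f]
      msum_eq_tower[OF ab(2,1) x, of \<kappa> "[e 2, e (Suc 0), e 0]" f]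
    by (simp add: eval_nat_numeral del: upt_Suc)
qed

text \<open>The exponents are the coordinates of the coroots, so \<open>e\<close> turns sums of
  coroots into products; this gives the premises of \<open>yang_baxter_4\<close>.\<close>

lemma msum_string_4:
  assumes ab: "\<alpha> \<in> \<Delta>" "\<beta> \<in> \<Delta>" and x: "x \<in> W"
    and last: "alternating \<alpha> \<beta> 3 = \<beta>"
    and rev: "\<And>i. i \<le> 3 \<Longrightarrow> alternating \<beta> \<alpha> i = alternating \<alpha> \<beta> (3 - i)"
    and cone: "\<And>i. i \<le> 3 \<Longrightarrow> \<exists>x y :: nat. alternating \<alpha> \<beta> i = comb \<alpha> \<beta> (real x) (real y)"
    and e: "\<And>i. i \<le> 3 \<Longrightarrow> e i = exp (real ([1, 1, 1, 0] ! i) * u + real ([0, 1, 2, 1] ! i) * v)"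
    and ne: "\<And>i. i \<le> 3 \<Longrightarrow> e i \<noteq> 1"
  shows "msum \<kappa> (zip (map (alternating \<alpha> \<beta>) [0..<Suc 3]) (map e [0..<Suc 3])) f x =
    msum \<kappa> (zip (map (alternating \<beta> \<alpha>) [0..<Suc 3]) (map (\<lambda>i. e (3 - i)) [0..<Suc 3])) f x"
proof -
  let ?c = "\<lambda>e. \<kappa> * e / (1 - e)"
  have nes: "e 0 \<noteq> 1" "e (Suc 0) \<noteq> 1" "e 2 \<noteq> 1" "e 3 \<noteq> 1"
    using ne by simp_all
  have rel: "e (Suc 0) = e 0 * e 3" "e 2 = e (Suc 0) * e 3"
    by (simp_all add: e exp_add[symmetric] algebra_simps)
  interpret ds: dihedral_states W 3 "\<lambda>x. x \<circ> root_refl \<alpha>" "\<lambda>x. x \<circ> root_refl \<beta>"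
    "\<lambda>k x. x (alternating \<alpha> \<beta> k) \<in> Pos" \<kappa>
    by (rule dihedral_states_string[OF ab last rev cone])
  have "root_refl (alternating \<alpha> \<beta> 3) v =
      root_refl \<alpha> (root_refl \<beta> (root_refl \<alpha> (root_refl \<beta> (root_refl \<alpha> (root_refl \<beta> (root_refl \<alpha>
          v))))))" for v
    by (simp add: root_refl_root_refl eval_nat_numeral)
  then have refl: "root_refl \<beta> v =
      root_refl \<alpha> (root_refl \<beta> (root_refl \<alpha> (root_refl \<beta> (root_refl \<alpha> (root_refl \<beta> (root_refl \<alpha>
          v))))))" for v unfolding last .
  have word: "root_refl \<beta> (root_refl \<alpha> (root_refl \<beta> (root_refl \<alpha> v))) =
      root_refl \<alpha> (root_refl \<beta> (root_refl \<alpha> (root_refl \<beta> v)))" for v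
    by (subst refl[of "root_refl \<alpha> (root_refl \<beta> (root_refl \<alpha> v))"]) simp
  have br: "z \<circ> root_refl \<beta> \<circ> root_refl \<alpha> \<circ> root_refl \<beta> \<circ> root_refl \<alpha> =
      z \<circ> root_refl \<alpha> \<circ> root_refl \<beta> \<circ> root_refl \<alpha> \<circ> root_refl \<beta>" for z :: "'a \<Rightarrow> 'a"
    using word by (simp add: fun_eq_iff)
  note yb = ds.yang_baxter_4[OF ds.braid_4[OF HOL.refl br]
      coefficient_relation[OF rel(1) nes(1) nes(2) nes(4)]
      coefficient_relation[OF rel(2) nes(2) nes(3) nes(4)],
      unfolded ds.R\<^sub>1_def ds.R\<^sub>2_def, unfolded alternating.simps(1) last]
  have "tower \<kappa> \<alpha> \<beta> [?c (e 0), ?c (e (Suc 0)), ?c (e 2), ?c (e 3)] f x =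
      tower \<kappa> \<beta> \<alpha> [?c (e 3), ?c (e 2), ?c (e (Suc 0)), ?c (e 0)] f x"
    by (simp only: tower.simps br) (rule fun_cong[OF yb])
  moreover have "map e [0..<Suc 3] = [e 0, e (Suc 0), e 2, e 3]" "map (\<lambda>i. e (3 - i)) [0..<Suc 3] =
      [e 3, e 2, e (Suc 0), e 0]"
    by (simp_all add: eval_nat_numeral)
  ultimately show ?thesis
    using msum_eq_tower[OF ab x, of \<kappa> "[e 0, e (Suc 0), e 2, e 3]" f]
      msum_eq_tower[OF ab(2,1) x, of \<kappa> "[e 3, e 2, e (Suc 0), e 0]" f]
    by (simp add: eval_nat_numeral del: upt_Suc)
qed

lemma msum_string_6:
  assumes ab: "\<alpha> \<in> \<Delta>" "\<beta> \<in> \<Delta>" and x: "x \<in> W"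
    and last: "alternating \<alpha> \<beta> 5 = \<beta>"
    and rev: "\<And>i. i \<le> 5 \<Longrightarrow> alternating \<beta> \<alpha> i = alternating \<alpha> \<beta> (5 - i)"
    and cone: "\<And>i. i \<le> 5 \<Longrightarrow> \<exists>x y :: nat. alternating \<alpha> \<beta> i = comb \<alpha> \<beta> (real x) (real y)"
    and e: "\<And>i. i \<le> 5 \<Longrightarrow> e i = exp (real ([1, 1, 2, 1, 1, 0] ! i) * u + real ([0, 1, 3, 2, 3, 1] ! i) * v)"
    and ne: "\<And>i. i \<le> 5 \<Longrightarrow> e i \<noteq> 1"
  shows "msum \<kappa> (zip (map (alternating \<alpha> \<beta>) [0..<Suc 5]) (map e [0..<Suc 5])) f x =
    msum \<kappa> (zip (map (alternating \<beta> \<alpha>) [0..<Suc 5]) (map (\<lambda>i. e (5 - i)) [0..<Suc 5])) f x"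
proof -
  let ?c = "\<lambda>e. \<kappa> * e / (1 - e)"
  have nes: "e 0 \<noteq> 1" "e (Suc 0) \<noteq> 1" "e 2 \<noteq> 1" "e 3 \<noteq> 1" "e 4 \<noteq> 1" "e 5 \<noteq> 1"
    using ne by simp_all
  have rel: "e (Suc 0) = e 0 * e 5" "e 2 = e 0 * e 4" "e 2 = e (Suc 0) * e 3" "e 3 = e (Suc 0) * e
      5" "e 4 = e 3 * e 5"
    by (simp_all add: e exp_add[symmetric] algebra_simps)
  interpret ds: dihedral_states W 5 "\<lambda>x. x \<circ> root_refl \<alpha>" "\<lambda>x. x \<circ> root_refl \<beta>"
    "\<lambda>k x. x (alternating \<alpha> \<beta> k) \<in> Pos" \<kappa>
    by (rule dihedral_states_string[OF ab last rev cone])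
  have "root_refl (alternating \<alpha> \<beta> 5) v =
      root_refl \<alpha> (root_refl \<beta> (root_refl \<alpha> (root_refl \<beta> (root_refl \<alpha> (root_refl \<beta> (root_refl \<alpha>
          (root_refl \<beta> (root_refl \<alpha> (root_refl \<beta> (root_refl \<alpha> v))))))))))" for v
    by (simp add: root_refl_root_refl eval_nat_numeral)
  then have refl: "root_refl \<beta> v =
      root_refl \<alpha> (root_refl \<beta> (root_refl \<alpha> (root_refl \<beta> (root_refl \<alpha> (root_refl \<beta> (root_refl \<alpha>
          (root_refl \<beta> (root_refl \<alpha> (root_refl \<beta> (root_refl \<alpha> v))))))))))" for v unfolding last .
  have word: "root_refl \<beta> (root_refl \<alpha> (root_refl \<beta> (root_refl \<alpha> (root_refl \<beta> (root_refl \<alpha> v))))) =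
      root_refl \<alpha> (root_refl \<beta> (root_refl \<alpha> (root_refl \<beta> (root_refl \<alpha> (root_refl \<beta> v)))))" for v
    by (subst refl[of "root_refl \<alpha> (root_refl \<beta> (root_refl \<alpha> (root_refl \<beta> (root_refl \<alpha> v))))"]) simp
  have br: "z \<circ> root_refl \<beta> \<circ> root_refl \<alpha> \<circ> root_refl \<beta> \<circ> root_refl \<alpha> \<circ> root_refl \<beta> \<circ> root_refl \<alpha> =
      z \<circ> root_refl \<alpha> \<circ> root_refl \<beta> \<circ> root_refl \<alpha> \<circ> root_refl \<beta> \<circ> root_refl \<alpha> \<circ> root_refl \<beta>" for z
          :: "'a \<Rightarrow> 'a"
    using word by (simp add: fun_eq_iff)
  note yb = ds.yang_baxter_6[OF ds.braid_6[OF HOL.refl br]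
      coefficient_relation[OF rel(1) nes(1) nes(2) nes(6)]
      coefficient_relation[OF rel(2) nes(1) nes(3) nes(5)]
      coefficient_relation[OF rel(3) nes(2) nes(3) nes(4)]
      coefficient_relation[OF rel(4) nes(2) nes(4) nes(6)]
      coefficient_relation[OF rel(5) nes(4) nes(5) nes(6)],
      unfolded ds.R\<^sub>1_def ds.R\<^sub>2_def, unfolded alternating.simps(1) last]
  have "tower \<kappa> \<alpha> \<beta> [?c (e 0), ?c (e (Suc 0)), ?c (e 2), ?c (e 3), ?c (e 4), ?c (e 5)] f x =
      tower \<kappa> \<beta> \<alpha> [?c (e 5), ?c (e 4), ?c (e 3), ?c (e 2), ?c (e (Suc 0)), ?c (e 0)] f x"
    by (simp only: tower.simps br) (rule fun_cong[OF yb])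
  moreover have "map e [0..<Suc 5] = [e 0, e (Suc 0), e 2, e 3, e 4, e 5]" "map (\<lambda>i. e (5 - i))
      [0..<Suc 5] = [e 5, e 4, e 3, e 2, e (Suc 0), e 0]"
    by (simp_all add: eval_nat_numeral)
  ultimately show ?thesis
    using msum_eq_tower[OF ab x, of \<kappa> "[e 0, e (Suc 0), e 2, e 3, e 4, e 5]" f]
      msum_eq_tower[OF ab(2,1) x, of \<kappa> "[e 5, e 4, e 3, e 2, e (Suc 0), e 0]" f]
    by (simp add: eval_nat_numeral del: upt_Suc)
qed

end

context rank2
begin

lemma rank2_data_string:
  assumes d: "rank2_data \<alpha> \<beta> n xs ys"
    and "\<forall>i<n. xs ! i \<noteq> 0 \<or> ys ! i \<noteq> 1" "xs ! n = 0" "ys ! n = 1"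
  shows "alternating \<alpha> \<beta> n = \<beta>"
    and "\<And>i. i \<le> n \<Longrightarrow> alternating \<beta> \<alpha> i = alternating \<alpha> \<beta> (n - i)"
    and "\<And>i. i \<le> n \<Longrightarrow> \<exists>x y :: nat. alternating \<alpha> \<beta> i = comb \<alpha> \<beta> (real x) (real y)"
    and "rank2_string \<alpha> \<beta> = map (alternating \<alpha> \<beta>) [0..<Suc n]"
    and "rank2_string \<beta> \<alpha> = map (alternating \<beta> \<alpha>) [0..<Suc n]"
proof -
  have alt: "alternating \<alpha> \<beta> i = comb \<alpha> \<beta> (xs ! i) (ys ! i)"
    "alternating \<beta> \<alpha> i = comb \<alpha> \<beta> (xs ! (n - i)) (ys ! (n - i))" if "i \<le> n" for i
    using d that unfolding rank2_data_def by blast+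
  show last: "alternating \<alpha> \<beta> n = \<beta>" using alt(1)[of n] assms by (simp add: comb_unit)
  show rev: "alternating \<beta> \<alpha> i = alternating \<alpha> \<beta> (n - i)" if "i \<le> n" for i
    using alt that by simp
  show "\<exists>x y :: nat. alternating \<alpha> \<beta> i = comb \<alpha> \<beta> (real x) (real y)" if "i \<le> n" for i
    using alt(1)[OF that] by blast
  show str: "rank2_string \<alpha> \<beta> = map (alternating \<alpha> \<beta>) [0..<Suc n]"
  proof (rule rank2_string_eq[OF last])
    show "alternating \<alpha> \<beta> i \<noteq> \<beta>" if "i < n" for i
      using assms(2) alt(1)[of i] that by (auto simp: comb_eq_right)
  qed
  show "rank2_string \<beta> \<alpha> = map (alternating \<beta> \<alpha>) [0..<Suc n]"
    unfolding rank2_string_swap str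
    by (rule nth_equalityI) (auto simp: rev rev_nth simp del: upt_Suc)
qed

end

context based_root_system
begin

text \<open>The part common to all types. The roots follow the table \<open>xs\<close>,
  \<open>ys\<close>, but the weights follow the table \<open>cx\<close>, \<open>cy\<close> of the
  dual string.\<close>

lemma msum_string_data:
  assumes r2: "rank2 \<alpha> \<beta>"
    and ne: "\<And>\<gamma>. \<gamma> \<in> set (rank2_string \<alpha> \<beta>) \<Longrightarrow> exp (\<xi> \<bullet> coroot \<gamma>) \<noteq> 1"
    and d: "rank2_data \<alpha> \<beta> n xs ys" "\<forall>i<n. xs ! i \<noteq> 0 \<or> ys ! i \<noteq> 1" "xs ! n = 0" "ys ! n = 1"
    and d': "rank2_data (coroot \<alpha>) (coroot \<beta>) n cx cy"
    and yb: "\<And>e u v. \<lbrakk>alternating \<alpha> \<beta> n = \<beta>;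
        \<And>i. i \<le> n \<Longrightarrow> alternating \<beta> \<alpha> i = alternating \<alpha> \<beta> (n - i);
        \<And>i. i \<le> n \<Longrightarrow> \<exists>x y :: nat. alternating \<alpha> \<beta> i = comb \<alpha> \<beta> (real x) (real y);
        \<And>i. i \<le> n \<Longrightarrow> e i = exp (real (cx ! i) * u + real (cy ! i) * v);
        \<And>i. i \<le> n \<Longrightarrow> e i \<noteq> 1\<rbrakk> \<Longrightarrow>
      msum \<kappa> (zip (map (alternating \<alpha> \<beta>) [0..<Suc n]) (map e [0..<Suc n])) f x =
      msum \<kappa> (zip (map (alternating \<beta> \<alpha>) [0..<Suc n]) (map (\<lambda>i. e (n - i)) [0..<Suc n])) f x"
  shows "msum \<kappa> (map (\<lambda>\<gamma>. (\<gamma>, exp (\<xi> \<bullet> coroot \<gamma>))) (rank2_string \<alpha> \<beta>)) f x =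
    msum \<kappa> (map (\<lambda>\<gamma>. (\<gamma>, exp (\<xi> \<bullet> coroot \<gamma>))) (rank2_string \<beta> \<alpha>)) f x"
proof -
  interpret rank2 \<alpha> \<beta> by (rule r2)
  note str = rank2_data_string[OF d]
  define e where "e i = exp (\<xi> \<bullet> coroot (alternating \<alpha> \<beta> i))" for i
  have e: "e i = exp (real (cx ! i) * (\<xi> \<bullet> coroot \<alpha>) + real (cy ! i) * (\<xi> \<bullet> coroot \<beta>))" if "i \<le> n" for i
    using d' that unfolding e_def coroot_alternating rank2_data_def by (simp add: comb_def inner_add_right)
  have ne': "e i \<noteq> 1" if "i \<le> n" for i
    unfolding e_def by (rule ne) (use that in \<open>auto simp: str(4) simp del: upt_Suc\<close>)
  have L: "map (\<lambda>\<gamma>. (\<gamma>, exp (\<xi> \<bullet> coroot \<gamma>))) (rank2_string \<alpha> \<beta>) =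
      zip (map (alternating \<alpha> \<beta>) [0..<Suc n]) (map e [0..<Suc n])"
    unfolding str(4) by (rule nth_equalityI) (simp_all add: e_def del: upt_Suc)
  have R: "map (\<lambda>\<gamma>. (\<gamma>, exp (\<xi> \<bullet> coroot \<gamma>))) (rank2_string \<beta> \<alpha>) =
      zip (map (alternating \<beta> \<alpha>) [0..<Suc n]) (map (\<lambda>i. e (n - i)) [0..<Suc n])"
    unfolding str(5) by (rule nth_equalityI) (simp_all add: e_def str(2) del: upt_Suc)
  show ?thesis unfolding L R by (rule yb[OF str(1-3) e ne'])
qed

text \<open>The assertion is symmetric in \<alpha> and \<beta>, so one order of each type suffices.
  For B2 and G2 the coroots have the transposed Cartan integers, hence the swapped tables.\<close>

lemma msum_string_forward:
  assumes ab: "\<alpha> \<in> \<Delta>" "\<beta> \<in> \<Delta>" and r2: "rank2 \<alpha> \<beta>" and x: "x \<in> W"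
    and ne: "\<And>\<gamma>. \<gamma> \<in> set (rank2_string \<alpha> \<beta>) \<Longrightarrow> exp (\<xi> \<bullet> coroot \<gamma>) \<noteq> 1"
    and p: "(pairing \<alpha> \<beta>, pairing \<beta> \<alpha>) \<in> {(0, 0), (-1, -1), (-1, -2), (-1, -3)}"
  shows "msum \<kappa> (map (\<lambda>\<gamma>. (\<gamma>, exp (\<xi> \<bullet> coroot \<gamma>))) (rank2_string \<alpha> \<beta>)) f x =
    msum \<kappa> (map (\<lambda>\<gamma>. (\<gamma>, exp (\<xi> \<bullet> coroot \<gamma>))) (rank2_string \<beta> \<alpha>)) f x"
proof -
  interpret rank2 \<alpha> \<beta> by (rule r2)
  interpret co: rank2 "coroot \<alpha>" "coroot \<beta>" by (rule coroots)
  interpret cos: rank2 "coroot \<beta>" "coroot \<alpha>" by (rule co.swap)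
  consider "pairing \<alpha> \<beta> = 0" "pairing \<beta> \<alpha> = 0" | "pairing \<alpha> \<beta> = -1" "pairing \<beta> \<alpha> = -1"
    | "pairing \<alpha> \<beta> = -1" "pairing \<beta> \<alpha> = -2" | "pairing \<alpha> \<beta> = -1" "pairing \<beta> \<alpha> = -3"
    using p by auto
  then show ?thesis
  proof cases
    case 1
    have "rank2_data (coroot \<alpha>) (coroot \<beta>) 1 [1, 0] [0, 1]"
      by (rule co.rank2_data_A1A1) (simp_all add: pairing_coroot 1)
    moreover have "\<forall>i<1. [1, 0] ! i \<noteq> (0::nat) \<or> [0, 1] ! i \<noteq> (1::nat)"
      by (auto simp: numeral_eq_Suc less_Suc_eq)
    ultimately show ?thesis
      by (intro msum_string_data[OF r2 ne rank2_data_A1A1[OF 1]] msum_string_2[OF ab x]) simp_all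
  next
    case 2
    have "rank2_data (coroot \<alpha>) (coroot \<beta>) 2 [1, 1, 0] [0, 1, 1]"
      by (rule co.rank2_data_A2) (simp_all add: pairing_coroot 2)
    moreover have "\<forall>i<2. [1, 1, 0] ! i \<noteq> (0::nat) \<or> [0, 1, 1] ! i \<noteq> (1::nat)"
      by (auto simp: numeral_eq_Suc less_Suc_eq)
    ultimately show ?thesis
      by (intro msum_string_data[OF r2 ne rank2_data_A2[OF 2]] msum_string_3[OF ab x]) simp_all
  next
    case 3
    have "rank2_data (coroot \<alpha>) (coroot \<beta>) 3 [1, 1, 1, 0] [0, 1, 2, 1]"
      using rank2_data_swap[OF cos.rank2_data_B2] 3 by (simp add: pairing_coroot)
    moreover have "\<forall>i<3. [1, 2, 1, 0] ! i \<noteq> (0::nat) \<or> [0, 1, 1, 1] ! i \<noteq> (1::nat)"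
      by (auto simp: numeral_eq_Suc less_Suc_eq)
    ultimately show ?thesis
      by (intro msum_string_data[OF r2 ne rank2_data_B2[OF 3]] msum_string_4[OF ab x]) simp_all
  next
    case 4
    have "rank2_data (coroot \<alpha>) (coroot \<beta>) 5 [1, 1, 2, 1, 1, 0] [0, 1, 3, 2, 3, 1]"
      using rank2_data_swap[OF cos.rank2_data_G2] 4 by (simp add: pairing_coroot)
    moreover have "\<forall>i<5. [1, 3, 2, 3, 1, 0] ! i \<noteq> (0::nat) \<or> [0, 1, 1, 2, 1, 1] ! i \<noteq> (1::nat)"
      by (auto simp: numeral_eq_Suc less_Suc_eq)
    ultimately show ?thesis
      by (intro msum_string_data[OF r2 ne rank2_data_G2[OF 4]] msum_string_6[OF ab x]) simp_all
  qed
qed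

theorem msum_string:
  assumes ab: "\<alpha> \<in> \<Delta>" "\<beta> \<in> \<Delta>" and r2: "rank2 \<alpha> \<beta>" and x: "x \<in> W"
    and ne: "\<And>\<gamma>. \<gamma> \<in> set (rank2_string \<alpha> \<beta>) \<Longrightarrow> exp (\<xi> \<bullet> coroot \<gamma>) \<noteq> 1"
  shows "msum \<kappa> (map (\<lambda>\<gamma>. (\<gamma>, exp (\<xi> \<bullet> coroot \<gamma>))) (rank2_string \<alpha> \<beta>)) f x =
    msum \<kappa> (map (\<lambda>\<gamma>. (\<gamma>, exp (\<xi> \<bullet> coroot \<gamma>))) (rank2_string \<beta> \<alpha>)) f x"
proof -
  interpret rank2 \<alpha> \<beta> by (rule r2)
  have ne': "exp (\<xi> \<bullet> coroot \<gamma>) \<noteq> 1" if "\<gamma> \<in> set (rank2_string \<beta> \<alpha>)" for \<gamma>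
    using that ne by (simp add: rank2_string_swap)
  show ?thesis
    using pairings msum_string_forward[OF ab r2 x ne]
      msum_string_forward[OF ab(2,1) swap x ne', symmetric] by auto
qed

end

section \<open>The limit to the quantum Bruhat graph\<close>

lemma tendsto_exp_affine:
  fixes a b :: real
  assumes "a \<le> 0"
  shows "((\<lambda>T. exp (a * T + b)) \<longlongrightarrow> (if a = 0 then exp b else 0)) at_top"
proof (cases "a = 0")
  case False
  then have "filterlim (\<lambda>T. a * T) at_bot at_top"
    using assms by (intro filterlim_tendsto_neg_mult_at_bot[OF tendsto_const _ filterlim_ident]) auto
  then have "filterlim (\<lambda>T. b + a * T) at_bot at_top"
    by (subst filterlim_tendsto_add_at_bot_iff[OF tendsto_const])
  then have "((\<lambda>T. exp (b + a * T)) \<longlongrightarrow> 0) at_top"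
    by (rule filterlim_compose[OF exp_at_bot])
  then show ?thesis using False by (simp add: add.commute)
qed simp

text \<open>The quotients of values of g telescope along every path.\<close>

lemma psum_conjugate:
  assumes "\<And>z. g z \<noteq> 0"
  shows "psum (\<lambda>x \<gamma>. c x \<gamma> * g (x \<circ> root_refl \<gamma>) / g x) L f x * g x = psum c L (\<lambda>z. f z * g z) x"
proof (induction L arbitrary: x)
  case (Cons \<gamma> L)
  define y where "y = x \<circ> root_refl \<gamma>"
  let ?p = "psum (\<lambda>x \<gamma>. c x \<gamma> * g (x \<circ> root_refl \<gamma>) / g x) L f"
  have "(?p x + c x \<gamma> * g y / g x * ?p y) * g x = ?p x * g x + c x \<gamma> * (?p y * g y)"
    using assms[of x] by (simp add: field_simps)
  then show ?case unfolding psum.simps y_def[symmetric] Cons.IH .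
qed simp

text \<open>Among the exponents with nonzero coefficient choose d0 of maximal norm and put \<mu> = T
  d0. Then \<open>d0 \<bullet> d < d0 \<bullet> d0\<close> for all others, so the term of d0
  dominates as T grows.\<close>

lemma exp_inner_independent:
  fixes c :: "'a::euclidean_space \<Rightarrow> real"
  assumes "finite D" and zero: "\<And>\<mu>. (\<Sum>d\<in>D. c d * exp (\<mu> \<bullet> d)) = 0" and "d \<in> D"
  shows "c d = 0"
proof (rule ccontr)
  assume "c d \<noteq> 0"
  let ?D = "{d\<in>D. c d \<noteq> 0}"
  have fin: "finite ?D" "?D \<noteq> {}" using assms \<open>c d \<noteq> 0\<close> by auto
  define m where "m = Max (norm ` ?D)"
  have "m \<in> norm ` ?D" unfolding m_def using fin by (intro Max_in) auto
  then obtain d0 where d0: "d0 \<in> ?D" "norm d0 = m" by auto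
  have less: "d0 \<bullet> d - d0 \<bullet> d0 < 0" if "d \<in> ?D" "d \<noteq> d0" for d
  proof -
    have "norm d \<le> norm d0" using fin that(1) unfolding d0(2) m_def by (intro Max_ge) auto
    then have "d \<bullet> d \<le> d0 \<bullet> d0" by (simp add: norm_le)
    moreover have "0 < (d0 - d) \<bullet> (d0 - d)" using that(2) by simp
    ultimately show ?thesis by (simp add: inner_diff_left inner_diff_right inner_commute)
  qed
  have "((\<lambda>T. \<Sum>d\<in>?D. c d * exp ((d0 \<bullet> d - d0 \<bullet> d0) * T + 0)) \<longlongrightarrow>
      (\<Sum>d\<in>?D. c d * (if d0 \<bullet> d - d0 \<bullet> d0 = 0 then exp 0 else 0))) at_top"
    using less by (intro tendsto_sum tendsto_mult tendsto_const tendsto_exp_affine)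
      (metis dual_order.refl eq_iff_diff_eq_0 less_eq_real_def)
  moreover have "(\<Sum>d\<in>?D. c d * (if d0 \<bullet> d - d0 \<bullet> d0 = 0 then exp 0 else 0)) =
      (\<Sum>d\<in>?D. if d = d0 then c d0 else 0)"
    using less by (intro sum.cong) fastforce+
  moreover have "(\<Sum>d\<in>?D. c d * exp ((d0 \<bullet> d - d0 \<bullet> d0) * T + 0)) = 0" for T
  proof -
    have "(\<Sum>d\<in>?D. c d * exp ((d0 \<bullet> d - d0 \<bullet> d0) * T + 0)) =
        exp (- (d0 \<bullet> d0) * T) * (\<Sum>d\<in>?D. c d * exp ((T *\<^sub>R d0) \<bullet> d))"
      by (simp add: sum_distrib_left mult_exp_exp algebra_simps)
    also have "(\<Sum>d\<in>?D. c d * exp ((T *\<^sub>R d0) \<bullet> d)) = (\<Sum>d\<in>D. c d * exp ((T *\<^sub>R d0) \<bullet> d))"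
      using assms(1) by (intro sum.mono_neutral_left) auto
    finally show ?thesis by (simp only: zero mult_zero_right)
  qed
  ultimately have "((\<lambda>T::real. 0) \<longlongrightarrow> c d0) at_top" using fin d0 by simp
  then have "c d0 = 0" using tendsto_unique[OF _ _ tendsto_const] trivial_limit_at_top_linorder by blast
  then show False using d0 by simp
qed

context based_root_system
begin

lemma weyl_vector_pairing_ge: assumes "\<gamma> \<in> Pos" shows "pairing (weyl_vector \<Delta> S) \<gamma> \<ge> 1"
proof -
  have "\<gamma> \<in> inversions (root_refl \<gamma>)"
    using assms pos_root_not_neg by (simp add: inversions_def root_refl_self)
  then have "card (inversions (root_refl \<gamma>)) > 0"
    using finite_inversions card_gt_0_iff by blast
  then show ?thesis using card_inversions_refl_le[OF assms] by linarith
qed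

text \<open>The coefficient of \<open>Q\<close> at x. The exponential marks quantum steps, so that a
  product along a path records \<open>down\<close>.\<close>

definition quantum_coef :: "'a \<Rightarrow> ('a \<Rightarrow> 'a) \<Rightarrow> 'a \<Rightarrow> real" where
  "quantum_coef \<mu> x \<gamma> = root_sgn \<Delta> S \<gamma> *
     (of_bool (bruhat_edge \<Delta> S x (root_abs \<Delta> S \<gamma>) (x \<circ> root_refl \<gamma>)) +
      of_bool (quantum_edge \<Delta> S x (root_abs \<Delta> S \<gamma>) (x \<circ> root_refl \<gamma>)) *
        exp (\<mu> \<bullet> coroot (root_abs \<Delta> S \<gamma>)))"

definition mixed_weight :: "'a \<Rightarrow> real \<Rightarrow> 'a \<Rightarrow> real" where
  "mixed_weight \<mu> T \<gamma> = exp ((\<mu> - (2 * T) *\<^sub>R weyl_vector \<Delta> S) \<bullet> coroot \<gamma>)"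

definition mixed_coef :: "'a \<Rightarrow> real \<Rightarrow> ('a \<Rightarrow> 'a) \<Rightarrow> 'a \<Rightarrow> real" where
  "mixed_coef \<mu> T x \<gamma> = exp T * mixed_weight \<mu> T \<gamma> / (1 - mixed_weight \<mu> T \<gamma>) +
     (if x \<gamma> \<in> Pos then exp T else 0)"

definition scaled_coef :: "'a \<Rightarrow> real \<Rightarrow> ('a \<Rightarrow> 'a) \<Rightarrow> 'a \<Rightarrow> real" where
  "scaled_coef \<mu> T x \<gamma> = mixed_coef \<mu> T x \<gamma> *
     exp (- (T * weyl_length S (x \<circ> root_refl \<gamma>))) / exp (- (T * weyl_length S x))"

lemma mixed_weight_eq:
  "mixed_weight \<mu> T \<gamma> = exp ((- 2 * pairing (weyl_vector \<Delta> S) \<gamma>) * T + \<mu> \<bullet> coroot \<gamma>)"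
  by (simp add: mixed_weight_def pairing_def inner_diff_left algebra_simps)

lemma mixed_weight_uminus: "mixed_weight \<mu> T (- \<gamma>) = 1 / mixed_weight \<mu> T \<gamma>"
  by (simp add: mixed_weight_def coroot_uminus exp_minus inverse_eq_divide)

lemma mixed_weight_tendsto:
  assumes "\<gamma> \<in> Pos" shows "((\<lambda>T. mixed_weight \<mu> T \<gamma>) \<longlongrightarrow> 0) at_top"
  using tendsto_exp_affine[of "- 2 * pairing (weyl_vector \<Delta> S) \<gamma>" "\<mu> \<bullet> coroot \<gamma>"]
    weyl_vector_pairing_ge[OF assms] unfolding mixed_weight_eq by simp

lemma mixed_weight_ne_1_pos:
  assumes "\<gamma> \<in> Pos" shows "eventually (\<lambda>T. mixed_weight \<mu> T \<gamma> \<noteq> 1) at_top"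
  using order_tendstoD(2)[OF mixed_weight_tendsto[OF assms], of 1 \<mu>]
  by (auto elim: eventually_mono)

lemma mixed_weight_ne_1:
  assumes "\<gamma> \<in> \<Delta>" shows "eventually (\<lambda>T. mixed_weight \<mu> T \<gamma> \<noteq> 1) at_top"
proof (cases "\<gamma> \<in> Pos")
  case True
  then show ?thesis by (rule mixed_weight_ne_1_pos)
next
  case False
  then have "- \<gamma> \<in> Pos" using assms neg_root_iff by blast
  from mixed_weight_ne_1_pos[OF this, of \<mu>] show ?thesis
    by (rule eventually_mono) (auto simp: mixed_weight_uminus)
qed

text \<open>With y the end of the step, conjugation contributes exp (T (\<ell>(x) - \<ell>(y))).
  Together with \<kappa> and, for negative \<open>x \<gamma>\<close>, with the weight, T gets the
  factor 1 + \<ell>(x) - \<ell>(y) or 1 - 2 \<open>?p\<close> + \<ell>(x) - \<ell>(y). In its own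
  case each is at most 0 and vanishes exactly on Bruhat or on quantum edges; the denominator tends
  to 1.\<close>

lemma scaled_coef_tendsto_pos:
  assumes x: "x \<in> W" and \<gamma>: "\<gamma> \<in> Pos"
  shows "((\<lambda>T. scaled_coef \<mu> T x \<gamma>) \<longlongrightarrow> quantum_coef \<mu> x \<gamma>) at_top"
proof -
  let ?y = "x \<circ> root_refl \<gamma>" and ?p = "pairing (weyl_vector \<Delta> S) \<gamma>"
  let ?d = "real (weyl_length S x) - real (weyl_length S ?y)"
  have p: "?p \<ge> 1" by (rule weyl_vector_pairing_ge[OF \<gamma>])
  have abs: "root_abs \<Delta> S \<gamma> = \<gamma>" "root_sgn \<Delta> S \<gamma> = 1"
    using \<gamma> by (simp_all add: root_abs_def root_sgn_def)
  have quot: "exp (- (T * weyl_length S ?y)) / exp (- (T * weyl_length S x)) = exp (?d * T)" for T :: real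
    by (simp add: exp_diff[symmetric] algebra_simps)
  have scaled: "scaled_coef \<mu> T x \<gamma> = mixed_coef \<mu> T x \<gamma> * exp (?d * T)" for T
    by (simp only: scaled_coef_def quot[symmetric] times_divide_eq_right)
  have lim1: "((\<lambda>T. 1 - mixed_weight \<mu> T \<gamma>) \<longlongrightarrow> 1 - 0) at_top"
    by (intro tendsto_diff tendsto_const mixed_weight_tendsto \<gamma>)
  show ?thesis
  proof (cases "x \<gamma> \<in> Pos")
    case True
    have lt: "weyl_length S x < weyl_length S ?y" by (rule weyl_length_refl_pos[OF x \<gamma> True])
    then have d: "1 + ?d \<le> 0" by linarith
    have "\<not> quantum_edge \<Delta> S x \<gamma> ?y"
      using lt p unfolding quantum_edge_def by auto
    moreover have "bruhat_edge \<Delta> S x \<gamma> ?y \<longleftrightarrow> 1 + ?d = 0"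
      using x \<gamma> unfolding bruhat_edge_def by (auto simp: of_nat_eq_iff[symmetric, where 'a = real]
          simp del: of_nat_eq_iff)
    ultimately have q: "quantum_coef \<mu> x \<gamma> = (if 1 + ?d = 0 then exp 0 else 0) / (1 - 0)"
      by (simp add: quantum_coef_def abs)
    have "((\<lambda>T. exp ((1 + ?d) * T + 0) / (1 - mixed_weight \<mu> T \<gamma>)) \<longlongrightarrow> quantum_coef \<mu> x \<gamma>) at_top"
      unfolding q by (intro tendsto_divide tendsto_exp_affine d lim1) simp
    moreover have "eventually (\<lambda>T. scaled_coef \<mu> T x \<gamma> =
        exp ((1 + ?d) * T + 0) / (1 - mixed_weight \<mu> T \<gamma>)) at_top"
      using mixed_weight_ne_1_pos[OF \<gamma>]
    proof (rule eventually_mono)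
      fix T assume "mixed_weight \<mu> T \<gamma> \<noteq> 1"
      then have "mixed_coef \<mu> T x \<gamma> = exp T / (1 - mixed_weight \<mu> T \<gamma>)"
        using True by (simp add: mixed_coef_def field_simps)
      moreover have "exp ((1 + ?d) * T + 0) = exp T * exp (?d * T)"
        by (simp add: exp_add[symmetric] algebra_simps)
      ultimately show "scaled_coef \<mu> T x \<gamma> = exp ((1 + ?d) * T + 0) / (1 - mixed_weight \<mu> T \<gamma>)"
        unfolding scaled by simp
    qed
    ultimately show ?thesis by (simp add: tendsto_cong)
  next
    case False
    have lt: "weyl_length S ?y < weyl_length S x" by (rule weyl_length_refl_neg[OF x \<gamma> False])
    have d: "1 - 2 * ?p + ?d \<le> 0" using weyl_length_refl_diff[OF x \<gamma>] by linarith
    have "\<not> bruhat_edge \<Delta> S x \<gamma> ?y"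
      using lt unfolding bruhat_edge_def by auto
    moreover have "quantum_edge \<Delta> S x \<gamma> ?y \<longleftrightarrow> 1 - 2 * ?p + ?d = 0"
      using x \<gamma> unfolding quantum_edge_def by auto
    ultimately have q: "quantum_coef \<mu> x \<gamma> =
        (if 1 - 2 * ?p + ?d = 0 then exp (\<mu> \<bullet> coroot \<gamma>) else 0) / (1 - 0)"
      by (simp add: quantum_coef_def abs)
    have "((\<lambda>T. exp ((1 - 2 * ?p + ?d) * T + \<mu> \<bullet> coroot \<gamma>) / (1 - mixed_weight \<mu> T \<gamma>)) \<longlongrightarrow>
        quantum_coef \<mu> x \<gamma>) at_top"
      unfolding q by (intro tendsto_divide tendsto_exp_affine d lim1) simp
    moreover have "scaled_coef \<mu> T x \<gamma> =
        exp ((1 - 2 * ?p + ?d) * T + \<mu> \<bullet> coroot \<gamma>) / (1 - mixed_weight \<mu> T \<gamma>)" for T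
    proof -
      have "exp ((1 - 2 * ?p + ?d) * T + \<mu> \<bullet> coroot \<gamma>) = exp T * mixed_weight \<mu> T \<gamma> * exp (?d * T)"
        unfolding mixed_weight_eq by (simp add: exp_add[symmetric] algebra_simps)
      then show ?thesis
        using False unfolding scaled by (simp add: mixed_coef_def)
    qed
    ultimately show ?thesis by simp
  qed
qed

text \<open>The coefficient is odd in \<gamma>: passing to the negative root inverts the weight e
  and exchanges the two cases, and \<kappa> / (1 - 1/e) = - \<kappa> e / (1 - e).\<close>

lemma scaled_coef_tendsto:
  assumes x: "x \<in> W" and \<gamma>: "\<gamma> \<in> \<Delta>"
  shows "((\<lambda>T. scaled_coef \<mu> T x \<gamma>) \<longlongrightarrow> quantum_coef \<mu> x \<gamma>) at_top"
proof (cases "\<gamma> \<in> Pos")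
  case True
  then show ?thesis by (rule scaled_coef_tendsto_pos[OF x])
next
  case False
  then have neg: "- \<gamma> \<in> Pos" using \<gamma> neg_root_iff by blast
  have "quantum_coef \<mu> x \<gamma> = - quantum_coef \<mu> x (- \<gamma>)"
    using neg False by (simp add: quantum_coef_def root_abs_def root_sgn_def root_refl_uminus)
  then have "((\<lambda>T. - scaled_coef \<mu> T x (- \<gamma>)) \<longlongrightarrow> quantum_coef \<mu> x \<gamma>) at_top"
    using tendsto_minus[OF scaled_coef_tendsto_pos[OF x neg]] by simp
  moreover have "eventually (\<lambda>T. scaled_coef \<mu> T x \<gamma> = - scaled_coef \<mu> T x (- \<gamma>)) at_top"
    using mixed_weight_ne_1_pos[OF neg]
  proof (rule eventually_mono)
    fix T let ?e = "mixed_weight \<mu> T (- \<gamma>)"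
    assume e: "?e \<noteq> 1"
    have e': "mixed_weight \<mu> T \<gamma> = 1 / ?e" "?e \<noteq> 0"
      using mixed_weight_uminus[of \<mu> T "- \<gamma>"] by (simp_all add: mixed_weight_def)
    have pos: "x (- \<gamma>) \<in> Pos \<longleftrightarrow> x \<gamma> \<notin> Pos"
      using weyl_uminus[OF x] weyl_root[OF x \<gamma>] neg_root_iff by simp
    have "mixed_coef \<mu> T x \<gamma> = - mixed_coef \<mu> T x (- \<gamma>)"
      using e e'(2) unfolding mixed_coef_def pos e'(1) by (simp add: divide_simps) (simp add: algebra_simps)
    then show "scaled_coef \<mu> T x \<gamma> = - scaled_coef \<mu> T x (- \<gamma>)"
      by (simp add: scaled_coef_def root_refl_uminus)
  qed
  ultimately show ?thesis by (simp add: tendsto_cong)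
qed

lemma psum_tendsto:
  assumes "set L \<subseteq> \<Delta>" "x \<in> W"
  shows "((\<lambda>T. psum (scaled_coef \<mu> T) L f x) \<longlongrightarrow> psum (quantum_coef \<mu>) L f x) at_top"
  using assms
proof (induction L arbitrary: x)
  case (Cons \<gamma> L)
  then show ?case
    by (simp del: o_apply) (intro tendsto_add tendsto_mult scaled_coef_tendsto; simp add: weyl_refl)
qed simp

lemma msum_eq_psum:
  "msum (exp T) (map (\<lambda>\<gamma>. (\<gamma>, exp ((\<mu> - (2 * T) *\<^sub>R weyl_vector \<Delta> S) \<bullet> coroot \<gamma>))) L) f x =
   psum (mixed_coef \<mu> T) L f x"
  by (induction L arbitrary: x) (simp_all add: mixed_coef_def mixed_weight_def)

theorem psum_string:
  assumes ab: "\<alpha> \<in> \<Delta>" "\<beta> \<in> \<Delta>" and r2: "rank2 \<alpha> \<beta>" and x: "x \<in> W"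
  shows "psum (quantum_coef \<mu>) (rank2_string \<alpha> \<beta>) f x = psum (quantum_coef \<mu>) (rank2_string \<beta> \<alpha>) f x"
proof -
  have sub: "set (rank2_string \<alpha> \<beta>) \<subseteq> \<Delta>" "set (rank2_string \<beta> \<alpha>) \<subseteq> \<Delta>"
    using alternating_root ab by (auto simp: rank2_string_def simp del: upt_Suc)
  have conj: "psum (scaled_coef \<mu> T) L f x * exp (- (T * weyl_length S x)) =
      psum (mixed_coef \<mu> T) L (\<lambda>z. f z * exp (- (T * weyl_length S z))) x" for T L
    unfolding scaled_coef_def using psum_conjugate[of "\<lambda>z. exp (- (T * weyl_length S z))"] by simp
  \<comment> \<open>The deformed coefficients have poles at weight 1; as there are finitely many
    roots, all large T avoid them.\<close>
  have "eventually (\<lambda>T. \<forall>\<gamma>\<in>\<Delta>. mixed_weight \<mu> T \<gamma> \<noteq> 1) at_top"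
    using finite_roots mixed_weight_ne_1 by (intro eventually_ball_finite) auto
  then have "eventually (\<lambda>T. psum (scaled_coef \<mu> T) (rank2_string \<alpha> \<beta>) f x =
      psum (scaled_coef \<mu> T) (rank2_string \<beta> \<alpha>) f x) at_top"
  proof (rule eventually_mono)
    fix T assume ne: "\<forall>\<gamma>\<in>\<Delta>. mixed_weight \<mu> T \<gamma> \<noteq> 1"
    have "psum (mixed_coef \<mu> T) (rank2_string \<alpha> \<beta>) g x = psum (mixed_coef \<mu> T) (rank2_string \<beta> \<alpha>) g x" for g
      unfolding msum_eq_psum[symmetric]
      by (rule msum_string[OF ab r2 x]) (use ne sub in \<open>auto simp: mixed_weight_def\<close>)
    then have "psum (scaled_coef \<mu> T) (rank2_string \<alpha> \<beta>) f x * exp (- (T * weyl_length S x)) =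
      psum (scaled_coef \<mu> T) (rank2_string \<beta> \<alpha>) f x * exp (- (T * weyl_length S x))"
      unfolding conj by blast
    then show "psum (scaled_coef \<mu> T) (rank2_string \<alpha> \<beta>) f x =
      psum (scaled_coef \<mu> T) (rank2_string \<beta> \<alpha>) f x" by simp
  qed
  then have "((\<lambda>T. psum (scaled_coef \<mu> T) (rank2_string \<beta> \<alpha>) f x) \<longlongrightarrow>
      psum (quantum_coef \<mu>) (rank2_string \<alpha> \<beta>) f x) at_top"
    using psum_tendsto[OF sub(1) x] by (rule Lim_transform_eventually[rotated])
  then show ?thesis
    using psum_tendsto[OF sub(2) x] tendsto_unique trivial_limit_at_top_linorder by blast
qed

end

section \<open>Alcove paths\<close>

lemma affine_hyp_coroot: "affine_hyp \<gamma> k = {\<nu>. coroot \<gamma> \<bullet> \<nu> = of_int k}"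
  by (simp add: affine_hyp_def pairing_def inner_commute)

lemma affine_hyp_uminus: "affine_hyp (- \<gamma>) k = affine_hyp \<gamma> (- k)"
  by (auto simp: affine_hyp_def pairing_uminus_right)

lemma affine_refl_eq: "affine_refl \<gamma> k \<nu> = root_refl \<gamma> \<nu> + of_int k *\<^sub>R \<gamma>"
  by (simp add: affine_refl_def root_refl_def scaleR_diff_left)

lemma affine_refl_eq_comp: "affine_refl \<gamma> k = (+) (of_int k *\<^sub>R \<gamma>) \<circ> root_refl \<gamma>"
  by (simp add: affine_refl_eq fun_eq_iff)

lemma affine_refl_uminus: "affine_refl (- \<gamma>) k = affine_refl \<gamma> (- k)"
  by (simp add: affine_refl_eq root_refl_uminus fun_eq_iff)

text \<open>Any point of the hyperplane can serve as origin; reflections in hyperplanes through one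
  common point thus compose like linear ones.\<close>

lemma affine_refl_center:
  assumes "pairing p \<gamma> = of_int k"
  shows "affine_refl \<gamma> k \<nu> = p + root_refl \<gamma> (\<nu> - p)"
  using assms by (simp add: affine_refl_def root_refl_def pairing_diff_left)

lemma affine_refl_involution: "affine_refl \<gamma> k (affine_refl \<gamma> k \<nu>) = \<nu>"
  by (simp add: affine_refl_eq linear_add[OF linear_root_refl] linear_scale[OF linear_root_refl]
      root_refl_self)

lemma inj_root_refl: "inj (root_refl \<gamma>)"
  by (metis injI root_refl_involution)

lemma common_wall_affine_refl:
  assumes "common_wall A B F"
  shows "common_wall (affine_refl \<gamma> k ` A) (affine_refl \<gamma> k ` B) (affine_refl \<gamma> k ` F)"
proof -
  let ?s = "affine_refl \<gamma> k"
  have im: "?s ` X = (+) (of_int k *\<^sub>R \<gamma>) ` (root_refl \<gamma> ` X)" for X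
    by (simp add: affine_refl_eq_comp image_comp)
  have cl: "closure (?s ` X) = ?s ` closure X" for X
    by (simp add: im closure_translation closure_injective_linear_image[OF linear_root_refl inj_root_refl])
  have "?s ` F facet_of ?s ` X" if "F facet_of X" for X
    using that unfolding facet_of_def im face_of_translation_eq aff_dim_translation_eq
    by (simp add: face_of_linear_image[OF linear_root_refl inj_root_refl]
        aff_dim_injective_linear_image[OF linear_root_refl inj_root_refl])
  then show ?thesis using assms by (simp add: common_wall_def cl)
qed

context based_root_system
begin

section \<open>Alcoves described by integer parts of pairings\<close>

text \<open>An alcove is encoded by the integer parts of the pairings with all roots. A cell may be
  empty; the nonempty cells are the alcoves.\<close>

definition alcove_cell :: "('a \<Rightarrow> int) \<Rightarrow> 'a set" where
  "alcove_cell k = {\<nu>. \<forall>\<delta>\<in>\<Delta>. of_int (k \<delta>) < pairing \<nu> \<delta> \<and> pairing \<nu> \<delta> < of_int (k \<delta>) + 1}"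

text \<open>The chosen point does not matter, by \<open>alcove_floor_bounds\<close>.\<close>

definition alcove_floor :: "'a set \<Rightarrow> 'a \<Rightarrow> int" where
  "alcove_floor A \<delta> = \<lfloor>pairing (SOME \<nu>. \<nu> \<in> A) \<delta>\<rfloor>"

abbreviation "off_walls \<equiv> UNIV - (\<Union>\<alpha>\<in>\<Delta>. \<Union>k. affine_hyp \<alpha> k)"

lemma alcove_some: "A \<in> alcoves \<Delta> \<Longrightarrow> (SOME \<nu>. \<nu> \<in> A) \<in> A"
  unfolding alcoves_def using in_components_nonempty some_in_eq by metis

lemma alcove_not_Int: "A \<in> alcoves \<Delta> \<Longrightarrow> \<nu> \<in> A \<Longrightarrow> \<delta> \<in> \<Delta> \<Longrightarrow> pairing \<nu> \<delta> \<noteq> of_int k"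
  unfolding alcoves_def using in_components_subset by (fastforce simp: affine_hyp_def)

text \<open>The alcove is connected, so a pairing leaving its strip would take an integer value
  inside the alcove.\<close>

lemma alcove_floor_bounds:
  assumes A: "A \<in> alcoves \<Delta>" "\<nu> \<in> A" "\<delta> \<in> \<Delta>"
  shows "of_int (alcove_floor A \<delta>) < pairing \<nu> \<delta>" "pairing \<nu> \<delta> < of_int (alcove_floor A \<delta>) + 1"
proof -
  define \<nu>0 where "\<nu>0 = (SOME \<nu>. \<nu> \<in> A)"
  let ?k = "alcove_floor A \<delta>"
  have \<nu>0: "\<nu>0 \<in> A" unfolding \<nu>0_def by (rule alcove_some[OF A(1)])
  have k: "of_int ?k \<le> pairing \<nu>0 \<delta>" "pairing \<nu>0 \<delta> < of_int ?k + 1"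
    unfolding alcove_floor_def \<nu>0_def[symmetric] by linarith+
  have conn: "connected A" using A(1) in_components_connected unfolding alcoves_def by blast
  show "of_int ?k < pairing \<nu> \<delta>"
  proof (rule ccontr)
    assume "\<not> ?thesis"
    then obtain z where "z \<in> A" "coroot \<delta> \<bullet> z = of_int ?k"
      using connected_ivt_hyperplane[OF conn A(2) \<nu>0, of "coroot \<delta>" "of_int ?k"] k
      by (auto simp: pairing_def inner_commute)
    then show False using alcove_not_Int[OF A(1) _ A(3), of z ?k] by (simp add: pairing_def inner_commute)
  qed
  show "pairing \<nu> \<delta> < of_int ?k + 1"
  proof (rule ccontr)
    assume "\<not> ?thesis"
    then obtain z where "z \<in> A" "coroot \<delta> \<bullet> z = of_int (?k + 1)"
      using connected_ivt_hyperplane[OF conn \<nu>0 A(2), of "coroot \<delta>" "of_int (?k + 1)"] k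
      by (auto simp: pairing_def inner_commute)
    then show False
      using alcove_not_Int[OF A(1) _ A(3), of z "?k + 1"] by (simp add: pairing_def inner_commute)
  qed
qed

lemma alcove_floor_unique:
  assumes "A \<in> alcoves \<Delta>" "\<nu> \<in> A" "\<delta> \<in> \<Delta>" "of_int k < pairing \<nu> \<delta>" "pairing \<nu> \<delta> < of_int k + 1"
  shows "alcove_floor A \<delta> = k"
  using alcove_floor_bounds[OF assms(1-3)] assms(4,5) by linarith

text \<open>No pairing with a root is an integer inside an alcove, hence the -1.\<close>

lemma alcove_floor_uminus:
  assumes "A \<in> alcoves \<Delta>" "\<delta> \<in> \<Delta>"
  shows "alcove_floor A (- \<delta>) = - alcove_floor A \<delta> - 1"
  using alcove_floor_bounds[OF assms(1) alcove_some[OF assms(1)] assms(2)]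
  by (intro alcove_floor_unique[OF assms(1) alcove_some[OF assms(1)] uminus_root[OF assms(2)]])
    (simp_all add: pairing_uminus_right)

lemma convex_strip: "convex {\<nu>. a < pairing \<nu> \<delta> \<and> pairing \<nu> \<delta> < b}"
proof -
  have "{\<nu>. a < pairing \<nu> \<delta> \<and> pairing \<nu> \<delta> < b} =
      {\<nu>. coroot \<delta> \<bullet> \<nu> > a} \<inter> {\<nu>. coroot \<delta> \<bullet> \<nu> < b}"
    by (auto simp: pairing_def inner_commute)
  then show ?thesis
    by (simp only: convex_Int convex_halfspace_lt convex_halfspace_gt)
qed

lemma open_strip: "open {\<nu>. a < pairing \<nu> \<delta> \<and> pairing \<nu> \<delta> < b}"
proof -
  have "{\<nu>. a < pairing \<nu> \<delta> \<and> pairing \<nu> \<delta> < b} =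
      {\<nu>. coroot \<delta> \<bullet> \<nu> > a} \<inter> {\<nu>. coroot \<delta> \<bullet> \<nu> < b}"
    by (auto simp: pairing_def inner_commute)
  then show ?thesis
    by (simp only: open_Int open_halfspace_lt open_halfspace_gt)
qed

lemma alcove_cell_eq: "alcove_cell k =
    (\<Inter>\<delta>\<in>\<Delta>. {\<nu>. of_int (k \<delta>) < pairing \<nu> \<delta> \<and> pairing \<nu> \<delta> < of_int (k \<delta>) + 1})"
  by (auto simp: alcove_cell_def)

lemma alcove_cell_subset: "alcove_cell k \<subseteq> off_walls"
proof
  fix \<nu> assume \<nu>: "\<nu> \<in> alcove_cell k"
  have "pairing \<nu> \<delta> \<noteq> of_int m" if "\<delta> \<in> \<Delta>" for \<delta> m
  proof
    assume "pairing \<nu> \<delta> = of_int m"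
    then have "real_of_int (k \<delta>) < of_int m" "real_of_int m < of_int (k \<delta>) + 1"
      using \<nu> that unfolding alcove_cell_def by auto
    then have "k \<delta> < m" "real_of_int m < of_int (k \<delta> + 1)" by simp_all
    then show False unfolding of_int_less_iff by simp
  qed
  then show "\<nu> \<in> off_walls" by (auto simp: affine_hyp_def)
qed

lemma connected_alcove_cell: "connected (alcove_cell k)"
  unfolding alcove_cell_eq by (intro convex_connected convex_INT convex_strip)

lemma alcove_eq_cell:
  assumes "A \<in> alcoves \<Delta>" shows "A = alcove_cell (alcove_floor A)"
proof
  show sub: "A \<subseteq> alcove_cell (alcove_floor A)"
    using alcove_floor_bounds[OF assms] by (auto simp: alcove_cell_def)
  have "A \<inter> alcove_cell (alcove_floor A) \<noteq> {}" using sub alcove_some[OF assms] by auto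
  then show "alcove_cell (alcove_floor A) \<subseteq> A"
    using components_maximal[OF assms[unfolded alcoves_def] connected_alcove_cell alcove_cell_subset]
    by simp
qed

lemma alcove_cell_cong: "(\<And>\<delta>. \<delta> \<in> \<Delta> \<Longrightarrow> k \<delta> = k' \<delta>) \<Longrightarrow> alcove_cell k = alcove_cell k'"
  by (simp add: alcove_cell_def)

lemma alcove_eqI:
  assumes "A \<in> alcoves \<Delta>" "B \<in> alcoves \<Delta>" "\<And>\<delta>. \<delta> \<in> \<Delta> \<Longrightarrow> alcove_floor A \<delta> = alcove_floor B \<delta>"
  shows "A = B"
proof -
  have "A = alcove_cell (alcove_floor A)" by (rule alcove_eq_cell[OF assms(1)])
  also have "\<dots> = alcove_cell (alcove_floor B)" by (rule alcove_cell_cong[OF assms(3)])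
  also have "\<dots> = B" by (rule alcove_eq_cell[OF assms(2), symmetric])
  finally show ?thesis .
qed

lemma alcove_cell_alcove:
  assumes "\<nu> \<in> alcove_cell k" shows "alcove_cell k \<in> alcoves \<Delta>"
proof -
  let ?C = "connected_component_set off_walls \<nu>"
  have "\<nu> \<in> off_walls" using assms alcove_cell_subset by blast
  then have C: "?C \<in> alcoves \<Delta>" "\<nu> \<in> ?C"
    unfolding alcoves_def by (auto intro: componentsI)
  have "?C = alcove_cell (alcove_floor ?C)" by (rule alcove_eq_cell[OF C(1)])
  also have "\<dots> = alcove_cell k"
    using assms by (intro alcove_cell_cong alcove_floor_unique[OF C]) (auto simp: alcove_cell_def)
  finally show ?thesis using C by simp
qed

lemma aff_dim_closure_alcove:
  assumes "A \<in> alcoves \<Delta>" shows "aff_dim (closure A) = DIM('a)"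
proof -
  have "open A" by (subst alcove_eq_cell[OF assms], unfold alcove_cell_eq)
      (intro open_INT finite_roots ballI open_strip)
  moreover have "A \<noteq> {}" using alcove_some[OF assms] by blast
  ultimately show ?thesis by (simp add: aff_dim_open)
qed

lemma closure_alcove_bounds:
  assumes A: "A \<in> alcoves \<Delta>" "\<nu> \<in> closure A" "\<delta> \<in> \<Delta>"
  shows "of_int (alcove_floor A \<delta>) \<le> pairing \<nu> \<delta>" "pairing \<nu> \<delta> \<le> of_int (alcove_floor A \<delta>) + 1"
proof -
  let ?k = "alcove_floor A \<delta>"
  have "closure A \<subseteq> {\<nu>. coroot \<delta> \<bullet> \<nu> \<ge> of_int ?k} \<inter> {\<nu>. coroot \<delta> \<bullet> \<nu> \<le> of_int ?k + 1}"
    using alcove_floor_bounds[OF A(1) _ A(3)]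
    by (intro closure_minimal closed_Int closed_halfspace_ge closed_halfspace_le)
      (auto simp: pairing_def inner_commute less_imp_le)
  then show "of_int ?k \<le> pairing \<nu> \<delta>" "pairing \<nu> \<delta> \<le> of_int ?k + 1"
    using A(2) by (auto simp: pairing_def inner_commute)
qed

section \<open>Crossing a wall\<close>

text \<open>Facets of alcoves have codimension one, so no facet lies in the hyperplanes of two roots
  that differ by more than a sign.\<close>

lemma aff_dim_hyp_Int:
  assumes "\<gamma> \<in> \<Delta>" "\<delta> \<in> \<Delta>" "\<delta> \<noteq> \<gamma>" "\<delta> \<noteq> - \<gamma>"
  shows "aff_dim (affine_hyp \<gamma> k \<inter> affine_hyp \<delta> c) < int DIM('a) - 1"
proof -
  have ne: "\<gamma> \<noteq> 0" "\<delta> \<noteq> 0" using assms zero_not_root by auto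
  \<comment> \<open>The part of \<delta> orthogonal to \<gamma>: a shift along v stays in the
    hyperplane of \<gamma> but leaves that of \<delta>.\<close>
  define v where "v = \<delta> - ((\<delta> \<bullet> \<gamma>) / (\<gamma> \<bullet> \<gamma>)) *\<^sub>R \<gamma>"
  have "v \<noteq> 0"
  proof
    assume "v = 0"
    then have "\<delta> = ((\<delta> \<bullet> \<gamma>) / (\<gamma> \<bullet> \<gamma>)) *\<^sub>R \<gamma>" by (simp add: v_def)
    then show False using scaleR_root_iff[OF assms(1)] assms(2-4)
      by (metis scaleR_minus1_left scaleR_one)
  qed
  have v\<gamma>: "v \<bullet> \<gamma> = 0" using ne by (simp add: v_def inner_diff_left)
  have "v \<bullet> v = v \<bullet> \<delta> - ((\<delta> \<bullet> \<gamma>) / (\<gamma> \<bullet> \<gamma>)) * (v \<bullet> \<gamma>)"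
    by (subst (2) v_def) (simp add: inner_diff_right)
  then have v\<delta>: "v \<bullet> \<delta> \<noteq> 0" using \<open>v \<noteq> 0\<close> v\<gamma>
    by (metis diff_zero inner_eq_zero_iff mult_zero_right)
  have pv: "pairing v \<gamma> = 0" "pairing v \<delta> \<noteq> 0"
    using v\<gamma> v\<delta> ne by (simp_all add: pairing_eq)
  have dim: "aff_dim (affine_hyp \<gamma> k) = int DIM('a) - 1"
    unfolding affine_hyp_coroot using aff_dim_hyperplane[of "coroot \<gamma>" "of_int k"]
    by (simp add: coroot_nonzero ne of_nat_diff Suc_leI)
  have nsub: "\<not> affine_hyp \<gamma> k \<subseteq> affine_hyp \<delta> c" if "z \<in> affine_hyp \<gamma> k \<inter> affine_hyp \<delta> c" for z
  proof
    assume sub: "affine_hyp \<gamma> k \<subseteq> affine_hyp \<delta> c"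
    have "z + v \<in> affine_hyp \<gamma> k" using that pv by (simp add: affine_hyp_def pairing_add_left)
    then have "z + v \<in> affine_hyp \<delta> c" using sub by blast
    then show False using that pv by (simp add: affine_hyp_def pairing_add_left)
  qed
  show ?thesis
  proof (cases "affine_hyp \<gamma> k \<inter> affine_hyp \<delta> c = {}")
    case True
    then show ?thesis using DIM_positive[where 'a = 'a] by (cases "DIM('a) = 1") (auto simp: dim nsub)
  next
    case False
    then obtain z where z: "z \<in> affine_hyp \<gamma> k \<inter> affine_hyp \<delta> c" by blast
    have "aff_dim (affine_hyp \<gamma> k \<inter> affine_hyp \<delta> c) = aff_dim (affine_hyp \<gamma> k) - 1"
      using aff_dim_affine_Int_hyperplane[of "affine_hyp \<gamma> k" "coroot \<delta>" "of_int c"] nsub[OF z] z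
      by (auto simp: affine_hyp_coroot affine_hyperplane)
    then show ?thesis using dim by simp
  qed
qed

text \<open>Only the floors of \<gamma> and -\<gamma> change: any other change would put the whole
  common facet into a second hyperplane.\<close>

lemma alcove_step_floor:
  assumes "alcove_step \<Delta> \<gamma> A B"
  obtains F where "common_wall A B F" "F \<subseteq> affine_hyp \<gamma> (alcove_floor B \<gamma>)" "F \<noteq> {}"
    "alcove_floor B \<gamma> = alcove_floor A \<gamma> + 1"
    "\<And>\<delta>. \<delta> \<in> \<Delta> \<Longrightarrow> \<delta> \<noteq> \<gamma> \<Longrightarrow> \<delta> \<noteq> - \<gamma> \<Longrightarrow> alcove_floor B \<delta> = alcove_floor A \<delta>"
proof -
  obtain F k where st: "A \<in> alcoves \<Delta>" "B \<in> alcoves \<Delta>" "\<gamma> \<in> \<Delta>"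
    and F: "common_wall A B F" "F \<subseteq> affine_hyp \<gamma> k"
    and side: "\<And>\<nu>. \<nu> \<in> A \<Longrightarrow> pairing \<nu> \<gamma> < of_int k" "\<And>\<nu>. \<nu> \<in> B \<Longrightarrow> of_int k < pairing \<nu> \<gamma>"
    using assms unfolding alcove_step_def by blast
  have facet: "F facet_of closure A" "F facet_of closure B" using F by (auto simp: common_wall_def)
  then have ne: "F \<noteq> {}" and sub: "F \<subseteq> closure A" "F \<subseteq> closure B"
    by (auto simp: facet_of_def dest: face_of_imp_subset)
  have dim: "aff_dim F = int DIM('a) - 1"
    using facet(1) unfolding facet_of_def aff_dim_closure_alcove[OF st(1)] by blast
  obtain f where f: "f \<in> F" using ne by blast
  have fk: "pairing f \<gamma> = of_int k" using f F by (auto simp: affine_hyp_def)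
  have kA: "k = alcove_floor A \<gamma> + 1"
  proof -
    have "k \<le> alcove_floor A \<gamma> + 1"
      using closure_alcove_bounds(2)[OF st(1) _ st(3), of f] f sub fk by (simp add: subset_iff)
    moreover have "alcove_floor A \<gamma> < k"
      using alcove_floor_bounds(1)[OF st(1) alcove_some[OF st(1)] st(3)] side(1)[OF alcove_some[OF st(1)]]
      by linarith
    ultimately show ?thesis by linarith
  qed
  have kB: "k = alcove_floor B \<gamma>"
  proof -
    have "alcove_floor B \<gamma> \<le> k"
      using closure_alcove_bounds(1)[OF st(2) _ st(3), of f] f sub fk by auto
    moreover have "k < alcove_floor B \<gamma> + 1"
      using alcove_floor_bounds(2)[OF st(2) alcove_some[OF st(2)] st(3)] side(2)[OF alcove_some[OF st(2)]]
      by linarith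
    ultimately show ?thesis by linarith
  qed
  have "alcove_floor B \<delta> = alcove_floor A \<delta>" if \<delta>: "\<delta> \<in> \<Delta>" "\<delta> \<noteq> \<gamma>" "\<delta> \<noteq> - \<gamma>" for \<delta>
  proof (rule ccontr)
    assume neq: "alcove_floor B \<delta> \<noteq> alcove_floor A \<delta>"
    \<comment> \<open>Both closures contain the facet, so the closed strips for \<delta> meet;
      having different floors they are adjacent and meet in the level of the larger floor.\<close>
    define c where "c = max (alcove_floor A \<delta>) (alcove_floor B \<delta>)"
    have "pairing f \<delta> = of_int c" if "f \<in> F" for f
    proof -
      have fc: "f \<in> closure A" "f \<in> closure B" using that sub by auto
      show ?thesis
        using closure_alcove_bounds[OF st(1) fc(1) \<delta>(1)] closure_alcove_bounds[OF st(2) fc(2) \<delta>(1)] neq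
        unfolding c_def by linarith
    qed
    then have "F \<subseteq> affine_hyp \<gamma> k \<inter> affine_hyp \<delta> c" using F by (auto simp: affine_hyp_def)
    then have "aff_dim F < int DIM('a) - 1"
      using aff_dim_subset aff_dim_hyp_Int[OF st(3) \<delta>] by (meson order_le_less_trans)
    then show False using dim by simp
  qed
  then show thesis
    using F ne kA by (intro that[of F]) (simp_all add: kB[symmetric])
qed

lemma alcove_step_floor_same: "alcove_step \<Delta> \<gamma> A B \<Longrightarrow> alcove_floor B \<gamma> = alcove_floor A \<gamma> + 1"
  by (erule alcove_step_floor)

lemma alcove_step_floor_other:
  "alcove_step \<Delta> \<gamma> A B \<Longrightarrow> \<delta> \<in> \<Delta> \<Longrightarrow> \<delta> \<noteq> \<gamma> \<Longrightarrow> \<delta> \<noteq> - \<gamma> \<Longrightarrow>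
    alcove_floor B \<delta> = alcove_floor A \<delta>"
  by (erule alcove_step_floor)

lemma alcove_step_alcoves:
  assumes "alcove_step \<Delta> \<gamma> A B" shows "A \<in> alcoves \<Delta>" "B \<in> alcoves \<Delta>" "\<gamma> \<in> \<Delta>"
  using assms by (auto simp: alcove_step_def)

lemma alcove_step_unique:
  assumes "alcove_step \<Delta> \<gamma> A B" "alcove_step \<Delta> \<gamma> A B'" shows "B = B'"
proof (rule alcove_eqI)
  show B: "B \<in> alcoves \<Delta>" "B' \<in> alcoves \<Delta>" using assms alcove_step_alcoves by blast+
  have \<gamma>: "\<gamma> \<in> \<Delta>" using assms alcove_step_alcoves by blast
  fix \<delta> assume \<delta>: "\<delta> \<in> \<Delta>"
  show "alcove_floor B \<delta> = alcove_floor B' \<delta>"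
    using alcove_step_floor_same[OF assms(1)] alcove_step_floor_same[OF assms(2)]
      alcove_step_floor_other[OF assms(1) \<delta>] alcove_step_floor_other[OF assms(2) \<delta>]
      alcove_floor_uminus[OF B(1) \<gamma>] alcove_floor_uminus[OF B(2) \<gamma>]
    by (cases "\<delta> = \<gamma>"; cases "\<delta> = - \<gamma>") auto
qed

text \<open>The reflection permutes the roots and shifts the pairings by the integers
  \<open>m\<close>, so cells go to cells.\<close>

lemma affine_refl_alcove:
  assumes A: "A \<in> alcoves \<Delta>" and \<gamma>: "\<gamma> \<in> \<Delta>"
  shows "affine_refl \<gamma> k ` A \<in> alcoves \<Delta>"
proof -
  let ?s = "affine_refl \<gamma> k"
  define m where "m \<delta> = \<lfloor>of_int k * pairing \<gamma> (root_refl \<gamma> \<delta>)\<rfloor>" for \<delta>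
  have m: "of_int (m \<delta>) = of_int k * pairing \<gamma> (root_refl \<gamma> \<delta>)" if "\<delta> \<in> \<Delta>" for \<delta>
  proof -
    have "pairing \<gamma> (root_refl \<gamma> \<delta>) \<in> \<int>" using pairing_Ints root_refl_root \<gamma> that by blast
    then show ?thesis unfolding m_def by (auto elim!: Ints_cases)
  qed
  define k' where "k' \<delta> = alcove_floor A (root_refl \<gamma> \<delta>) - m \<delta>" for \<delta>
  have eq: "pairing (?s \<nu>) (root_refl \<gamma> \<delta>) = pairing \<nu> \<delta> + of_int (m \<delta>)" if "\<delta> \<in> \<Delta>" for \<nu> \<delta>
    by (simp add: affine_refl_eq pairing_add_left pairing_scaleR_left m[OF that]
        orthogonal_pairing[OF orthogonal_root_refl])
  have "?s ` A = alcove_cell k'"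
  proof
    show "?s ` A \<subseteq> alcove_cell k'"
    proof
      fix \<nu> assume "\<nu> \<in> ?s ` A"
      then have "?s \<nu> \<in> A" by (auto simp: affine_refl_involution)
      then have "of_int (alcove_floor A (root_refl \<gamma> \<delta>)) < pairing (?s \<nu>) (root_refl \<gamma> \<delta>)"
        "pairing (?s \<nu>) (root_refl \<gamma> \<delta>) < of_int (alcove_floor A (root_refl \<gamma> \<delta>)) + 1"
        if "\<delta> \<in> \<Delta>" for \<delta> using alcove_floor_bounds[OF A] root_refl_root[OF \<gamma> that] by auto
      then show "\<nu> \<in> alcove_cell k'" unfolding alcove_cell_def k'_def using eq by fastforce
    qed
    show "alcove_cell k' \<subseteq> ?s ` A"
    proof
      fix \<nu> assume \<nu>: "\<nu> \<in> alcove_cell k'"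
      have "of_int (alcove_floor A \<delta>) < pairing (?s \<nu>) \<delta> \<and> pairing (?s \<nu>) \<delta> < of_int (alcove_floor A \<delta>) + 1"
        if "\<delta> \<in> \<Delta>" for \<delta>
      proof -
        have r: "root_refl \<gamma> \<delta> \<in> \<Delta>" using root_refl_root[OF \<gamma> that] .
        then show ?thesis using \<nu> eq[OF r, of \<nu>] unfolding alcove_cell_def k'_def by fastforce
      qed
      then have "?s \<nu> \<in> alcove_cell (alcove_floor A)" by (simp add: alcove_cell_def)
      then have "?s \<nu> \<in> A" using alcove_eq_cell[OF A] by blast
      then show "\<nu> \<in> ?s ` A" using affine_refl_involution by (metis image_eqI)
    qed
  qed
  moreover have "?s ` A \<noteq> {}" using alcove_some[OF A] by blast
  ultimately show ?thesis using alcove_cell_alcove by fastforce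
qed

lemma alcove_step_affine_refl:
  assumes st: "alcove_step \<Delta> \<gamma> A B" and \<delta>: "\<delta> \<in> \<Delta>"
  shows "alcove_step \<Delta> (root_refl \<delta> \<gamma>) (affine_refl \<delta> k ` A) (affine_refl \<delta> k ` B)"
proof -
  let ?s = "affine_refl \<delta> k"
  obtain F l where F: "common_wall A B F" "F \<subseteq> affine_hyp \<gamma> l"
    and side: "\<And>\<nu>. \<nu> \<in> A \<Longrightarrow> pairing \<nu> \<gamma> < of_int l" "\<And>\<nu>. \<nu> \<in> B \<Longrightarrow> of_int l < pairing \<nu> \<gamma>"
    using st unfolding alcove_step_def by blast
  note alc = alcove_step_alcoves[OF st]
  have "pairing \<delta> (root_refl \<delta> \<gamma>) \<in> \<int>" using pairing_Ints root_refl_root \<delta> alc by blast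
  then obtain m where m: "pairing \<delta> (root_refl \<delta> \<gamma>) = of_int m" by (auto elim: Ints_cases)
  have eq: "pairing (?s \<nu>) (root_refl \<delta> \<gamma>) = pairing \<nu> \<gamma> + of_int (k * m)" for \<nu>
    by (simp add: affine_refl_eq pairing_add_left pairing_scaleR_left m
        orthogonal_pairing[OF orthogonal_root_refl])
  show ?thesis
    unfolding alcove_step_def
  proof (intro conjI exI[of _ "?s ` F"] exI[of _ "l + k * m"] affine_refl_alcove alc \<delta> root_refl_root
      common_wall_affine_refl F)
    show "?s ` F \<subseteq> affine_hyp (root_refl \<delta> \<gamma>) (l + k * m)"
      using F(2) by (auto simp: affine_hyp_def eq)
    show "\<forall>\<nu>\<in>?s ` A. pairing \<nu> (root_refl \<delta> \<gamma>) < of_int (l + k * m)"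
      using side(1) by (auto simp: eq)
    show "\<forall>\<nu>\<in>?s ` B. of_int (l + k * m) < pairing \<nu> (root_refl \<delta> \<gamma>)"
      using side(2) by (auto simp: eq)
  qed
qed

text \<open>The reflected alcove lies across the same wall as B, and only one alcove lies
  there.\<close>

lemma alcove_step_refl_image:
  assumes st: "alcove_step \<Delta> \<gamma> A B" and k: "k = alcove_floor B \<gamma>"
  shows "affine_refl \<gamma> k ` A = B"
proof -
  let ?s = "affine_refl \<gamma> k"
  note alc = alcove_step_alcoves[OF st]
  have \<gamma>0: "\<gamma> \<noteq> 0" using alc zero_not_root by auto
  obtain F where F: "common_wall A B F" "F \<subseteq> affine_hyp \<gamma> k"
    "alcove_floor B \<gamma> = alcove_floor A \<gamma> + 1"
    using alcove_step_floor[OF st] k by metis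
  have "?s ` F = id ` F"
  proof (rule image_cong)
    fix \<nu> assume "\<nu> \<in> F"
    then have "pairing \<nu> \<gamma> = of_int k" using F(2) by (auto simp: affine_hyp_def)
    then show "?s \<nu> = id \<nu>" by (simp add: affine_refl_def)
  qed simp
  then have "common_wall A (?s ` A) F"
    using common_wall_affine_refl[OF F(1), of \<gamma> k] F(1) by (simp add: common_wall_def)
  moreover have "pairing \<nu> \<gamma> < of_int k" if "\<nu> \<in> A" for \<nu>
    using alcove_floor_bounds(2)[OF alc(1) that alc(3)] F(3) k by simp
  moreover from this have "of_int k < pairing (?s \<nu>) \<gamma>" if "\<nu> \<in> A" for \<nu>
    using that \<gamma>0 by (simp add: affine_refl_def pairing_diff_left pairing_scaleR_left pairing_self)
  ultimately have "alcove_step \<Delta> \<gamma> A (?s ` A)"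
    unfolding alcove_step_def using alc affine_refl_alcove F(2) by auto
  then show ?thesis using alcove_step_unique st by blast
qed

section \<open>The alcove path of a chain and its levels\<close>

lemma alcove_path_unique:
  assumes "alcove_path \<Delta> S \<Gamma> As" "alcove_path \<Delta> S \<Gamma> As'" shows "As = As'"
proof (rule nth_equalityI)
  show "length As = length As'" using assms by (simp add: alcove_path_def)
  have "j \<le> length \<Gamma> \<Longrightarrow> As ! j = As' ! j" for j
  proof (induction j)
    case 0
    then show ?case using assms by (simp add: alcove_path_def)
  next
    case (Suc j)
    then have "alcove_step \<Delta> (- (\<Gamma> ! j)) (As ! j) (As ! Suc j)"
      "alcove_step \<Delta> (- (\<Gamma> ! j)) (As ! j) (As' ! Suc j)"
      using assms unfolding alcove_path_def by (auto simp: Suc_le_eq)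
    then show ?case by (rule alcove_step_unique)
  qed
  then show "As ! j = As' ! j" if "j < length As" for j
    using that assms by (simp add: alcove_path_def)
qed

lemma path_of_eq: "alcove_path \<Delta> S \<Gamma> As \<Longrightarrow> path_of \<Delta> S \<Gamma> = As"
  unfolding path_of_def using alcove_path_unique by blast

lemma alcove_path_step:
  assumes "alcove_path \<Delta> S \<Gamma> As" "j < length \<Gamma>"
  shows "alcove_step \<Delta> (- (\<Gamma> ! j)) (As ! j) (As ! Suc j)" "\<Gamma> ! j \<in> \<Delta>"
  using assms alcove_step_alcoves(3) uminus_root_iff unfolding alcove_path_def by blast+

lemma alcove_path_floor:
  assumes p: "alcove_path \<Delta> S \<Gamma> As" and j: "j < length \<Gamma>" and \<delta>: "\<delta> \<in> \<Delta>" "\<delta> \<noteq> - (\<Gamma> ! j)"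
  shows "alcove_floor (As ! Suc j) \<delta> = (if \<delta> = \<Gamma> ! j then alcove_floor (As ! j) \<delta> - 1 else
      alcove_floor (As ! j) \<delta>)"
proof -
  note st = alcove_path_step[OF p j]
  note alc = alcove_step_alcoves[OF st(1)]
  show ?thesis
    using alcove_step_floor_same[OF st(1)] alcove_step_floor_other[OF st(1) \<delta>]
      \<delta>(1) alcove_floor_uminus[OF alc(1) st(2)] alcove_floor_uminus[OF alc(2) st(2)] by auto
qed

text \<open>The step leaves \<open>As ! j\<close> in direction \<open>- (\<Gamma> ! j)\<close>,
  hence through the lower boundary of the strip, whose level is the floor.\<close>

lemma chain_l_eq:
  assumes p: "alcove_path \<Delta> S \<Gamma> As" and j: "j < length \<Gamma>"
  shows "chain_l \<Delta> S \<Gamma> j = - alcove_floor (As ! j) (\<Gamma> ! j)"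
  unfolding chain_l_def path_of_eq[OF p]
proof (rule the_equality)
  let ?\<beta> = "\<Gamma> ! j" and ?A = "As ! j" and ?B = "As ! Suc j"
  note st = alcove_path_step[OF p j]
  note alc = alcove_step_alcoves[OF st(1)]
  obtain F where F: "common_wall ?A ?B F" "F \<subseteq> affine_hyp (- ?\<beta>) (alcove_floor ?B (- ?\<beta>))"
    "alcove_floor ?B (- ?\<beta>) = alcove_floor ?A (- ?\<beta>) + 1"
    using alcove_step_floor[OF st(1)] by metis
  have fl: "alcove_floor ?B (- ?\<beta>) = - alcove_floor ?A ?\<beta>"
    using F(3) alcove_floor_uminus[OF alc(1) st(2)] by simp
  show "\<exists>F. common_wall ?A ?B F \<and> F \<subseteq> affine_hyp ?\<beta> (- (- alcove_floor ?A ?\<beta>))"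
    using F fl by (auto simp: affine_hyp_uminus)
  fix l assume "\<exists>F. common_wall ?A ?B F \<and> F \<subseteq> affine_hyp ?\<beta> (- l)"
  then obtain G where G: "common_wall ?A ?B G" "G \<subseteq> affine_hyp ?\<beta> (- l)" by blast
  then obtain f where f: "f \<in> G" "f \<in> closure ?A" "f \<in> closure ?B"
    unfolding common_wall_def facet_of_def using face_of_imp_subset by blast
  have "pairing f ?\<beta> = - of_int l" using f G by (auto simp: affine_hyp_def)
  then show "l = - alcove_floor ?A ?\<beta>"
    using closure_alcove_bounds[OF alc(1) f(2) st(2)] closure_alcove_bounds[OF alc(2) f(3) st(2)]
      fl alcove_floor_uminus[OF alc(2) st(2)] by linarith
qed

end

subsection \<open>Reversing a string of rank two\<close>

lemma rank2_string_coroot: "rank2_string (coroot \<alpha>) (coroot \<beta>) = map coroot (rank2_string \<alpha> \<beta>)"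
proof -
  have "alternating (coroot \<alpha>) (coroot \<beta>) i = coroot \<beta> \<longleftrightarrow> alternating \<alpha> \<beta> i = \<beta>" for i
    unfolding coroot_alternating[symmetric] by (metis coroot_coroot)
  then show ?thesis by (simp add: rank2_string_def coroot_alternating del: upt_Suc)
qed

lemma nth_reverse_segment:
  assumes "t + q \<le> length xs"
    and ys: "ys = take t xs @ rev (take q (drop t xs)) @ drop (t + q) xs"
  shows "length ys = length xs"
    and "\<And>j. j < t \<Longrightarrow> ys ! j = xs ! j"
    and "\<And>i. i < q \<Longrightarrow> ys ! (t + i) = xs ! (t + (q - Suc i))"
    and "\<And>j. t + q \<le> j \<Longrightarrow> j < length xs \<Longrightarrow> ys ! j = xs ! j"
  using assms by (auto simp: nth_append rev_nth min_def intro!: arg_cong[of _ _ "(!) xs"])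

context based_root_system
begin

text \<open>The roots of the segment are pairwise distinct up to sign, so each floor changes only
  when its own root is crossed.\<close>

lemma segment_floor:
  assumes p: "alcove_path \<Delta> S \<Gamma> As" and m: "t + m \<le> length \<Gamma>"
    and dist: "\<And>i j. i < m \<Longrightarrow> j < m \<Longrightarrow> i \<noteq> j \<Longrightarrow> \<Gamma> ! (t + i) \<noteq> \<Gamma> ! (t + j) \<and> \<Gamma> ! (t + i) \<noteq> - \<Gamma> ! (t + j)"
    and i: "i < m" and j: "j \<le> m"
  shows "alcove_floor (As ! (t + j)) (\<Gamma> ! (t + i)) =
    alcove_floor (As ! t) (\<Gamma> ! (t + i)) - (if i < j then 1 else 0)"
  using j
proof (induction j)
  case (Suc j)
  have root: "\<Gamma> ! (t + i) \<in> \<Delta>" using alcove_path_step(2)[OF p] i m by simp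
  have neg: "\<Gamma> ! (t + i) \<noteq> - (\<Gamma> ! (t + j))"
  proof (cases "i = j")
    case True
    then show ?thesis using root root_pos_or_neg pos_root_not_neg by metis
  next
    case False
    then show ?thesis using dist[of i j] i Suc.prems by simp
  qed
  have eq: "\<Gamma> ! (t + i) = \<Gamma> ! (t + j) \<longleftrightarrow> i = j" using dist[of i j] i Suc.prems by auto
  have "t + j < length \<Gamma>" using Suc.prems m by simp
  from alcove_path_floor[OF p this root neg] Suc eq show ?case by auto
qed simp

text \<open>The point c is defined by the floors of \<alpha> and \<beta>. The coroot of another root
  \<gamma> of the string is a combination of theirs with nonnegative integer coefficients; let m be
  the resulting integer \<open>pairing c \<gamma>\<close>. Before the string the alcove lies above
  the levels of \<alpha> and \<beta>, hence above level m of \<gamma>; after it, it lies below both,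
  hence below m. Since the floor of \<gamma> drops only by one in between, it was m.\<close>

lemma segment_center:
  assumes r2: "rank2 \<alpha> \<beta>" and p: "alcove_path \<Delta> S \<Gamma> As" and n: "t + Suc n \<le> length \<Gamma>"
    and \<Gamma>: "\<And>i. i \<le> n \<Longrightarrow> \<Gamma> ! (t + i) = alternating \<alpha> \<beta> i"
    and str: "rank2_string \<alpha> \<beta> = map (alternating \<alpha> \<beta>) [0..<Suc n]"
    and last: "alternating \<alpha> \<beta> n = \<beta>"
    and dist: "\<And>i j. i \<le> n \<Longrightarrow> j \<le> n \<Longrightarrow> i \<noteq> j \<Longrightarrow>
      alternating \<alpha> \<beta> i \<noteq> alternating \<alpha> \<beta> j \<and> alternating \<alpha> \<beta> i \<noteq> - alternating \<alpha> \<beta> j"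
  obtains c where "\<And>i. i \<le> n \<Longrightarrow>
    pairing c (alternating \<alpha> \<beta> i) = of_int (alcove_floor (As ! t) (alternating \<alpha> \<beta> i))"
proof -
  interpret rank2 \<alpha> \<beta> by (rule r2)
  let ?fl = "alcove_floor (As ! t)"
  let ?a = "of_int (?fl \<alpha>) :: real" and ?b = "of_int (?fl \<beta>) :: real"
  define M where "M = pairing \<beta> \<alpha>"
  define N where "N = pairing \<alpha> \<beta>"
  define d where "d = 4 - M * N"
  \<comment> \<open>Cramer's rule for the pairings with \<alpha> and \<beta>; the determinant d is
    nonzero because the Cartan integers have product at most 3.\<close>
  define c where "c = ((2 * ?a - M * ?b) / d) *\<^sub>R \<alpha> + ((2 * ?b - N * ?a) / d) *\<^sub>R \<beta>"
  have d0: "d \<noteq> 0" using pairings by (auto simp: d_def M_def N_def)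
  have c\<alpha>: "pairing c \<alpha> = ?a"
  proof -
    have "pairing c \<alpha> = ((2 * ?a - M * ?b) / d) * 2 + ((2 * ?b - N * ?a) / d) * M"
      by (simp add: c_def pairing_add_left pairing_scaleR_left pairing_self nonzero M_def)
    also have "\<dots> = (d * ?a) / d" by (simp add: d_def add_divide_distrib[symmetric] algebra_simps)
    finally show ?thesis using d0 by simp
  qed
  have c\<beta>: "pairing c \<beta> = ?b"
  proof -
    have "pairing c \<beta> = ((2 * ?a - M * ?b) / d) * N + ((2 * ?b - N * ?a) / d) * 2"
      by (simp add: c_def pairing_add_left pairing_scaleR_left pairing_self nonzero N_def)
    also have "\<dots> = (d * ?b) / d" by (simp add: d_def add_divide_distrib[symmetric] algebra_simps)
    finally show ?thesis using d0 by simp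
  qed
  interpret co: rank2 "coroot \<alpha>" "coroot \<beta>" by (rule coroots)
  obtain n' where n': "rank2_string (coroot \<alpha>) (coroot \<beta>) = map (alternating (coroot \<alpha>) (coroot \<beta>))
      [0..<Suc n']"
    and cone: "\<And>i. i \<le> n' \<Longrightarrow> \<exists>x y :: nat. alternating (coroot \<alpha>) (coroot \<beta>) i =
      comb (coroot \<alpha>) (coroot \<beta>) (real x) (real y) \<and> (x \<noteq> 0 \<or> y \<noteq> 0)"
    using co.rank2_structure by metis
  have "n' = n"
    using arg_cong[OF n'[unfolded rank2_string_coroot str], of length] by simp
  have pathseg: "alcove_floor (As ! (t + j)) (alternating \<alpha> \<beta> i) =
      ?fl (alternating \<alpha> \<beta> i) - (if i < j then 1 else 0)" if "i \<le> n" "j \<le> Suc n" for i j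
    using segment_floor[OF p n, of i j] \<Gamma> dist that by (simp add: less_Suc_eq_le)
  have roots: "alternating \<alpha> \<beta> i \<in> \<Delta>" if "i \<le> n" for i
    using alcove_path_step(2)[OF p, of "t + i"] \<Gamma>[OF that] that n by simp
  have ab: "\<alpha> \<in> \<Delta>" "\<beta> \<in> \<Delta>" using roots[of 0] roots[of n] last by auto
  have alc: "As ! t \<in> alcoves \<Delta>" "As ! (t + Suc n) \<in> alcoves \<Delta>"
    using alcove_step_alcoves(1)[OF alcove_path_step(1)[OF p, of t]]
      alcove_step_alcoves(2)[OF alcove_path_step(1)[OF p, of "t + n"]] n by auto
  show thesis
  proof (rule that[of c])
    fix i assume i: "i \<le> n"
    let ?\<gamma> = "alternating \<alpha> \<beta> i"
    obtain x y :: nat where xy: "coroot ?\<gamma> = comb (coroot \<alpha>) (coroot \<beta>) (real x) (real y)" "x \<noteq> 0 \<or> y \<noteq> 0"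
      using cone i \<open>n' = n\<close> unfolding coroot_alternating by blast
    have pr: "pairing \<nu> ?\<gamma> = real x * pairing \<nu> \<alpha> + real y * pairing \<nu> \<beta>" for \<nu>
      unfolding pairing_def xy by (simp add: comb_def inner_add_right)
    let ?m = "int x * ?fl \<alpha> + int y * ?fl \<beta>"
    have c\<gamma>: "pairing c ?\<gamma> = of_int ?m" by (simp add: pr c\<alpha> c\<beta>)
    obtain \<nu> where \<nu>: "\<nu> \<in> As ! t" using alcove_some[OF alc(1)] by blast
    obtain \<nu>' where \<nu>': "\<nu>' \<in> As ! (t + Suc n)" using alcove_some[OF alc(2)] by blast
    have strict: "real x * u + real y * v > 0" if "u > 0" "v > 0" for u v
      using that xy(2) by (cases "x = 0") (auto intro: add_pos_nonneg)
    have "real x * (pairing \<nu> \<alpha> - ?a) + real y * (pairing \<nu> \<beta> - ?b) > 0"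
      using alcove_floor_bounds(1)[OF alc(1) \<nu>] ab by (intro strict) auto
    then have "of_int ?m < pairing \<nu> ?\<gamma>" by (simp add: pr algebra_simps)
    then have "of_int ?m < (of_int (?fl ?\<gamma>) + 1 :: real)"
      using alcove_floor_bounds(2)[OF alc(1) \<nu> roots[OF i]] by linarith
    then have 1: "?m \<le> ?fl ?\<gamma>" by linarith
    have "real x * (?a - pairing \<nu>' \<alpha>) + real y * (?b - pairing \<nu>' \<beta>) > 0"
      using alcove_floor_bounds(2)[OF alc(2) \<nu>'] ab pathseg[of 0 "Suc n"] pathseg[of n "Suc n"] last
      by (intro strict) fastforce+
    then have "pairing \<nu>' ?\<gamma> < of_int ?m" by (simp add: pr algebra_simps)
    then have "of_int (?fl ?\<gamma> - 1) < (of_int ?m :: real)"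
      using alcove_floor_bounds(1)[OF alc(2) \<nu>' roots[OF i]] pathseg[OF i, of "Suc n"] i by simp
    then have 2: "?fl ?\<gamma> \<le> ?m" unfolding of_int_less_iff by simp
    have "?fl ?\<gamma> = ?m" using 1 2 by simp
    then show "pairing c ?\<gamma> = of_int (?fl ?\<gamma>)" using c\<gamma> by (simp only:)
  qed
qed

text \<open>The same c serves both chains, because the reversed string starts in the same alcove and
  crosses the same roots.\<close>

theorem reverse_rank2_segment:
  assumes r2: "rank2 \<alpha> \<beta>" and chain: "lambda_chain \<Delta> S lam \<Gamma>"
    and len: "t + q \<le> length \<Gamma>" and seg: "take q (drop t \<Gamma>) = rank2_string \<alpha> \<beta>"
    and \<Gamma>': "\<Gamma>' = take t \<Gamma> @ rev (take q (drop t \<Gamma>)) @ drop (t + q) \<Gamma>"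
  obtains c where "lambda_chain \<Delta> S lam \<Gamma>'"
    "\<And>j. j < length \<Gamma> \<Longrightarrow> j < t \<or> t + q \<le> j \<Longrightarrow> chain_l \<Delta> S \<Gamma>' j = chain_l \<Delta> S \<Gamma> j"
    "\<And>j. t \<le> j \<Longrightarrow> j < t + q \<Longrightarrow> pairing c (\<Gamma> ! j) = - of_int (chain_l \<Delta> S \<Gamma> j)"
    "\<And>j. t \<le> j \<Longrightarrow> j < t + q \<Longrightarrow> pairing c (\<Gamma>' ! j) = - of_int (chain_l \<Delta> S \<Gamma>' j)"
proof -
  interpret rank2 \<alpha> \<beta> by (rule r2)
  obtain As where p: "alcove_path \<Delta> S \<Gamma> As" and fin: "As ! length \<Gamma> = shifted_alcove \<Delta> S (- lam)"
    using chain unfolding lambda_chain_def by blast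
  obtain n where str: "rank2_string \<alpha> \<beta> = map (alternating \<alpha> \<beta>) [0..<Suc n]"
    and rev: "\<And>i. i \<le> n \<Longrightarrow> alternating \<beta> \<alpha> i = alternating \<alpha> \<beta> (n - i)"
    and last: "alternating \<alpha> \<beta> n = \<beta>"
    and n0: "n \<noteq> 0"
    and dist: "\<And>i j. i \<le> n \<Longrightarrow> j \<le> n \<Longrightarrow> i \<noteq> j \<Longrightarrow>
      alternating \<alpha> \<beta> i \<noteq> alternating \<alpha> \<beta> j \<and> alternating \<alpha> \<beta> i \<noteq> - alternating \<alpha> \<beta> j"
    by (rule rank2_structure) auto
  have q: "q = Suc n" using arg_cong[OF seg, of length] len by (simp add: str)
  have \<Gamma>: "\<Gamma> ! (t + i) = alternating \<alpha> \<beta> i" if "i \<le> n" for i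
  proof -
    have "\<Gamma> ! (t + i) = take q (drop t \<Gamma>) ! i" using that len q by simp
    also have "\<dots> = alternating \<alpha> \<beta> i" unfolding seg str using that by (simp del: upt_Suc)
    finally show ?thesis .
  qed
  note nth' = nth_reverse_segment[OF len \<Gamma>']
  have \<Gamma>'mid: "\<Gamma>' ! (t + i) = alternating \<alpha> \<beta> (n - i)" if "i \<le> n" for i
    using nth'(3)[of i] \<Gamma>[of "n - i"] that q by simp
  have n: "t + Suc n \<le> length \<Gamma>" using len q by simp
  obtain c where c: "\<And>i. i \<le> n \<Longrightarrow>
      pairing c (alternating \<alpha> \<beta> i) = of_int (alcove_floor (As ! t) (alternating \<alpha> \<beta> i))"
    using segment_center[OF r2 p n \<Gamma> str last dist] by blast
  \<comment> \<open>The alcoves around the face through \<open>c\<close> form a cycle.  The reversed string runs through it the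
    other way, which is the image of the given path under the reflection in its first wall.\<close>
  define R where "R \<gamma> X = (\<lambda>\<nu>. c + root_refl \<gamma> (\<nu> - c)) ` X" for \<gamma> X
  have R_refl: "affine_refl \<gamma> k ` X = R \<gamma> X" if "pairing c \<gamma> = of_int k" for \<gamma> k X
    unfolding R_def by (simp add: affine_refl_center[OF that])
  have R_inv: "R \<gamma> (R \<gamma> X) = X" for \<gamma> X
    by (simp add: R_def image_comp comp_def)
  have floor: "alcove_floor (As ! (t + j)) (alternating \<alpha> \<beta> i) =
      alcove_floor (As ! t) (alternating \<alpha> \<beta> i) - (if i < j then 1 else 0)" if "i \<le> n" "j \<le> Suc n" for i j
    using segment_floor[OF p n, of i j] \<Gamma> dist that by (simp add: less_Suc_eq_le)
  have step: "alcove_step \<Delta> (- alternating \<alpha> \<beta> i) (As ! (t + i)) (As ! Suc (t + i))" if "i \<le> n" for i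
    using alcove_path_step(1)[OF p, of "t + i"] \<Gamma> that n by simp
  have roots: "alternating \<alpha> \<beta> i \<in> \<Delta>" if "i \<le> n" for i
    using alcove_step_alcoves(3)[OF step[OF that]] uminus_root_iff by simp
  have ab: "\<alpha> \<in> \<Delta>" "\<beta> \<in> \<Delta>" using roots[of 0] roots[of n] last by auto
  have c\<alpha>: "pairing c \<alpha> = of_int (alcove_floor (As ! t) \<alpha>)" and c\<beta>: "pairing c \<beta> = of_int
      (alcove_floor (As ! t) \<beta>)"
    using c[of 0] c[of n] last by auto
  have R_step: "R (alternating \<alpha> \<beta> i) (As ! (t + i)) = As ! Suc (t + i)" if i: "i \<le> n" for i
  proof -
    let ?\<gamma> = "alternating \<alpha> \<beta> i"
    have "alcove_floor (As ! Suc (t + i)) (- ?\<gamma>) = - alcove_floor (As ! (t + i)) ?\<gamma>"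
      using alcove_step_floor_same[OF step[OF i]]
        alcove_floor_uminus[OF alcove_step_alcoves(1)[OF step[OF i]] roots[OF i]] by simp
    also have "\<dots> = - alcove_floor (As ! t) ?\<gamma>" using floor[OF i, of i] i by simp
    finally have "affine_refl (- ?\<gamma>) (- alcove_floor (As ! t) ?\<gamma>) ` (As ! (t + i)) = As ! Suc (t + i)"
      using alcove_step_refl_image[OF step[OF i]] by simp
    then show ?thesis using R_refl[OF c[OF i]] by (simp add: affine_refl_uminus)
  qed
  have R_alcove_step: "alcove_step \<Delta> (root_refl \<alpha> \<gamma>) (R \<alpha> A) (R \<alpha> B)"
    "alcove_step \<Delta> (root_refl \<beta> \<gamma>) (R \<beta> A) (R \<beta> B)" if "alcove_step \<Delta> \<gamma> A B" for \<gamma> A B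
    using alcove_step_affine_refl[OF that ab(1)] alcove_step_affine_refl[OF that ab(2)]
      R_refl[OF c\<alpha>] R_refl[OF c\<beta>] by metis+
  \<comment> \<open>Reflection in the first wall maps \<open>As ! Suc t\<close> back to
    \<open>As ! t\<close>, hence the shift of the index by one. The reflected path covers the first
    n steps of the reversed string.\<close>
  define As' where "As' = map (\<lambda>j. if t \<le> j \<and> j \<le> t + n then R \<alpha> (As ! Suc j) else As ! j) [0..<length As]"
  have lenAs: "length As = Suc (length \<Gamma>)" using p by (simp add: alcove_path_def)
  have As': "As' ! j = (if t \<le> j \<and> j \<le> t + n then R \<alpha> (As ! Suc j) else As ! j)" if "j \<le> length \<Gamma>" for j
    using that lenAs unfolding As'_def by (simp del: upt_Suc)
  have As't: "As' ! t = As ! t"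
    using As'[of t] R_step[of 0] R_inv n by (metis add.right_neutral alternating.simps(1) le0
        le_add1 order_refl add_leD1)
  have out: "As' ! j = As ! j" if "j \<le> length \<Gamma>" "j \<le> t \<or> t + q \<le> j" for j
    using that As'[of j] As't q by (cases "j = t") auto
  have p': "alcove_path \<Delta> S \<Gamma>' As'"
    unfolding alcove_path_def
  proof (intro conjI allI impI)
    show "length As' = Suc (length \<Gamma>')" using lenAs nth'(1) by (simp add: As'_def del: upt_Suc)
    show "As' ! 0 = fund_alcove \<Delta> S" using out[of 0] p by (simp add: alcove_path_def)
    fix j assume "j < length \<Gamma>'"
    then have j: "j < length \<Gamma>" using nth'(1) by simp
    consider "j < t" | i where "j = t + i" "i < n" | "j = t + n" | "t + q \<le> j"
      using q by (metis Suc_leI add_Suc_right le_add_diff_inverse linorder_neqE_nat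
          nat_add_left_cancel_less not_le)
    then show "alcove_step \<Delta> (- \<Gamma>' ! j) (As' ! j) (As' ! Suc j)"
    proof cases
      case 1
      then show ?thesis
        using alcove_path_step(1)[OF p j] out[of j] out[of "Suc j"] nth'(2)[of j] j by simp
    next
      case (2 i)
      have "As' ! j = R \<alpha> (As ! (t + Suc i))" "As' ! Suc j = R \<alpha> (As ! Suc (t + Suc i))"
        using As'[of j] As'[of "Suc j"] 2 j by simp_all
      moreover have "root_refl \<alpha> (- alternating \<alpha> \<beta> (Suc i)) = - \<Gamma>' ! j"
        using \<Gamma>'mid[of i] rev[of i] 2 by (simp add: root_refl_neg_arg)
      ultimately show ?thesis
        using R_alcove_step(1)[OF step[of "Suc i"]] 2(2) by simp
    next
      case 3
      \<comment> \<open>The last step lies outside the image under \<open>R \<alpha>\<close>.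
        Reflection in the last wall of the given string, \<open>R \<beta>\<close>, produces it from
        step m = n - 1; by \<open>eq\<close> both reflections yield the same alcove before the
        step.\<close>
      obtain m where m: "n = Suc m" using n0 not0_implies_Suc by blast
      have "alternating \<alpha> \<beta> m = root_refl \<beta> \<alpha>" using rev[of 1] m by simp
      then have g: "R (root_refl \<beta> \<alpha>) (As ! (t + m)) = As ! (t + n)"
        using R_step[of m] m by simp
      have "R \<alpha> (R \<beta> (R (root_refl \<beta> \<alpha>) X)) = R \<beta> X" for X
        by (simp add: R_def image_comp comp_def root_refl_root_refl)
      from this[of "As ! (t + m)"] have eq: "R \<alpha> (As ! Suc (t + n)) = R \<beta> (As ! (t + m))"
        using g R_step[of n] last by simp
      have "As' ! j = R \<beta> (As ! (t + m))" using As'[of j] 3 j eq by simp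
      moreover have "As' ! Suc j = R \<beta> (As ! Suc (t + m))"
        using out[of "Suc j"] 3 j q R_step[of n] last m by simp
      moreover have "root_refl \<beta> (- alternating \<alpha> \<beta> m) = - \<Gamma>' ! j"
        using \<Gamma>'mid[of n] 3 \<open>alternating \<alpha> \<beta> m = root_refl \<beta> \<alpha>\<close> by (simp add: root_refl_neg_arg)
      ultimately show ?thesis using R_alcove_step(2)[OF step[of m]] m by simp
    next
      case 4
      then show ?thesis
        using alcove_path_step(1)[OF p j] out[of j] out[of "Suc j"] nth'(4)[of j] j by simp
    qed
  qed
  show thesis
  proof (rule that[of c])
    show "lambda_chain \<Delta> S lam \<Gamma>'"
      unfolding lambda_chain_def
      using p' fin out[of "length \<Gamma>"] len nth'(1) by auto
    show "chain_l \<Delta> S \<Gamma>' j = chain_l \<Delta> S \<Gamma> j" if "j < length \<Gamma>" "j < t \<or> t + q \<le> j" for j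
      using that chain_l_eq[OF p, of j] chain_l_eq[OF p', of j] nth' out[of j] by auto
    fix j assume "t \<le> j" "j < t + q"
    then obtain i where i: "j = t + i" "i \<le> n" using q le_Suc_ex by fastforce
    show "pairing c (\<Gamma> ! j) = - of_int (chain_l \<Delta> S \<Gamma> j)"
      using chain_l_eq[OF p, of j] floor[OF i(2), of i] c[OF i(2)] \<Gamma>[OF i(2)] i n by simp
    have n': "t + Suc n \<le> length \<Gamma>'" using n nth'(1) by simp
    have dist': "\<Gamma>' ! (t + i) \<noteq> \<Gamma>' ! (t + j) \<and> \<Gamma>' ! (t + i) \<noteq> - \<Gamma>' ! (t + j)"
      if "i < Suc n" "j < Suc n" "i \<noteq> j" for i j
      using that dist[of "n - i" "n - j"] by (simp add: \<Gamma>'mid)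
    show "pairing c (\<Gamma>' ! j) = - of_int (chain_l \<Delta> S \<Gamma>' j)"
      using chain_l_eq[OF p', of j] segment_floor[OF p' n' dist', of i i] c[of "n - i"] \<Gamma>'mid[OF i(2)]
        i n' As't by simp
  qed
qed

end

section \<open>Matching by signed counts\<close>

text \<open>Here e is a prevailing sign. The elements of the other sign are matched with a subset M
  of the prevailing ones, the involution exchanges partners, and the unmatched elements form
  C.\<close>

lemma signed_class_cancel_aux:
  fixes s :: "'x \<Rightarrow> int"
  assumes fin: "finite X" and s: "\<And>A. A \<in> X \<Longrightarrow> s A = e \<or> s A = - e" and e: "e = 1 \<or> e = -1"
    and le: "card {A\<in>X. s A = - e} \<le> card {A\<in>X. s A = e}"
  shows "\<exists>C I. C \<subseteq> X \<and> (\<forall>A\<in>C. s A = e) \<and> int (card C) = e * (\<Sum>A\<in>X. s A) \<and>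
    (\<forall>A\<in>X - C. I A \<in> X - C \<and> I (I A) = A \<and> s (I A) = - s A)"
proof -
  let ?P = "{A\<in>X. s A = e}" and ?N = "{A\<in>X. s A = - e}"
  have disj: "?P \<inter> ?N = {}" using e by auto
  obtain M where M: "M \<subseteq> ?P" "card M = card ?N" using obtain_subset_with_card_n[OF le] by metis
  have finM: "finite M" "finite ?N" using fin M finite_subset[of M X] by auto
  obtain h where h: "bij_betw h M ?N" using finite_same_card_bij[OF finM M(2)] by blast
  define I where "I A = (if A \<in> M then h A else inv_into M h A)" for A
  have "(\<Sum>A\<in>X. s A) = (\<Sum>A\<in>?P. s A) + (\<Sum>A\<in>?N. s A)"
    using fin s disj by (subst sum.union_disjoint[symmetric]) (auto intro!: sum.cong)
  also have "\<dots> = e * (int (card ?P) - int (card ?N))" by (simp add: algebra_simps)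
  finally have "e * (\<Sum>A\<in>X. s A) = int (card ?P) - int (card ?N)" using e by auto
  moreover have "int (card (?P - M)) = int (card ?P) - int (card ?N)"
    using M finM le by (simp add: card_Diff_subset of_nat_diff)
  moreover have "I A \<in> X - (?P - M) \<and> I (I A) = A \<and> s (I A) = - s A" if A: "A \<in> X - (?P - M)" for A
  proof (cases "A \<in> M")
    case True
    then have hA: "h A \<in> ?N" using bij_betwE[OF h] by simp
    then have "h A \<notin> M" using M disj by blast
    then have "I (I A) = A" using True h by (simp add: I_def bij_betw_inv_into_left)
    then show ?thesis using True hA M e by (auto simp: I_def)
  next
    case False
    then have AN: "A \<in> ?N" using A s by auto
    then have inv: "inv_into M h A \<in> M" "h (inv_into M h A) = A"
      using h by (auto simp: bij_betw_def inv_into_into f_inv_into_f)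
    then show ?thesis using False AN M by (auto simp: I_def)
  qed
  ultimately show ?thesis by (intro exI[of _ "?P - M"] exI[of _ I]) auto
qed

text \<open>Sign and size of the leftover set C are determined by the signed sum alone, so equal
  sums leave sets that can be matched.\<close>

lemma signed_class_cancel:
  fixes s :: "'x \<Rightarrow> int"
  assumes fin: "finite X" and s: "\<And>A. A \<in> X \<Longrightarrow> s A = 1 \<or> s A = - 1"
  shows "\<exists>C I. C \<subseteq> X \<and> (\<forall>A\<in>C. s A = sgn (\<Sum>A\<in>X. s A)) \<and> int (card C) = \<bar>\<Sum>A\<in>X. s A\<bar> \<and>
    (\<forall>A\<in>X - C. I A \<in> X - C \<and> I (I A) = A \<and> s (I A) = - s A)"
proof -
  obtain e C I where e: "e = 1 \<or> e = (-1::int)" and C: "C \<subseteq> X" "\<forall>A\<in>C. s A = e"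
    "int (card C) = e * (\<Sum>A\<in>X. s A)"
    "\<forall>A\<in>X - C. I A \<in> X - C \<and> I (I A) = A \<and> s (I A) = - s A"
  proof (cases "card {A\<in>X. s A = - 1} \<le> card {A\<in>X. s A = 1}")
    case True
    have "\<exists>C I. C \<subseteq> X \<and> (\<forall>A\<in>C. s A = 1) \<and> int (card C) = 1 * (\<Sum>A\<in>X. s A) \<and>
      (\<forall>A\<in>X - C. I A \<in> X - C \<and> I (I A) = A \<and> s (I A) = - s A)"
      by (rule signed_class_cancel_aux[OF fin s _ True]) simp_all
    then show ?thesis using that[of 1] by blast
  next
    case False
    have s': "s A = - 1 \<or> s A = - (- 1)" if "A \<in> X" for A using s[OF that] by auto
    have le: "card {A\<in>X. s A = - (- 1)} \<le> card {A\<in>X. s A = - 1}" using False by simp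
    have "\<exists>C I. C \<subseteq> X \<and> (\<forall>A\<in>C. s A = - 1) \<and> int (card C) = - 1 * (\<Sum>A\<in>X. s A) \<and>
      (\<forall>A\<in>X - C. I A \<in> X - C \<and> I (I A) = A \<and> s (I A) = - s A)"
      by (rule signed_class_cancel_aux[OF fin s' _ le]) simp_all
    then show ?thesis using that[of "-1"] by blast
  qed
  have "sgn (\<Sum>A\<in>X. s A) = e" if "A \<in> C" for A
  proof -
    have "card C > 0" using that C(1) fin finite_subset card_gt_0_iff by blast
    then have "e * (\<Sum>A\<in>X. s A) > 0" using C(3) by linarith
    then show ?thesis using e by (auto simp: zero_less_mult_iff)
  qed
  moreover have "\<bar>\<Sum>A\<in>X. s A\<bar> = e * (\<Sum>A\<in>X. s A)" using e C(3) by auto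
  ultimately show ?thesis using C by (intro exI[of _ C] exI[of _ I]) auto
qed

text \<open>The cancellation is done separately for each value of the key, so the involutions and
  the bijection respect the key.\<close>

lemma signed_matching:
  fixes s1 :: "'x \<Rightarrow> int" and s2 :: "'y \<Rightarrow> int" and k1 :: "'x \<Rightarrow> 'k" and k2 :: "'y \<Rightarrow> 'k"
  assumes fin: "finite X1" "finite X2"
    and s1: "\<And>A. A \<in> X1 \<Longrightarrow> s1 A = 1 \<or> s1 A = - 1"
    and s2: "\<And>A. A \<in> X2 \<Longrightarrow> s2 A = 1 \<or> s2 A = - 1"
    and eq: "\<And>k. (\<Sum>A\<in>{A\<in>X1. k1 A = k}. s1 A) = (\<Sum>A\<in>{A\<in>X2. k2 A = k}. s2 A)"
  obtains C1 C2 Y I1 I2 where "C1 \<subseteq> X1" "C2 \<subseteq> X2" "bij_betw Y C1 C2"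
    "\<And>A. A \<in> C1 \<Longrightarrow> k2 (Y A) = k1 A \<and> s2 (Y A) = s1 A"
    "\<And>A. A \<in> X1 - C1 \<Longrightarrow> I1 A \<in> X1 - C1 \<and> I1 (I1 A) = A \<and> k1 (I1 A) = k1 A \<and> s1 (I1 A) = - s1 A"
    "\<And>A. A \<in> X2 - C2 \<Longrightarrow> I2 A \<in> X2 - C2 \<and> I2 (I2 A) = A \<and> k2 (I2 A) = k2 A \<and> s2 (I2 A) = - s2 A"
proof -
  define F1 where "F1 k = {A\<in>X1. k1 A = k}" for k
  define F2 where "F2 k = {A\<in>X2. k2 A = k}" for k
  let ?t = "\<lambda>k. \<Sum>A\<in>F1 k. s1 A"
  have fF: "finite (F1 k)" "finite (F2 k)" for k using fin by (auto simp: F1_def F2_def)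
  have sF: "A \<in> F1 k \<Longrightarrow> s1 A = 1 \<or> s1 A = - 1" "B \<in> F2 k \<Longrightarrow> s2 B = 1 \<or> s2 B = - 1" for A B k
    using s1 s2 by (auto simp: F1_def F2_def)
  have t2: "(\<Sum>A\<in>F2 k. s2 A) = ?t k" for k using eq by (simp add: F1_def F2_def)
  define Q1 where "Q1 k C I \<longleftrightarrow> C \<subseteq> F1 k \<and> (\<forall>A\<in>C. s1 A = sgn (?t k)) \<and> int (card C) = \<bar>?t k\<bar> \<and>
    (\<forall>A\<in>F1 k - C. I A \<in> F1 k - C \<and> I (I A) = A \<and> s1 (I A) = - s1 A)" for k C I
  have "\<exists>C I. Q1 k C I" for k
    unfolding Q1_def by (rule signed_class_cancel[OF fF(1)[of k]]) (rule sF(1))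
  then obtain C1 I1 where "\<And>k. Q1 k (C1 k) (I1 k)" by metis
  note q1 = this[unfolded Q1_def]
  have 1: "C1 k \<subseteq> F1 k" "A \<in> C1 k \<Longrightarrow> s1 A = sgn (?t k)" "int (card (C1 k)) = \<bar>?t k\<bar>"
    "A \<in> F1 k - C1 k \<Longrightarrow> I1 k A \<in> F1 k - C1 k \<and> I1 k (I1 k A) = A \<and> s1 (I1 k A) = - s1 A"
    for k A
    using q1[of k] by simp_all
  define Q2 where "Q2 k C I \<longleftrightarrow> C \<subseteq> F2 k \<and> (\<forall>A\<in>C. s2 A = sgn (?t k)) \<and> int (card C) = \<bar>?t k\<bar> \<and>
    (\<forall>A\<in>F2 k - C. I A \<in> F2 k - C \<and> I (I A) = A \<and> s2 (I A) = - s2 A)" for k C I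
  have "\<exists>C I. Q2 k C I" for k
    unfolding Q2_def by (rule signed_class_cancel[OF fF(2)[of k], of s2, unfolded t2]) (rule sF(2))
  then obtain C2 I2 where "\<And>k. Q2 k (C2 k) (I2 k)" by metis
  note q2 = this[unfolded Q2_def]
  have 2: "C2 k \<subseteq> F2 k" "A \<in> C2 k \<Longrightarrow> s2 A = sgn (?t k)" "int (card (C2 k)) = \<bar>?t k\<bar>"
    "A \<in> F2 k - C2 k \<Longrightarrow> I2 k A \<in> F2 k - C2 k \<and> I2 k (I2 k A) = A \<and> s2 (I2 k A) = - s2 A"
    for k A
    using q2[of k] by simp_all
  have "\<exists>Y. bij_betw Y (C1 k) (C2 k)" for k
  proof (rule finite_same_card_bij)
    show "finite (C1 k)" "finite (C2 k)" 
      by (rule finite_subset[OF 1(1) fF(1)], rule finite_subset[OF 2(1) fF(2)])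
    show "card (C1 k) = card (C2 k)" using 1(3)[of k] 2(3)[of k] by simp
  qed
  then obtain Y where Y: "\<And>k. bij_betw (Y k) (C1 k) (C2 k)" by metis
  have in1: "A \<in> C1 k \<Longrightarrow> A \<in> X1 \<and> k1 A = k" for A k using 1(1)[of k] by (auto simp: F1_def)
  have in2: "A \<in> C2 k \<Longrightarrow> A \<in> X2 \<and> k2 A = k" for A k using 2(1)[of k] by (auto simp: F2_def)
  have YC: "A \<in> C1 k \<Longrightarrow> Y k A \<in> C2 k" for A k using bij_betwE[OF Y[of k]] by simp
  show thesis
  proof (rule that)
    let ?C1 = "{A\<in>X1. A \<in> C1 (k1 A)}" and ?C2 = "{A\<in>X2. A \<in> C2 (k2 A)}"
    show "?C1 \<subseteq> X1" "?C2 \<subseteq> X2" by auto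
    show "bij_betw (\<lambda>A. Y (k1 A) A) ?C1 ?C2"
      unfolding bij_betw_def
    proof
      show "inj_on (\<lambda>A. Y (k1 A) A) ?C1"
      proof (rule inj_onI)
        fix A B assume AB: "A \<in> ?C1" "B \<in> ?C1" "Y (k1 A) A = Y (k1 B) B"
        then have "k1 A = k1 B" using YC in2 by (metis (no_types, lifting) mem_Collect_eq)
        then show "A = B" using AB Y[of "k1 A"] by (auto simp: bij_betw_def inj_on_def)
      qed
      show "(\<lambda>A. Y (k1 A) A) ` ?C1 = ?C2"
      proof
        show "(\<lambda>A. Y (k1 A) A) ` ?C1 \<subseteq> ?C2" using YC in2 by fastforce
        show "?C2 \<subseteq> (\<lambda>A. Y (k1 A) A) ` ?C1"
        proof
          fix B assume B: "B \<in> ?C2"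
          then obtain A where A: "A \<in> C1 (k2 B)" "Y (k2 B) A = B"
            using Y[of "k2 B"] by (auto simp: bij_betw_def image_iff) (metis image_iff)
          then have "A \<in> ?C1" "k1 A = k2 B" using in1 by auto
          then show "B \<in> (\<lambda>A. Y (k1 A) A) ` ?C1" using A by (metis (no_types, lifting) image_eqI)
        qed
      qed
    qed
    show "k2 (Y (k1 A) A) = k1 A \<and> s2 (Y (k1 A) A) = s1 A" if "A \<in> ?C1" for A
      using that YC in2 1(2) 2(2) by (metis (no_types, lifting) mem_Collect_eq)
    show "I1 (k1 A) A \<in> X1 - ?C1 \<and> I1 (k1 (I1 (k1 A) A)) (I1 (k1 A) A) = A \<and>
      k1 (I1 (k1 A) A) = k1 A \<and> s1 (I1 (k1 A) A) = - s1 A" if "A \<in> X1 - ?C1" for A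
      using that 1(4)[of A "k1 A"] by (auto simp: F1_def)
    show "I2 (k2 A) A \<in> X2 - ?C2 \<and> I2 (k2 (I2 (k2 A) A)) (I2 (k2 A) A) = A \<and>
      k2 (I2 (k2 A) A) = k2 A \<and> s2 (I2 (k2 A) A) = - s2 A" if "A \<in> X2 - ?C2" for A
      using that 2(4)[of A "k2 A"] by (auto simp: F2_def)
  qed
qed

section \<open>Walks\<close>

lemma sorted_list_of_set_Int_Suc:
  "sorted_list_of_set (A \<inter> {..<Suc m}) = sorted_list_of_set (A \<inter> {..<m}) @ (if m \<in> A then [m] else [])"
proof (cases "m \<in> A")
  case True
  then have "A \<inter> {..<Suc m} = insert m (A \<inter> {..<m})" by (auto simp: less_Suc_eq)
  then have "sorted_list_of_set (A \<inter> {..<Suc m}) = sorted_list_of_set (A \<inter> {..<m}) @ [m]"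
    by (subst sorted_list_of_set_unique[symmetric]) (auto simp: sorted_wrt_append)
  then show ?thesis using True by simp
next
  case False
  then have "A \<inter> {..<Suc m} = A \<inter> {..<m}" by (auto simp: less_Suc_eq)
  then show ?thesis using False by simp
qed

lemma root_refl_root_abs: "root_refl (root_abs \<Delta> S \<gamma>) = root_refl \<gamma>"
  by (simp add: root_abs_def root_sgn_def root_refl_uminus)

lemma coroot_root_abs: "coroot (root_abs \<Delta> S \<gamma>) = root_sgn \<Delta> S \<gamma> *\<^sub>R coroot \<gamma>"
  by (simp add: root_abs_def root_sgn_def coroot_uminus)

lemma walk_0 [simp]: "walk \<Delta> S w \<Gamma> A 0 = w"
  by (simp add: walk_def)

lemma walk_Suc:
  "walk \<Delta> S w \<Gamma> A (Suc m) =
   (if m \<in> A then walk \<Delta> S w \<Gamma> A m \<circ> root_refl (\<Gamma> ! m) else walk \<Delta> S w \<Gamma> A m)"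
  unfolding walk_def sorted_list_of_set_Int_Suc by (simp add: root_refl_root_abs)

lemma walk_cong_first:
  assumes "\<And>j. j < t \<Longrightarrow> j \<in> A \<longleftrightarrow> j \<in> A'" "\<And>j. j < t \<Longrightarrow> \<Gamma> ! j = \<Gamma>' ! j" "m \<le> t"
  shows "walk \<Delta> S w \<Gamma> A m = walk \<Delta> S w \<Gamma>' A' m"
  using assms(3) by (induction m) (use assms(1,2) in \<open>auto simp: walk_Suc\<close>)

text \<open>The walk restarted at x in position m. It does not depend on the part of A before m,
  which separates the steps after the string from those inside it.\<close>

fun steps :: "'a::euclidean_space list \<Rightarrow> nat set \<Rightarrow> nat \<Rightarrow> ('a \<Rightarrow> 'a) \<Rightarrow> nat \<Rightarrow> 'a \<Rightarrow> 'a" where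
  "steps \<Gamma> A m x 0 = x"
| "steps \<Gamma> A m x (Suc i) =
     (if m + i \<in> A then steps \<Gamma> A m x i \<circ> root_refl (\<Gamma> ! (m + i)) else steps \<Gamma> A m x i)"

lemma walk_steps: "walk \<Delta> S w \<Gamma> A (m + i) = steps \<Gamma> A m (walk \<Delta> S w \<Gamma> A m) i"
  by (induction i) (simp_all add: walk_Suc o_def)

lemma steps_comp: "steps \<Gamma> A m x i = x \<circ> steps \<Gamma> A m id i"
  by (induction i) (simp_all add: o_def)

lemma steps_cong:
  assumes "\<And>j. m \<le> j \<Longrightarrow> j < m + i \<Longrightarrow> j \<in> A \<longleftrightarrow> j \<in> A'"
    "\<And>j. m \<le> j \<Longrightarrow> j < m + i \<Longrightarrow> j \<in> A \<Longrightarrow> \<Gamma> ! j = \<Gamma>' ! j"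
  shows "steps \<Gamma> A m x i = steps \<Gamma>' A' m x i"
  using assms by (induction i) auto

text \<open>The expansion of the product of operators over the subsets J of the segment. In the
  induction the first position, if used, is moved from J to the fixed part
  \<open>A0\<close>.\<close>

lemma psum_subsets:
  fixes c :: "('a::euclidean_space \<Rightarrow> 'a) \<Rightarrow> 'a \<Rightarrow> real"
  assumes "A0 \<subseteq> {..<a}"
  shows "(\<Sum>J\<in>Pow {a..<a + n}. (\<Prod>j\<in>J. c (walk \<Delta> S w \<Gamma> (A0 \<union> J) j) (\<Gamma> ! j)) *
      f (walk \<Delta> S w \<Gamma> (A0 \<union> J) (a + n))) =
    psum c (map ((!) \<Gamma>) [a..<a + n]) f (walk \<Delta> S w \<Gamma> A0 a)"
  using assms
proof (induction n arbitrary: a A0)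
  case (Suc n)
  let ?x = "walk \<Delta> S w \<Gamma> A0 a"
  let ?g = "\<lambda>B J. (\<Prod>j\<in>J. c (walk \<Delta> S w \<Gamma> (B \<union> J) j) (\<Gamma> ! j)) * f (walk \<Delta> S w \<Gamma> (B \<union> J) (Suc a + n))"
  have ivl: "{a..<a + Suc n} = insert a {Suc a..<Suc a + n}" by auto
  have a_nin: "a \<notin> J" if "J \<in> Pow {Suc a..<Suc a + n}" for J using that by auto
  have first: "walk \<Delta> S w \<Gamma> B a = ?x" if "\<And>j. j < a \<Longrightarrow> j \<in> B \<longleftrightarrow> j \<in> A0" for B
    by (rule walk_cong_first[where t = a]) (use that in auto)
  have ins: "?g A0 (insert a J) = c ?x (\<Gamma> ! a) * ?g (insert a A0) J"
    if J: "J \<in> Pow {Suc a..<Suc a + n}" for J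
  proof -
    have "finite J" using J finite_subset by auto
    moreover have "walk \<Delta> S w \<Gamma> (A0 \<union> insert a J) a = ?x" by (rule first) (use J in auto)
    ultimately show ?thesis using a_nin[OF J] by (simp add: mult.assoc)
  qed
  have "(\<Sum>J\<in>Pow {a..<a + Suc n}. ?g A0 J) =
      (\<Sum>J\<in>Pow {Suc a..<Suc a + n}. ?g A0 J) + (\<Sum>J\<in>insert a ` Pow {Suc a..<Suc a + n}. ?g A0 J)"
    unfolding ivl Pow_insert using a_nin by (intro sum.union_disjoint) auto
  also have "(\<Sum>J\<in>insert a ` Pow {Suc a..<Suc a + n}. ?g A0 J) =
      (\<Sum>J\<in>Pow {Suc a..<Suc a + n}. ?g A0 (insert a J))"
    by (rule sum.reindex_cong[OF _ refl refl]) (rule inj_onI, metis a_nin insert_ident)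
  also have "\<dots> = c ?x (\<Gamma> ! a) * (\<Sum>J\<in>Pow {Suc a..<Suc a + n}. ?g (insert a A0) J)"
    unfolding sum_distrib_left by (rule sum.cong[OF refl ins])
  also have "(\<Sum>J\<in>Pow {Suc a..<Suc a + n}. ?g (insert a A0) J) =
      psum c (map ((!) \<Gamma>) [Suc a..<Suc a + n]) f (walk \<Delta> S w \<Gamma> (insert a A0) (Suc a))"
    by (rule Suc.IH) (use Suc.prems in auto)
  also have "walk \<Delta> S w \<Gamma> (insert a A0) (Suc a) = ?x \<circ> root_refl (\<Gamma> ! a)"
    using first[of "insert a A0"] by (simp add: walk_Suc)
  also have "(\<Sum>J\<in>Pow {Suc a..<Suc a + n}. ?g A0 J) =
      psum c (map ((!) \<Gamma>) [Suc a..<Suc a + n]) f (walk \<Delta> S w \<Gamma> A0 (Suc a))"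
    by (rule Suc.IH) (use Suc.prems in auto)
  also have "walk \<Delta> S w \<Gamma> A0 (Suc a) = ?x" using Suc.prems by (auto simp: walk_Suc)
  finally show ?case by (simp add: upt_conv_Cons o_def del: upt_Suc)
qed simp

section \<open>Amplitudes of admissible subsets\<close>

text \<open>Grouping by degree gives an exponential sum that vanishes for all \<mu>, so its
  coefficients vanish.\<close>

lemma graded_sums_eq:
  fixes s1 :: "'x \<Rightarrow> int" and s2 :: "'y \<Rightarrow> int" and d1 :: "'x \<Rightarrow> 'a::euclidean_space"
  assumes fin: "finite X1" "finite X2"
    and eq: "\<And>\<mu>. (\<Sum>A\<in>X1. of_int (s1 A) * exp (\<mu> \<bullet> d1 A)) = (\<Sum>A\<in>X2. of_int (s2 A) * exp (\<mu> \<bullet> d2 A) :: real)"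
  shows "(\<Sum>A\<in>{A\<in>X1. d1 A = d}. s1 A) = (\<Sum>A\<in>{A\<in>X2. d2 A = d}. s2 A)"
proof -
  \<comment> \<open>Inserting d also covers a degree that occurs on neither side.\<close>
  let ?D = "insert d (d1 ` X1 \<union> d2 ` X2)"
  define c1 where "c1 d = (\<Sum>A\<in>{A\<in>X1. d1 A = d}. s1 A)" for d
  define c2 where "c2 d = (\<Sum>A\<in>{A\<in>X2. d2 A = d}. s2 A)" for d
  have D: "finite ?D" using fin by simp
  have g1: "(\<Sum>d\<in>?D. of_int (c1 d) * exp (\<mu> \<bullet> d)) = (\<Sum>A\<in>X1. of_int (s1 A) * exp (\<mu> \<bullet> d1 A) :: real)" for \<mu>
    by (subst sum.group[OF fin(1) D, of d1, symmetric]) (auto simp: c1_def sum_distrib_right intro!: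
        sum.cong)
  have g2: "(\<Sum>d\<in>?D. of_int (c2 d) * exp (\<mu> \<bullet> d)) = (\<Sum>A\<in>X2. of_int (s2 A) * exp (\<mu> \<bullet> d2 A) :: real)" for \<mu>
    by (subst sum.group[OF fin(2) D, of d2, symmetric]) (auto simp: c2_def sum_distrib_right intro!:
        sum.cong)
  have "(\<Sum>d\<in>?D. (of_int (c1 d) - of_int (c2 d)) * exp (\<mu> \<bullet> d)) = (0::real)" for \<mu>
    unfolding left_diff_distrib sum_subtractf g1 g2 using eq by simp
  from exp_inner_independent[OF D this, of d] have "real_of_int (c1 d) - of_int (c2 d) = 0" by simp
  then have "c1 d = c2 d" by simp
  then show ?thesis by (simp add: c1_def c2_def)
qed

context based_root_system
begin

lemma walk_weyl: "w \<in> W \<Longrightarrow> (\<And>j. j < m \<Longrightarrow> \<Gamma> ! j \<in> \<Delta>) \<Longrightarrow> walk \<Delta> S w \<Gamma> A m \<in> W"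
  by (induction m) (simp_all add: walk_Suc weyl_refl del: o_apply)

text \<open>An edge is never both Bruhat and quantum, because the pairing of \<rho> with a positive
  root is at least 1; so at most one term of the sum remains.\<close>

lemma quantum_coef_edge:
  "quantum_coef \<mu> x \<gamma> =
   (if qbg_edge \<Delta> S x (root_abs \<Delta> S \<gamma>) (x \<circ> root_refl \<gamma>)
    then root_sgn \<Delta> S \<gamma> * exp (\<mu> \<bullet> (if quantum_edge \<Delta> S x (root_abs \<Delta> S \<gamma>) (x \<circ> root_refl \<gamma>)
      then coroot (root_abs \<Delta> S \<gamma>) else 0))
    else 0)"
proof -
  have "\<not> (bruhat_edge \<Delta> S x (root_abs \<Delta> S \<gamma>) y \<and> quantum_edge \<Delta> S x (root_abs \<Delta> S \<gamma>) y)" for y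
    using weyl_vector_pairing_ge unfolding bruhat_edge_def quantum_edge_def by fastforce
  then show ?thesis by (auto simp: quantum_coef_def qbg_edge_def)
qed

definition amplitude :: "'a \<Rightarrow> ('a \<Rightarrow> 'a) \<Rightarrow> 'a list \<Rightarrow> nat set \<Rightarrow> real" where
  "amplitude \<mu> w \<Gamma> A = (\<Prod>j\<in>A. quantum_coef \<mu> (walk \<Delta> S w \<Gamma> A j) (\<Gamma> ! j))"

text \<open>A subset of the positions that is not admissible contains a step that is no edge, and
  this factor is 0.\<close>

lemma amplitude_eq:
  assumes A: "A \<subseteq> {..<length \<Gamma>}" and \<Gamma>: "\<And>j. j < length \<Gamma> \<Longrightarrow> \<Gamma> ! j \<in> \<Delta>"
  shows "amplitude \<mu> w \<Gamma> A = (if A \<in> admissible \<Delta> S w \<Gamma>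
    then of_int ((-1) ^ neg_count \<Delta> S \<Gamma> A) * exp (\<mu> \<bullet> adm_down \<Delta> S w \<Gamma> A) else 0)"
proof -
  have fin: "finite A" using A finite_subset by blast
  let ?x = "walk \<Delta> S w \<Gamma> A" and ?abs = "root_abs \<Delta> S"
  have suc: "?x (Suc j) = ?x j \<circ> root_refl (\<Gamma> ! j)" if "j \<in> A" for j using that by (simp add:
      walk_Suc o_def)
  have adm: "A \<in> admissible \<Delta> S w \<Gamma> \<longleftrightarrow>
      (\<forall>j\<in>A. qbg_edge \<Delta> S (?x j) (?abs (\<Gamma> ! j)) (?x j \<circ> root_refl (\<Gamma> ! j)))"
    using A suc by (auto simp: admissible_def simp del: o_apply)
  show ?thesis
  proof (cases "A \<in> admissible \<Delta> S w \<Gamma>")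
    case False
    then obtain j where "j \<in> A" "quantum_coef \<mu> (?x j) (\<Gamma> ! j) = 0"
      unfolding adm quantum_coef_edge by auto
    then show ?thesis using False fin by (auto simp: amplitude_def)
  next
    case True
    let ?q = "\<lambda>j. quantum_edge \<Delta> S (?x j) (?abs (\<Gamma> ! j)) (?x (Suc j))"
    have "amplitude \<mu> w \<Gamma> A = (\<Prod>j\<in>A. root_sgn \<Delta> S (\<Gamma> ! j) *
        exp (\<mu> \<bullet> (if ?q j then coroot (?abs (\<Gamma> ! j)) else 0)))"
      unfolding amplitude_def
      by (rule prod.cong[OF refl]) (use True adm suc in \<open>simp add: quantum_coef_edge del: o_apply\<close>)
    also have "\<dots> = (\<Prod>j\<in>A. root_sgn \<Delta> S (\<Gamma> ! j)) *
        exp (\<mu> \<bullet> (\<Sum>j\<in>A. if ?q j then coroot (?abs (\<Gamma> ! j)) else 0))"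
      by (simp only: prod.distrib exp_sum[OF fin] inner_sum_right)
    also have "(\<Sum>j\<in>A. if ?q j then coroot (?abs (\<Gamma> ! j)) else 0) = adm_down \<Delta> S w \<Gamma> A"
      unfolding adm_down_def quantum_steps_def using fin by (rule sum.inter_filter[symmetric])
    also have "(\<Prod>j\<in>A. root_sgn \<Delta> S (\<Gamma> ! j)) =
        (\<Prod>j\<in>A. if \<Gamma> ! j \<in> uminus ` Pos then - 1 else 1)"
    proof (rule prod.cong[OF refl])
      fix j assume "j \<in> A"
      then have "\<Gamma> ! j \<in> \<Delta>" using A \<Gamma> by auto
      then have "\<Gamma> ! j \<in> uminus ` Pos \<longleftrightarrow> \<Gamma> ! j \<notin> Pos"
        using neg_root_iff[of "\<Gamma> ! j"] by (metis image_iff minus_minus)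
      then show "root_sgn \<Delta> S (\<Gamma> ! j) = (if \<Gamma> ! j \<in> uminus ` Pos then - 1 else 1)"
        by (simp add: root_sgn_def)
    qed
    also have "\<dots> = (\<Prod>j\<in>{j\<in>A. \<Gamma> ! j \<in> uminus ` Pos}. - 1)"
      using fin by (rule prod.inter_filter[symmetric])
    also have "\<dots> = of_int ((-1) ^ neg_count \<Delta> S \<Gamma> A)" by (simp add: neg_count_def)
    finally show ?thesis using True by simp
  qed
qed

section \<open>Signed sums with prescribed outer parts\<close>

text \<open>Subsets that are not admissible are included: their amplitude is 0, and the expansion of
  the path sum runs over all subsets of the segment.\<close>

definition fibre :: "('a \<Rightarrow> 'a) \<Rightarrow> 'a list \<Rightarrow> nat \<Rightarrow> nat \<Rightarrow> nat set \<Rightarrow> ('a \<Rightarrow> 'a) \<Rightarrow> nat set \<Rightarrow> nat set set" where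
  "fibre w \<Gamma> t q A1 y A3 = {A. A \<subseteq> {..<length \<Gamma>} \<and> A \<inter> {..<t} = A1 \<and>
     walk \<Delta> S w \<Gamma> A (t + q) = y \<and> A \<inter> {t + q..<length \<Gamma>} = A3}"

lemma finite_fibre: "finite (fibre w \<Gamma> t q A1 y A3)"
  by (rule finite_subset[of _ "Pow {..<length \<Gamma>}"]) (auto simp: fibre_def)

text \<open>Once the vertex y after the string is fixed, the factors of the first and third part do
  not depend on the steps inside the string; the sum over these steps is a path sum with the
  indicator function of y.\<close>

lemma fibre_amplitude:
  assumes tq: "t + q \<le> length \<Gamma>" and A1: "A1 \<subseteq> {..<t}" and A3: "A3 \<subseteq> {t + q..<length \<Gamma>}"
  shows "(\<Sum>A\<in>fibre w \<Gamma> t q A1 y A3. amplitude \<mu> w \<Gamma> A) =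
    (\<Prod>j\<in>A1. quantum_coef \<mu> (walk \<Delta> S w \<Gamma> A1 j) (\<Gamma> ! j)) *
    (\<Prod>j\<in>A3. quantum_coef \<mu> (steps \<Gamma> A3 (t + q) y (j - (t + q))) (\<Gamma> ! j)) *
    psum (quantum_coef \<mu>) (map ((!) \<Gamma>) [t..<t + q]) (\<lambda>z. of_bool (z = y)) (walk \<Delta> S w \<Gamma> A1 t)"
    (is "_ = ?p1 * ?p3 * _")
proof -
  let ?walk = "walk \<Delta> S w \<Gamma>" and ?c = "quantum_coef \<mu>"
  let ?B = "{J\<in>Pow {t..<t + q}. ?walk (A1 \<union> J) (t + q) = y}"
  let ?p2 = "\<lambda>J. \<Prod>j\<in>J. ?c (?walk (A1 \<union> J) j) (\<Gamma> ! j)"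
  have walk2: "?walk (A1 \<union> J \<union> A3) j = ?walk (A1 \<union> J) j" if "j \<le> t + q" for J j
    by (rule walk_cong_first[OF _ refl that]) (use A3 in auto)
  have walk1: "?walk (A1 \<union> J \<union> A3) j = ?walk A1 j" if "J \<subseteq> {t..<t + q}" "j \<le> t" for J j
    by (rule walk_cong_first[OF _ refl that(2)]) (use A3 that in auto)
  have amp: "amplitude \<mu> w \<Gamma> (A1 \<union> J \<union> A3) = ?p1 * ?p2 J * ?p3" if J: "J \<in> ?B" for J
  proof -
    have fin: "finite A1" "finite J" "finite A3" using A1 A3 J finite_subset by auto
    have JS: "J \<subseteq> {t..<t + q}" using J by auto
    have m1: "x < t" if "x \<in> A1" for x using that A1 by auto
    have m2: "t \<le> x \<and> x < t + q" if "x \<in> J" for x using that J by auto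
    have m3: "t + q \<le> x" if "x \<in> A3" for x using that A3 by auto
    have disj: "A1 \<inter> J = {}" "(A1 \<union> J) \<inter> A3 = {}"
    proof -
      have "x \<notin> J" if "x \<in> A1" for x using m1[OF that] m2[of x] by linarith
      then show "A1 \<inter> J = {}" by blast
      have "x \<notin> A1 \<union> J" if "x \<in> A3" for x using m1[of x] m2[of x] m3[OF that] by fastforce
      then show "(A1 \<union> J) \<inter> A3 = {}" by blast
    qed
    have "amplitude \<mu> w \<Gamma> (A1 \<union> J \<union> A3) =
        (\<Prod>j\<in>A1. ?c (?walk (A1 \<union> J \<union> A3) j) (\<Gamma> ! j)) * (\<Prod>j\<in>J. ?c (?walk (A1 \<union> J \<union> A3) j) (\<Gamma> ! j)) *
        (\<Prod>j\<in>A3. ?c (?walk (A1 \<union> J \<union> A3) j) (\<Gamma> ! j))"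
      unfolding amplitude_def prod.union_disjoint[OF finite_UnI[OF fin(1,2)] fin(3) disj(2)]
        prod.union_disjoint[OF fin(1,2) disj(1)] ..
    also have "(\<Prod>j\<in>A1. ?c (?walk (A1 \<union> J \<union> A3) j) (\<Gamma> ! j)) = ?p1"
      by (rule prod.cong[OF refl]) (simp only: walk1[OF JS less_imp_le[OF m1]])
    also have "(\<Prod>j\<in>J. ?c (?walk (A1 \<union> J \<union> A3) j) (\<Gamma> ! j)) = ?p2 J"
      by (rule prod.cong[OF refl]) (simp only: walk2[OF less_imp_le[OF conjunct2[OF m2]]])
    also have "(\<Prod>j\<in>A3. ?c (?walk (A1 \<union> J \<union> A3) j) (\<Gamma> ! j)) = ?p3"
    proof (rule prod.cong[OF refl])
      fix j assume "j \<in> A3"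
      then have "t + q \<le> j" by (rule m3)
      then obtain i where i: "j = t + q + i" using le_Suc_ex by blast
      have "?walk (A1 \<union> J \<union> A3) j = steps \<Gamma> (A1 \<union> J \<union> A3) (t + q) y i"
        unfolding i walk_steps[where m = "t + q" and i = i] using walk2[of "t + q"] J by simp
      also have "\<dots> = steps \<Gamma> A3 (t + q) y i"
        by (rule steps_cong) (use m1 m2 in \<open>fastforce+\<close>)
      finally show "?c (?walk (A1 \<union> J \<union> A3) j) (\<Gamma> ! j) = ?c (steps \<Gamma> A3 (t + q) y (j - (t + q))) (\<Gamma> ! j)"
        using i by simp
    qed
    finally show ?thesis .
  qed
  have "(\<Sum>A\<in>fibre w \<Gamma> t q A1 y A3. amplitude \<mu> w \<Gamma> A) = (\<Sum>J\<in>?B. amplitude \<mu> w \<Gamma> (A1 \<union> J \<union> A3))"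
  proof (rule sum.reindex_bij_witness[of _ "\<lambda>J. A1 \<union> J \<union> A3" "\<lambda>A. A \<inter> {t..<t + q}"])
    fix A assume A: "A \<in> fibre w \<Gamma> t q A1 y A3"
    then have A': "A1 = A \<inter> {..<t}" "A3 = A \<inter> {t + q..<length \<Gamma>}" "A \<subseteq> {..<length \<Gamma>}"
      by (simp_all add: fibre_def)
    show eq: "A1 \<union> (A \<inter> {t..<t + q}) \<union> A3 = A"
      unfolding A'(1,2) using A'(3) by auto
    show "A \<inter> {t..<t + q} \<in> ?B"
      using A walk2[of "t + q" "A \<inter> {t..<t + q}"] eq by (auto simp: fibre_def)
    show "amplitude \<mu> w \<Gamma> (A1 \<union> (A \<inter> {t..<t + q}) \<union> A3) = amplitude \<mu> w \<Gamma> A" using eq by simp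
  next
    fix J assume J: "J \<in> ?B"
    have m1: "x < t" if "x \<in> A1" for x using that A1 by auto
    have m2: "t \<le> x" "x < t + q" if "x \<in> J" for x using that J by auto
    have m3: "t + q \<le> x" "x < length \<Gamma>" if "x \<in> A3" for x using that A3 by auto
    show "(A1 \<union> J \<union> A3) \<inter> {t..<t + q} = J"
    proof (rule set_eqI)
      show "x \<in> (A1 \<union> J \<union> A3) \<inter> {t..<t + q} \<longleftrightarrow> x \<in> J" for x
        using m1[of x] m2[of x] m3[of x] by auto
    qed
    have "x \<in> (A1 \<union> J \<union> A3) \<inter> {..<t} \<longleftrightarrow> x \<in> A1" for x
      using m1[of x] m2[of x] m3[of x] by auto
    moreover have "x \<in> (A1 \<union> J \<union> A3) \<inter> {t + q..<length \<Gamma>} \<longleftrightarrow> x \<in> A3" for x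
      using m1[of x] m2[of x] m3[of x] by auto
    moreover have "x < length \<Gamma>" if "x \<in> A1 \<union> J \<union> A3" for x
      using m1[of x] m2[of x] m3[of x] tq that by auto
    ultimately show "A1 \<union> J \<union> A3 \<in> fibre w \<Gamma> t q A1 y A3"
      using J walk2[of "t + q" J] unfolding fibre_def by blast
  qed
  also have "\<dots> = (\<Sum>J\<in>?B. ?p1 * ?p3 * ?p2 J)" by (rule sum.cong[OF refl]) (simp add: amp)
  also have "\<dots> = ?p1 * ?p3 * (\<Sum>J\<in>?B. ?p2 J)" by (simp add: sum_distrib_left)
  also have "(\<Sum>J\<in>?B. ?p2 J) = (\<Sum>J\<in>Pow {t..<t + q}. ?p2 J * of_bool (?walk (A1 \<union> J) (t + q) = y))"
    by (rule sum.mono_neutral_cong_left) auto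
  also have "\<dots> = psum ?c (map ((!) \<Gamma>) [t..<t + q]) (\<lambda>z. of_bool (z = y)) (?walk A1 t)"
    by (rule psum_subsets[OF A1])
  finally show ?thesis .
qed

end

text \<open>Used for the two chains together and for each chain paired with itself, which gives
  weight and height for the involutions.\<close>

locale similar_chains = based_root_system +
  fixes \<Gamma> \<Gamma>' :: "'a list" and t q :: nat and c :: 'a and w :: "'a \<Rightarrow> 'a"
  assumes len: "length \<Gamma>' = length \<Gamma>" and tq: "t + q \<le> length \<Gamma>"
    and roots: "\<And>j. j < length \<Gamma> \<Longrightarrow> \<Gamma> ! j \<in> \<Delta>"
    and roots': "\<And>j. j < length \<Gamma> \<Longrightarrow> \<Gamma>' ! j \<in> \<Delta>"
    and outer: "\<And>j. j < length \<Gamma> \<Longrightarrow> j < t \<or> t + q \<le> j \<Longrightarrow>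
      \<Gamma>' ! j = \<Gamma> ! j \<and> chain_l \<Delta> S \<Gamma>' j = chain_l \<Delta> S \<Gamma> j"
    and center: "\<And>j. t \<le> j \<Longrightarrow> j < t + q \<Longrightarrow> pairing c (\<Gamma> ! j) = - of_int (chain_l \<Delta> S \<Gamma> j)"
    and center': "\<And>j. t \<le> j \<Longrightarrow> j < t + q \<Longrightarrow> pairing c (\<Gamma>' ! j) = - of_int (chain_l \<Delta> S \<Gamma>' j)"
    and w: "w \<in> W"
begin

lemma fibre_amplitude_eq:
  assumes A1: "A1 \<subseteq> {..<t}" and A3: "A3 \<subseteq> {t + q..<length \<Gamma>}"
    and yb: "\<And>f x. x \<in> W \<Longrightarrow> psum (quantum_coef \<mu>) (map ((!) \<Gamma>) [t..<t + q]) f x =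
      psum (quantum_coef \<mu>) (map ((!) \<Gamma>') [t..<t + q]) f x"
  shows "(\<Sum>A\<in>fibre w \<Gamma> t q A1 y A3. amplitude \<mu> w \<Gamma> A) =
    (\<Sum>A\<in>fibre w \<Gamma>' t q A1 y A3. amplitude \<mu> w \<Gamma>' A)"
proof -
  have walk: "walk \<Delta> S w \<Gamma> A1 j = walk \<Delta> S w \<Gamma>' A1 j" if "j \<le> t" for j
    by (rule walk_cong_first[OF refl _ that]) (use outer tq in auto)
  have "(\<Prod>j\<in>A1. quantum_coef \<mu> (walk \<Delta> S w \<Gamma> A1 j) (\<Gamma> ! j)) =
      (\<Prod>j\<in>A1. quantum_coef \<mu> (walk \<Delta> S w \<Gamma>' A1 j) (\<Gamma>' ! j))"
    by (rule prod.cong[OF refl]) (use walk outer tq A1 in \<open>auto simp: subset_iff less_imp_le\<close>)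
  moreover have "(\<Prod>j\<in>A3. quantum_coef \<mu> (steps \<Gamma> A3 (t + q) y (j - (t + q))) (\<Gamma> ! j)) =
      (\<Prod>j\<in>A3. quantum_coef \<mu> (steps \<Gamma>' A3 (t + q) y (j - (t + q))) (\<Gamma>' ! j))"
  proof (rule prod.cong[OF refl])
    fix j assume "j \<in> A3"
    have "steps \<Gamma> A3 (t + q) y (j - (t + q)) = steps \<Gamma>' A3 (t + q) y (j - (t + q))"
      by (rule steps_cong) (use A3 outer in auto)
    then show "quantum_coef \<mu> (steps \<Gamma> A3 (t + q) y (j - (t + q))) (\<Gamma> ! j) =
        quantum_coef \<mu> (steps \<Gamma>' A3 (t + q) y (j - (t + q))) (\<Gamma>' ! j)"
      using \<open>j \<in> A3\<close> A3 outer by auto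
  qed
  moreover have "walk \<Delta> S w \<Gamma>' A1 t \<in> W" by (rule walk_weyl[OF w]) (use roots' tq in auto)
  ultimately show ?thesis
    using fibre_amplitude[OF tq A1 A3] fibre_amplitude[of t q \<Gamma>' A1 A3] len tq A1 A3 walk[of t] yb by simp
qed

lemma signed_count_eq:
  assumes yb: "\<And>\<mu> f x. x \<in> W \<Longrightarrow> psum (quantum_coef \<mu>) (map ((!) \<Gamma>) [t..<t + q]) f x =
      psum (quantum_coef \<mu>) (map ((!) \<Gamma>') [t..<t + q]) f x"
  shows "(\<Sum>A\<in>{A\<in>fibre w \<Gamma> t q A1 y A3 \<inter> admissible \<Delta> S w \<Gamma>. adm_down \<Delta> S w \<Gamma> A = d}. (-1::int) ^
      neg_count \<Delta> S \<Gamma> A) =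
    (\<Sum>A\<in>{A\<in>fibre w \<Gamma>' t q A1 y A3 \<inter> admissible \<Delta> S w \<Gamma>'. adm_down \<Delta> S w \<Gamma>' A = d}. (-1) ^ neg_count
        \<Delta> S \<Gamma>' A)"
proof (cases "A1 \<subseteq> {..<t} \<and> A3 \<subseteq> {t + q..<length \<Gamma>}")
  case False
  then have "fibre w \<Gamma> t q A1 y A3 = {}" "fibre w \<Gamma>' t q A1 y A3 = {}"
    by (auto simp: fibre_def len)
  then show ?thesis by simp
next
  case True
  show ?thesis
  proof (rule graded_sums_eq)
    show "finite (fibre w \<Gamma> t q A1 y A3 \<inter> admissible \<Delta> S w \<Gamma>)"
      "finite (fibre w \<Gamma>' t q A1 y A3 \<inter> admissible \<Delta> S w \<Gamma>')" by (simp_all add: finite_fibre)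
    have sum: "(\<Sum>A\<in>fibre w G t q A1 y A3 \<inter> admissible \<Delta> S w G.
        of_int ((-1) ^ neg_count \<Delta> S G A) * exp (\<mu> \<bullet> adm_down \<Delta> S w G A)) =
        (\<Sum>A\<in>fibre w G t q A1 y A3. amplitude \<mu> w G A)"
      if "\<And>j. j < length G \<Longrightarrow> G ! j \<in> \<Delta>" for G \<mu>
      by (rule sum.mono_neutral_cong_left) (use amplitude_eq[OF _ that] in \<open>auto simp: finite_fibre
          fibre_def\<close>)
    show "(\<Sum>A\<in>fibre w \<Gamma> t q A1 y A3 \<inter> admissible \<Delta> S w \<Gamma>.
        of_int ((-1) ^ neg_count \<Delta> S \<Gamma> A) * exp (\<mu> \<bullet> adm_down \<Delta> S w \<Gamma> A)) =
      (\<Sum>A\<in>fibre w \<Gamma>' t q A1 y A3 \<inter> admissible \<Delta> S w \<Gamma>'.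
        of_int ((-1) ^ neg_count \<Delta> S \<Gamma>' A) * exp (\<mu> \<bullet> adm_down \<Delta> S w \<Gamma>' A))" for \<mu>
      using sum[of \<Gamma>] sum[of \<Gamma>'] roots roots' len fibre_amplitude_eq[OF _ _ yb] True by simp
  qed
qed

end

section \<open>Weight and height\<close>

text \<open>The composite in \<open>adm_wt\<close> cut off at position m, so that it can be compared
  with \<open>walk\<close> step by step.\<close>

definition partial_refl ::
  "'a::euclidean_space set \<Rightarrow> 'a set \<Rightarrow> 'a list \<Rightarrow> nat set \<Rightarrow> nat \<Rightarrow> 'a \<Rightarrow> 'a" where
  "partial_refl \<Delta> S \<Gamma> A m =
     foldr (\<lambda>j. affine_refl (\<Gamma> ! j) (- chain_l \<Delta> S \<Gamma> j)) (sorted_list_of_set (A \<inter> {..<m}))"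

lemma partial_refl_0: "partial_refl \<Delta> S \<Gamma> A 0 \<nu> = \<nu>"
  by (simp add: partial_refl_def)

lemma partial_refl_Suc:
  "partial_refl \<Delta> S \<Gamma> A (Suc m) \<nu> = partial_refl \<Delta> S \<Gamma> A m
     (if m \<in> A then affine_refl (\<Gamma> ! m) (- chain_l \<Delta> S \<Gamma> m) \<nu> else \<nu>)"
  by (simp add: partial_refl_def sorted_list_of_set_Int_Suc)

lemma adm_wt_partial_refl:
  assumes "A \<subseteq> {..<length \<Gamma>}"
  shows "adm_wt \<Delta> S lam w \<Gamma> A = - w (partial_refl \<Delta> S \<Gamma> A (length \<Gamma>) (- lam))"
proof -
  have "A \<inter> {..<length \<Gamma>} = A" using assms by auto
  then show ?thesis by (simp add: adm_wt_def partial_refl_def)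
qed

text \<open>All affine reflections of the string fix c, so together they act as the linear walk
  around c.\<close>

lemma partial_refl_center:
  assumes "\<And>j. t \<le> j \<Longrightarrow> j < t + q \<Longrightarrow> pairing c (\<Gamma> ! j) = - of_int (chain_l \<Delta> S \<Gamma> j)" "i \<le> q"
  shows "partial_refl \<Delta> S \<Gamma> A (t + i) \<nu> = partial_refl \<Delta> S \<Gamma> A t (c + steps \<Gamma> A t id i (\<nu> - c))"
  using assms(2)
proof (induction i arbitrary: \<nu>)
  case (Suc i)
  have "pairing c (\<Gamma> ! (t + i)) = of_int (- chain_l \<Delta> S \<Gamma> (t + i))"
    using assms(1)[of "t + i"] Suc.prems by simp
  from affine_refl_center[OF this] show ?case using Suc by (simp add: partial_refl_Suc)
qed simp

context similar_chains
begin

context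
  fixes A A' :: "nat set"
  assumes A: "A \<subseteq> {..<length \<Gamma>}" "A' \<subseteq> {..<length \<Gamma>}"
    and first: "A \<inter> {..<t} = A' \<inter> {..<t}"
    and third: "A \<inter> {t + q..<length \<Gamma>} = A' \<inter> {t + q..<length \<Gamma>}"
    and end2: "walk \<Delta> S w \<Gamma> A (t + q) = walk \<Delta> S w \<Gamma>' A' (t + q)"
begin

lemma mem_first: "j < t \<Longrightarrow> j \<in> A \<longleftrightarrow> j \<in> A'"
  using first by auto

lemma mem_third: "t + q \<le> j \<Longrightarrow> j \<in> A \<longleftrightarrow> j \<in> A'"
  using third A by (cases "j < length \<Gamma>") auto

lemma walk_first: "m \<le> t \<Longrightarrow> walk \<Delta> S w \<Gamma> A m = walk \<Delta> S w \<Gamma>' A' m"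
  by (rule walk_cong_first[where t = t]) (use mem_first outer tq in auto)

lemma walk_third: "t + q \<le> m \<Longrightarrow> walk \<Delta> S w \<Gamma> A m = walk \<Delta> S w \<Gamma>' A' m"
proof -
  assume "t + q \<le> m"
  then obtain i where i: "m = t + q + i" using le_Suc_ex by blast
  show ?thesis
    unfolding i walk_steps[where m = "t + q" and i = i] end2
    by (rule steps_cong) (use mem_third outer A in auto)
qed

lemma partial_refl_first: "m \<le> t \<Longrightarrow> partial_refl \<Delta> S \<Gamma> A m \<nu> = partial_refl \<Delta> S \<Gamma>' A' m \<nu>"
  by (induction m arbitrary: \<nu>) (use mem_first outer tq in \<open>auto simp: partial_refl_0 partial_refl_Suc\<close>)

text \<open>The walks agree before the string and are injective maps, so equal ends force the same
  linear map inside the string; around the common center c this determines the affine map.\<close>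

lemma partial_refl_middle: "partial_refl \<Delta> S \<Gamma> A (t + q) \<nu> = partial_refl \<Delta> S \<Gamma>' A' (t + q) \<nu>"
proof -
  have inj: "inj (walk \<Delta> S w \<Gamma> A t)"
    by (rule weyl_inj[OF walk_weyl[OF w]]) (use roots tq in auto)
  have "walk \<Delta> S w \<Gamma> A t \<circ> steps \<Gamma> A t id q = walk \<Delta> S w \<Gamma>' A' t \<circ> steps \<Gamma>' A' t id q"
    using end2 unfolding walk_steps[where m = t and i = q]
      steps_comp[of _ _ _ "walk \<Delta> S w \<Gamma> A t"] steps_comp[of _ _ _ "walk \<Delta> S w \<Gamma>' A' t"] .
  then have "steps \<Gamma> A t id q x = steps \<Gamma>' A' t id q x" for x
    using inj walk_first[of t] by (auto simp: fun_eq_iff dest: injD)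
  then show ?thesis
    using partial_refl_center[OF center order_refl, where A = A and \<nu> = \<nu>]
      partial_refl_center[OF center' order_refl, where A = A' and \<nu> = \<nu>]
      partial_refl_first by simp
qed

lemma adm_wt_eq: "adm_wt \<Delta> S lam w \<Gamma> A = adm_wt \<Delta> S lam w \<Gamma>' A'"
proof -
  have "t + q + i \<le> length \<Gamma> \<Longrightarrow>
      partial_refl \<Delta> S \<Gamma> A (t + q + i) \<nu> = partial_refl \<Delta> S \<Gamma>' A' (t + q + i) \<nu>" for i \<nu>
  proof (induction i arbitrary: \<nu>)
    case 0
    then show ?case using partial_refl_middle by simp
  next
    case (Suc i)
    then show ?case using mem_third[of "t + q + i"] outer[of "t + q + i"] by (simp add: partial_refl_Suc)
  qed
  from this[of "length \<Gamma> - (t + q)"] show ?thesis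
    using A tq len by (simp add: adm_wt_partial_refl)
qed

text \<open>The quantum steps outside the string agree, so equality of \<open>down\<close> passes to
  the contributions D and D' of the string. There the factor of each step is the inner product of
  \<open>lam + c\<close> with the coroot that the step adds to \<open>down\<close>.\<close>

lemma adm_height_eq:
  assumes down: "adm_down \<Delta> S w \<Gamma> A = adm_down \<Delta> S w \<Gamma>' A'"
  shows "adm_height \<Delta> S lam w \<Gamma> A = adm_height \<Delta> S lam w \<Gamma>' A'"
proof -
  let ?Q = "quantum_steps \<Delta> S w \<Gamma> A" and ?Q' = "quantum_steps \<Delta> S w \<Gamma>' A'"
  let ?O = "{..<t} \<union> {t + q..<length \<Gamma>}" and ?M = "{t..<t + q}"
  have fin: "finite ?Q" "finite ?Q'"
    using A by (auto intro: finite_subset[of _ "{..<length \<Gamma>}"] simp: quantum_steps_def)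
  have Qsub: "?Q \<subseteq> {..<length \<Gamma>}" "?Q' \<subseteq> {..<length \<Gamma>}" using A by (auto simp: quantum_steps_def)
  have Qout: "?Q \<inter> ?O = ?Q' \<inter> ?O"
  proof -
    have "j \<in> ?Q \<longleftrightarrow> j \<in> ?Q'" if "j \<in> ?O" for j
    proof -
      have "walk \<Delta> S w \<Gamma> A j = walk \<Delta> S w \<Gamma>' A' j" "walk \<Delta> S w \<Gamma> A (Suc j) = walk \<Delta> S w \<Gamma>' A' (Suc j)"
        "j \<in> A \<longleftrightarrow> j \<in> A'" "\<Gamma>' ! j = \<Gamma> ! j"
        using that walk_first walk_third mem_first mem_third outer tq by auto
      then show ?thesis by (simp add: quantum_steps_def)
    qed
    then show ?thesis by blast
  qed
  have split: "(\<Sum>j\<in>Q. f j) = (\<Sum>j\<in>Q \<inter> ?O. f j) + (\<Sum>j\<in>Q \<inter> ?M. f j)"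
    if "finite Q" "Q \<subseteq> {..<length \<Gamma>}" for Q and f :: "nat \<Rightarrow> 'b::comm_monoid_add"
  proof -
    have "Q = (Q \<inter> ?O) \<union> (Q \<inter> ?M)" using that(2) by auto
    moreover have "(Q \<inter> ?O) \<inter> (Q \<inter> ?M) = {}" by auto
    ultimately show ?thesis using that(1) by (metis finite_Int sum.union_disjoint)
  qed
  define D where "D = (\<Sum>j\<in>?Q \<inter> ?M. coroot (root_abs \<Delta> S (\<Gamma> ! j)))"
  define D' where "D' = (\<Sum>j\<in>?Q' \<inter> ?M. coroot (root_abs \<Delta> S (\<Gamma>' ! j)))"
  have outD: "(\<Sum>j\<in>?Q \<inter> ?O. coroot (root_abs \<Delta> S (\<Gamma> ! j))) =
      (\<Sum>j\<in>?Q' \<inter> ?O. coroot (root_abs \<Delta> S (\<Gamma>' ! j)))"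
    unfolding Qout by (rule sum.cong[OF refl]) (use outer tq in auto)
  have "D = D'"
    using down outD unfolding adm_down_def D_def D'_def split[OF fin(1) Qsub(1)] split[OF fin(2) Qsub(2)]
    by simp
  have mid: "(\<Sum>j\<in>Q \<inter> ?M. root_sgn \<Delta> S (G ! j) * chain_l_tilde \<Delta> S lam G j) =
      (lam + c) \<bullet> (\<Sum>j\<in>Q \<inter> ?M. coroot (root_abs \<Delta> S (G ! j)))"
    if "\<And>j. t \<le> j \<Longrightarrow> j < t + q \<Longrightarrow> pairing c (G ! j) = - of_int (chain_l \<Delta> S G j)" for G Q
  proof -
    have "root_sgn \<Delta> S (G ! j) * chain_l_tilde \<Delta> S lam G j = (lam + c) \<bullet> coroot (root_abs \<Delta> S (G ! j))"
      if "j \<in> Q \<inter> ?M" for j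
    proof -
      have "chain_l_tilde \<Delta> S lam G j = pairing (lam + c) (G ! j)"
        using that \<open>\<And>j. t \<le> j \<Longrightarrow> j < t + q \<Longrightarrow> pairing c (G ! j) = - of_int (chain_l \<Delta> S G j)\<close>[of j]
        by (simp add: chain_l_tilde_def pairing_add_left)
      then show ?thesis by (simp add: coroot_root_abs pairing_def)
    qed
    then show ?thesis unfolding inner_sum_right by (rule sum.cong[OF refl])
  qed
  have "(\<Sum>j\<in>?Q \<inter> ?O. root_sgn \<Delta> S (\<Gamma> ! j) * chain_l_tilde \<Delta> S lam \<Gamma> j) =
      (\<Sum>j\<in>?Q' \<inter> ?O. root_sgn \<Delta> S (\<Gamma>' ! j) * chain_l_tilde \<Delta> S lam \<Gamma>' j)"
    unfolding Qout by (rule sum.cong[OF refl]) (use outer tq in \<open>auto simp: chain_l_tilde_def\<close>)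
  moreover have "(\<Sum>j\<in>?Q \<inter> ?M. root_sgn \<Delta> S (\<Gamma> ! j) * chain_l_tilde \<Delta> S lam \<Gamma> j) = (lam + c) \<bullet> D"
    unfolding D_def by (rule mid[OF center])
  moreover have "(\<Sum>j\<in>?Q' \<inter> ?M. root_sgn \<Delta> S (\<Gamma>' ! j) * chain_l_tilde \<Delta> S lam \<Gamma>' j) = (lam + c) \<bullet> D"
    unfolding \<open>D = D'\<close> D'_def by (rule mid[OF center'])
  ultimately show ?thesis
    unfolding adm_height_def split[OF fin(1) Qsub(1)] split[OF fin(2) Qsub(2)] by simp
qed

end

end

text \<open>The first conjunct ensures that the integers attached to \<open>\<Gamma>\<^sub>2\<close>
  come from an actual alcove path.\<close>

theorem theorem3p4:
  fixes \<Delta> S :: "'a::euclidean_space set"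
    and lam \<alpha> \<beta> :: 'a
    and \<Gamma>\<^sub>1 \<Gamma>\<^sub>2 :: "'a list"
    and w :: "'a \<Rightarrow> 'a"
    and t q :: nat
  assumes "root_system \<Delta>"
    and "irreducible_roots \<Delta> \<or> type_A1_A1 \<Delta>"
    and "simple_system \<Delta> S"
    and "lam \<in> weight_lattice S"
    and "lambda_chain \<Delta> S lam \<Gamma>\<^sub>1"
    and "q \<ge> 1"
    and "t + q \<le> length \<Gamma>\<^sub>1"
    and "\<alpha> \<in> \<Delta>" and "\<beta> \<in> \<Delta>"
    and "pairing \<alpha> \<beta> \<le> 0" and "\<alpha> \<noteq> - \<beta>"
    and "take q (drop t \<Gamma>\<^sub>1) = rank2_string \<alpha> \<beta>"
    and "\<Gamma>\<^sub>2 = take t \<Gamma>\<^sub>1 @ rev (take q (drop t \<Gamma>\<^sub>1)) @ drop (t + q) \<Gamma>\<^sub>1"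
    and "w \<in> weyl_group \<Delta>"
  shows "lambda_chain \<Delta> S lam \<Gamma>\<^sub>2 \<and>
    (\<exists>\<A>\<^sub>1 \<A>\<^sub>2 Y I\<^sub>1 I\<^sub>2.
      \<A>\<^sub>1 \<subseteq> admissible \<Delta> S w \<Gamma>\<^sub>1 \<and>
      \<A>\<^sub>2 \<subseteq> admissible \<Delta> S w \<Gamma>\<^sub>2 \<and>
      bij_betw Y \<A>\<^sub>1 \<A>\<^sub>2 \<and>
      (\<forall>A\<in>\<A>\<^sub>1.
         Y A \<inter> {..<t} = A \<inter> {..<t} \<and>
         walk \<Delta> S w \<Gamma>\<^sub>2 (Y A) (t + q) = walk \<Delta> S w \<Gamma>\<^sub>1 A (t + q) \<and>
         Y A \<inter> {t + q..<length \<Gamma>\<^sub>1} = A \<inter> {t + q..<length \<Gamma>\<^sub>1} \<and>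
         adm_down \<Delta> S w \<Gamma>\<^sub>2 (Y A) = adm_down \<Delta> S w \<Gamma>\<^sub>1 A \<and>
         (-1::int) ^ neg_count \<Delta> S \<Gamma>\<^sub>2 (Y A) = (-1) ^ neg_count \<Delta> S \<Gamma>\<^sub>1 A \<and>
         adm_wt \<Delta> S lam w \<Gamma>\<^sub>2 (Y A) = adm_wt \<Delta> S lam w \<Gamma>\<^sub>1 A \<and>
         adm_height \<Delta> S lam w \<Gamma>\<^sub>2 (Y A) = adm_height \<Delta> S lam w \<Gamma>\<^sub>1 A) \<and>
      (\<forall>(\<Gamma>, \<A>, I) \<in> {(\<Gamma>\<^sub>1, \<A>\<^sub>1, I\<^sub>1), (\<Gamma>\<^sub>2, \<A>\<^sub>2, I\<^sub>2)}.
         \<forall>A \<in> admissible \<Delta> S w \<Gamma> - \<A>.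
           I A \<in> admissible \<Delta> S w \<Gamma> - \<A> \<and>
           I (I A) = A \<and>
           I A \<inter> {..<t} = A \<inter> {..<t} \<and>
           walk \<Delta> S w \<Gamma> (I A) (t + q) = walk \<Delta> S w \<Gamma> A (t + q) \<and>
           I A \<inter> {t + q..<length \<Gamma>} = A \<inter> {t + q..<length \<Gamma>} \<and>
           adm_down \<Delta> S w \<Gamma> (I A) = adm_down \<Delta> S w \<Gamma> A \<and>
           (-1::int) ^ neg_count \<Delta> S \<Gamma> (I A) = - ((-1) ^ neg_count \<Delta> S \<Gamma> A) \<and>
           adm_wt \<Delta> S lam w \<Gamma> (I A) = adm_wt \<Delta> S lam w \<Gamma> A \<and>
           adm_height \<Delta> S lam w \<Gamma> (I A) = adm_height \<Delta> S lam w \<Gamma> A))"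
proof -
  interpret based_root_system \<Delta> S using assms(1,3) by unfold_locales
  have r2: "rank2 \<alpha> \<beta>"
    using rank2_pairing_cases[OF assms(1,8-11)] by unfold_locales
  obtain c where chain: "lambda_chain \<Delta> S lam \<Gamma>\<^sub>2"
    and outer: "\<And>j. j < length \<Gamma>\<^sub>1 \<Longrightarrow> j < t \<or> t + q \<le> j \<Longrightarrow> chain_l \<Delta> S \<Gamma>\<^sub>2 j = chain_l \<Delta> S \<Gamma>\<^sub>1 j"
    and c1: "\<And>j. t \<le> j \<Longrightarrow> j < t + q \<Longrightarrow> pairing c (\<Gamma>\<^sub>1 ! j) = - of_int (chain_l \<Delta> S \<Gamma>\<^sub>1 j)"
    and c2: "\<And>j. t \<le> j \<Longrightarrow> j < t + q \<Longrightarrow> pairing c (\<Gamma>\<^sub>2 ! j) = - of_int (chain_l \<Delta> S \<Gamma>\<^sub>2 j)"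
    using reverse_rank2_segment[OF r2 assms(5,7,12,13)] by blast
  note nth = nth_reverse_segment[OF assms(7,13)]
  have roots: "G ! j \<in> \<Delta>" if "lambda_chain \<Delta> S lam G" "j < length G" for G j
    using that alcove_path_step(2) unfolding lambda_chain_def by blast
  note roots1 = roots[OF assms(5)] and roots2 = roots[OF chain, unfolded nth(1)]
  have sim11: "similar_chains \<Delta> S \<Gamma>\<^sub>1 \<Gamma>\<^sub>1 t q c w"
    by unfold_locales (simp_all add: assms(7,14) roots1 c1)
  have sim22: "similar_chains \<Delta> S \<Gamma>\<^sub>2 \<Gamma>\<^sub>2 t q c w"
    by unfold_locales (simp_all add: assms(7,14) nth(1) roots2 c2)
  interpret similar_chains \<Delta> S \<Gamma>\<^sub>1 \<Gamma>\<^sub>2 t q c w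
    by unfold_locales (use assms(7,14) nth roots1 roots2 outer c1 c2 in auto)
  have mid1: "map ((!) \<Gamma>\<^sub>1) [t..<t + q] = rank2_string \<alpha> \<beta>"
    unfolding assms(12)[symmetric]
    by (rule nth_equalityI) (use assms(7) in auto)
  have mid2: "map ((!) \<Gamma>\<^sub>2) [t..<t + q] = rank2_string \<beta> \<alpha>"
    unfolding rank2.rank2_string_swap[OF r2] assms(12)[symmetric]
    by (rule nth_equalityI) (use assms(7) nth(3) in \<open>auto simp: rev_nth\<close>)
  \<comment> \<open>Weight and height are not part of the key; \<open>stats\<close> derives them
    from it.\<close>
  define key where "key G A = (A \<inter> {..<t}, walk \<Delta> S w G A (t + q), A \<inter> {t + q..<length \<Gamma>\<^sub>1},
      adm_down \<Delta> S w G A)" for G A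
  let ?X = "admissible \<Delta> S w" and ?s = "\<lambda>G A. (-1::int) ^ neg_count \<Delta> S G A"
  have sub: "A \<subseteq> {..<length G}" if "A \<in> ?X G" for A G using that by (simp add: admissible_def)
  have fin: "finite (?X G)" for G
    by (rule finite_subset[of _ "Pow {..<length G}"]) (auto simp: admissible_def)
  have pm: "?s G A = 1 \<or> ?s G A = - 1" for G A by (cases "even (neg_count \<Delta> S G A)") auto
  \<comment> \<open>Fixing the key amounts to fixing a fibre and \<open>down\<close>, the form in
    which \<open>signed_count_eq\<close> compares the chains.\<close>
  have fib: "{A\<in>?X G. key G A = (A1, y, A3, d)} =
      {A\<in>fibre w G t q A1 y A3 \<inter> ?X G. adm_down \<Delta> S w G A = d}" if "length G = length \<Gamma>\<^sub>1" for G A1 y A3 d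
    using sub[of _ G] that by (auto simp: key_def fibre_def)
  have count: "(\<Sum>A\<in>{A\<in>?X \<Gamma>\<^sub>1. key \<Gamma>\<^sub>1 A = k}. ?s \<Gamma>\<^sub>1 A) = (\<Sum>A\<in>{A\<in>?X \<Gamma>\<^sub>2. key \<Gamma>\<^sub>2 A = k}. ?s \<Gamma>\<^sub>2 A)" for k
  proof -
    obtain A1 y A3 d where k: "k = (A1, y, A3, d)" by (cases k)
    show ?thesis
      unfolding k fib[OF refl] fib[OF nth(1)]
      by (rule signed_count_eq) (simp only: mid1 mid2 psum_string[OF assms(8,9) r2])
  qed
  obtain C1 C2 Y I1 I2 where C: "C1 \<subseteq> ?X \<Gamma>\<^sub>1" "C2 \<subseteq> ?X \<Gamma>\<^sub>2" and Y: "bij_betw Y C1 C2"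
    and YC: "\<And>A. A \<in> C1 \<Longrightarrow> key \<Gamma>\<^sub>2 (Y A) = key \<Gamma>\<^sub>1 A \<and> ?s \<Gamma>\<^sub>2 (Y A) = ?s \<Gamma>\<^sub>1 A"
    and I1: "\<And>A. A \<in> ?X \<Gamma>\<^sub>1 - C1 \<Longrightarrow> I1 A \<in> ?X \<Gamma>\<^sub>1 - C1 \<and> I1 (I1 A) = A \<and>
      key \<Gamma>\<^sub>1 (I1 A) = key \<Gamma>\<^sub>1 A \<and> ?s \<Gamma>\<^sub>1 (I1 A) = - ?s \<Gamma>\<^sub>1 A"
    and I2: "\<And>A. A \<in> ?X \<Gamma>\<^sub>2 - C2 \<Longrightarrow> I2 A \<in> ?X \<Gamma>\<^sub>2 - C2 \<and> I2 (I2 A) = A \<and>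
      key \<Gamma>\<^sub>2 (I2 A) = key \<Gamma>\<^sub>2 A \<and> ?s \<Gamma>\<^sub>2 (I2 A) = - ?s \<Gamma>\<^sub>2 A"
    by (rule signed_matching[OF fin fin pm pm count]) (rule that)
  have stats: "adm_wt \<Delta> S lam w G' A' = adm_wt \<Delta> S lam w G A \<and> adm_height \<Delta> S lam w G' A' =
      adm_height \<Delta> S lam w G A"
    if "similar_chains \<Delta> S G G' t q c w" "A \<in> ?X G" "A' \<in> ?X G'" "key G' A' = key G A" "length G =
        length \<Gamma>\<^sub>1" for G G' A A'
  proof -
    interpret sim: similar_chains \<Delta> S G G' t q c w by (rule that(1))
    have "A \<subseteq> {..<length G}" "A' \<subseteq> {..<length G}" using sub that(2,3) sim.len by metis+
    moreover have "A \<inter> {..<t} = A' \<inter> {..<t}" "A \<inter> {t + q..<length G} = A' \<inter> {t + q..<length G}"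
      "walk \<Delta> S w G A (t + q) = walk \<Delta> S w G' A' (t + q)" "adm_down \<Delta> S w G A = adm_down \<Delta> S w G' A'"
      using that(4,5) by (auto simp: key_def)
    ultimately show ?thesis using sim.adm_wt_eq sim.adm_height_eq by metis
  qed
  have Ymem: "Y A \<in> ?X \<Gamma>\<^sub>2" if "A \<in> C1" for A using bij_betwE[OF Y] that C by blast
  show ?thesis
  proof (rule conjI[OF chain], rule exI[of _ C1], rule exI[of _ C2], rule exI[of _ Y],
      rule exI[of _ I1], rule exI[of _ I2], intro conjI C Y ballI)
    fix A assume A: "A \<in> C1"
    note kA = YC[OF A]
    note st = stats[OF similar_chains_axioms subsetD[OF C(1) A] Ymem[OF A] kA[THEN conjunct1] refl]
    show "Y A \<inter> {..<t} = A \<inter> {..<t}" "walk \<Delta> S w \<Gamma>\<^sub>2 (Y A) (t + q) = walk \<Delta> S w \<Gamma>\<^sub>1 A (t + q)"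
      "Y A \<inter> {t + q..<length \<Gamma>\<^sub>1} = A \<inter> {t + q..<length \<Gamma>\<^sub>1}"
      "adm_down \<Delta> S w \<Gamma>\<^sub>2 (Y A) = adm_down \<Delta> S w \<Gamma>\<^sub>1 A" "?s \<Gamma>\<^sub>2 (Y A) = ?s \<Gamma>\<^sub>1 A"
      "adm_wt \<Delta> S lam w \<Gamma>\<^sub>2 (Y A) = adm_wt \<Delta> S lam w \<Gamma>\<^sub>1 A"
      "adm_height \<Delta> S lam w \<Gamma>\<^sub>2 (Y A) = adm_height \<Delta> S lam w \<Gamma>\<^sub>1 A"
      using kA st by (simp_all add: key_def)
  next
    fix T assume "T \<in> {(\<Gamma>\<^sub>1, C1, I1), (\<Gamma>\<^sub>2, C2, I2)}"
    then obtain G C I where T: "T = (G, C, I)" and sim: "similar_chains \<Delta> S G G t q c w"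
      and len: "length G = length \<Gamma>\<^sub>1"
      and I: "\<And>A. A \<in> ?X G - C \<Longrightarrow> I A \<in> ?X G - C \<and> I (I A) = A \<and>
        key G (I A) = key G A \<and> ?s G (I A) = - ?s G A"
      using sim11 sim22 I1 I2 nth(1) by blast
    have "I A \<in> ?X G - C \<and> I (I A) = A \<and> I A \<inter> {..<t} = A \<inter> {..<t} \<and>
        walk \<Delta> S w G (I A) (t + q) = walk \<Delta> S w G A (t + q) \<and>
        I A \<inter> {t + q..<length G} = A \<inter> {t + q..<length G} \<and>
        adm_down \<Delta> S w G (I A) = adm_down \<Delta> S w G A \<and> ?s G (I A) = - ?s G A \<and>
        adm_wt \<Delta> S lam w G (I A) = adm_wt \<Delta> S lam w G A \<and>
        adm_height \<Delta> S lam w G (I A) = adm_height \<Delta> S lam w G A" if A: "A \<in> ?X G - C" for A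
    proof -
      note IA = I[OF A]
      have st: "adm_wt \<Delta> S lam w G (I A) = adm_wt \<Delta> S lam w G A \<and>
          adm_height \<Delta> S lam w G (I A) = adm_height \<Delta> S lam w G A"
        by (rule stats[OF sim _ _ _ len]) (use A IA in auto)
      show ?thesis using IA st len by (simp add: key_def)
    qed
    then show "case T of (\<Gamma>, \<A>, I) \<Rightarrow> \<forall>A\<in>?X \<Gamma> - \<A>.
        I A \<in> ?X \<Gamma> - \<A> \<and> I (I A) = A \<and> I A \<inter> {..<t} = A \<inter> {..<t} \<and>
        walk \<Delta> S w \<Gamma> (I A) (t + q) = walk \<Delta> S w \<Gamma> A (t + q) \<and>
        I A \<inter> {t + q..<length \<Gamma>} = A \<inter> {t + q..<length \<Gamma>} \<and>
        adm_down \<Delta> S w \<Gamma> (I A) = adm_down \<Delta> S w \<Gamma> A \<and> ?s \<Gamma> (I A) = - ?s \<Gamma> A \<and>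
        adm_wt \<Delta> S lam w \<Gamma> (I A) = adm_wt \<Delta> S lam w \<Gamma> A \<and>
        adm_height \<Delta> S lam w \<Gamma> (I A) = adm_height \<Delta> S lam w \<Gamma> A"
      unfolding T by simp
  qed
qed

end
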